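(* Let $K$ be a real quadratic field, and let $S$, $K_S$, $\mathcal{O}_K$ be as in the context. Let $\phi=(\phi_\sigma)_{\sigma\in S}:[0,1]\to K_S$ be a continuously differentiable map such that $\phi'_\sigma(x)\neq0$ for all but finitely many $x\in[0,1]$ and every $\sigma\in S$. For $x\in[0,1]$ define $$\Phi(x):=\left(\begin{pmatrix}1&\phi_\sigma(x)\\0&1\end{pmatrix}\right)_{\sigma\in S}\in \mathrm{SL}_2(K_S).$$ Let $g\in \mathrm{SL}_2(K_S)$ and $\Lambda=\mathrm{SL}_2(\mathcal{O}_K)g\in \mathrm{SL}_2(\mathcal{O}_K)\backslash \mathrm{SL}_2(K_S)$. Then the set $$\bigcap_{\mathbf{r}\in\mathbb{Q}^2_+}\{x\in[0,1] : \Lambda\Phi(x)\text{ has bounded trajectory under the flow } g(\mathbf{r})_t\}$$ is winning in the sense of Schmidt (as a subset of $[0,1]$). Here $\mathbb{Q}^2_+$ denotes the set of rational vectors $\mathbf{r}=(r_\sigma)_{\sigma\in S}\in\mathbb{Q}^2$ with $r_\sigma\ge0$ for all $\sigma\in S$ and $\sum_{\sigma\in S}r_\sigma=1$, and for $t\ge 0$ $$g(\mathbf{r})_t:=\left(\begin{pmatrix}e^{-r_\sigma t}&0\\0&e^{r_\sigma t}\end{pmatrix}\right)_{\sigma\in S}$$ acts on $\mathrm{SL}_2(\mathcal{O}_K)\backslash \mathrm{SL}_2(K_S)$ by right multiplication.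
   Context: Number field notation. $K$ is a real quadratic extension of $\mathbb{Q}$, $\mathcal{O}_K$ is its ring of integers, $S$ is the set of its two real embeddings $\sigma:K\to\mathbb{R}$, and $K_S:=\mathbb{R}^2$ with coordinates indexed by $S$. $\tau:K\to K_S$, $\tau(x)=(\sigma(x))_{\sigma\in S}$, is extended entrywise to vectors and matrices. $\mathrm{SL}_2(K_S)=\prod_{\sigma\in S}\mathrm{SL}_2(\mathbb{R})$, and $\mathrm{SL}_2(\mathcal{O}_K)$ is regarded as a subgroup of it via $\tau$. Bounded trajectory. A point $y\in \mathrm{SL}_2(\mathcal{O}_K)\backslash \mathrm{SL}_2(K_S)$ has bounded trajectory under $g(\mathbf{r})_t$ if $\{y\, g(\mathbf{r})_t : t\ge 0\}$ is relatively compact in $\mathrm{SL}_2(\mathcal{O}_K)\backslash \mathrm{SL}_2(K_S)$. Schmidt's game. Let $X$ be a complete metric space (here $X=[0,1]$ with the usual metric), $W\subseteq X$, and $0<\alpha,\beta<1$. Balls are closed balls $B(x,\rho)$ with specified center and radius. Player A first chooses an arbitrary ball $A_0=B(x_0,\rho)$; Player B chooses a ball $B_0=B(y_0,\alpha\rho)\subset A_0$. In general, at step $n$ Player A chooses a ball $A_n=B(x_n,(\alpha\beta)^n\rho)\subset B_{n-1}$ and then Player B chooses a ball $B_n=B(y_n,\alpha(\alpha\beta)^n\rho)\subset A_n$. The intersection $\bigcap_n A_n$ is a single point $x_\infty$; Player B wins if $x_\infty\in W$. $W$ is $(\alpha,\beta)$-winning if Player B has a winning strategy, $\alpha$-winning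 if it is $(\alpha,\beta)$-winning for all $0<\beta<1$, and winning (in the sense of Schmidt) if it is $\alpha$-winning for some $\alpha>0$. *)

theory Defs
  imports
    "HOL-Analysis.Analysis"
    "HOL-Algebra.Coset"
    "HOL-Algebra.Product_Groups"
    "HOL-Computational_Algebra.Polynomial"
begin

section \<open>Real quadratic fields\<close>

text \<open>The field $K$ is the universe of a type \<open>'k\<close> of characteristic zero.\<close>

definition real_embeddings :: "('k::field_char_0 \<Rightarrow> real) set" where
  "real_embeddings = {\<sigma>. \<sigma> 1 = 1 \<and> (\<forall>x y. \<sigma> (x + y) = \<sigma> x + \<sigma> y) \<and> (\<forall>x y. \<sigma> (x * y) = \<sigma> x * \<sigma> y)}"

text \<open>
  The library dimension is 0 for spaces that are not finite-dimensional, so the first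
  conjunct says exactly $[K : \mathbf{Q}] = 2$. A quadratic field with one real embedding has two.
\<close>

definition real_quadratic_field :: "'k::field_char_0 itself \<Rightarrow> bool" where
  "real_quadratic_field _ \<longleftrightarrow>
     vector_space.dim (\<lambda>q x. of_rat q * x) (UNIV :: 'k set) = 2 \<and>
     (real_embeddings :: ('k \<Rightarrow> real) set) \<noteq> {}"


section \<open>The group \<open>SL\<^sub>2(K\<^sub>S)\<close> and its quotient by \<open>SL\<^sub>2(O\<^sub>K)\<close>\<close>

definition SL2_real :: "(real^2^2) monoid" where
  "SL2_real = \<lparr>carrier = {A. det A = 1}, monoid.mult = (**), one = mat 1\<rparr>"

text \<open>
  Elements of $K_S$ and of $\mathrm{SL}_2(K_S)$ are families indexed by the embeddings. Elements of the
  product group are extensional, that is \<open>undefined\<close> outside \<^const>\<open>real_embeddings\<close>.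
\<close>

definition SL2_KS :: "(('k::field_char_0 \<Rightarrow> real) \<Rightarrow> real^2^2) monoid" where
  "SL2_KS = product_group real_embeddings (\<lambda>_. SL2_real)"

definition SL2_KS_topology :: "(('k::field_char_0 \<Rightarrow> real) \<Rightarrow> real^2^2) topology" where
  "SL2_KS_topology = product_topology (\<lambda>_. top_of_set (carrier SL2_real)) real_embeddings"

definition SL2_OK :: "(('k::field_char_0 \<Rightarrow> real) \<Rightarrow> real^2^2) set" where
  "SL2_OK = {(\<lambda>\<sigma>\<in>real_embeddings. map_matrix \<sigma> A) | A :: 'k^2^2.
              (\<forall>i j. algebraic_int (A $ i $ j)) \<and> det A = 1}"

definition quotient_topology :: "'a topology \<Rightarrow> ('a \<Rightarrow> 'b) \<Rightarrow> 'b topology" where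
  "quotient_topology X f =
     topology (\<lambda>U. U \<subseteq> f ` topspace X \<and> openin X {x \<in> topspace X. f x \<in> U})"

text \<open>The points of $\mathrm{SL}_2(O_K)\backslash\mathrm{SL}_2(K_S)$ are the right cosets of \<^const>\<open>SL2_OK\<close>.\<close>

definition SL2_quotient_topology ::
    "(('k::field_char_0 \<Rightarrow> real) \<Rightarrow> real^2^2) set topology" where
  "SL2_quotient_topology =
     quotient_topology SL2_KS_topology (\<lambda>g. SL2_OK #>\<^bsub>SL2_KS\<^esub> g)"

text \<open>Right multiplication of a point (a coset) by a group element is again \<open>#>\<close>.\<close>

definition bounded_trajectory ::
    "(('k::field_char_0 \<Rightarrow> real) \<Rightarrow> real^2^2) set \<Rightarrow> (real \<Rightarrow> ('k \<Rightarrow> real) \<Rightarrow> real^2^2) \<Rightarrow> bool" where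
  "bounded_trajectory y F \<longleftrightarrow>
     compactin SL2_quotient_topology
       (SL2_quotient_topology closure_of {y #>\<^bsub>SL2_KS\<^esub> F t | t. t \<ge> 0})"

definition unipotent :: "(('k::field_char_0 \<Rightarrow> real) \<Rightarrow> real) \<Rightarrow> ('k \<Rightarrow> real) \<Rightarrow> real^2^2" where
  "unipotent u = (\<lambda>\<sigma>\<in>real_embeddings. vector [vector [1, u \<sigma>], vector [0, 1]])"

definition diag_flow :: "(('k::field_char_0 \<Rightarrow> real) \<Rightarrow> real) \<Rightarrow> real \<Rightarrow> ('k \<Rightarrow> real) \<Rightarrow> real^2^2" where
  "diag_flow r t =
     (\<lambda>\<sigma>\<in>real_embeddings. vector [vector [exp (- r \<sigma> * t), 0], vector [0, exp (r \<sigma> * t)]])"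

definition rational_weights :: "(('k::field_char_0 \<Rightarrow> real) \<Rightarrow> real) set" where
  "rational_weights =
     {r \<in> real_embeddings \<rightarrow>\<^sub>E \<rat>. (\<forall>\<sigma>\<in>real_embeddings. r \<sigma> \<ge> 0) \<and> (\<Sum>\<sigma>\<in>real_embeddings. r \<sigma>) = 1}"


section \<open>Schmidt's game\<close>

text \<open>
  The game is played on a subset \<open>X\<close> of a metric space, with the induced metric. A move is the
  centre of a ball, the radii being determined by the initial radius \<open>\<rho>\<close>; inclusion of balls
  is inclusion of subsets of \<open>X\<close>. A strategy of Player B maps \<open>\<rho>\<close> and the list of the
  centres chosen by Player A so far to the next centre of Player B.
\<close>

definition ball_in :: "'a::metric_space set \<Rightarrow> 'a \<Rightarrow> real \<Rightarrow> 'a set" where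
  "ball_in X x r = cball x r \<inter> X"

definition A_ball :: "'a::metric_space set \<Rightarrow> real \<Rightarrow> real \<Rightarrow> real \<Rightarrow> (nat \<Rightarrow> 'a) \<Rightarrow> nat \<Rightarrow> 'a set" where
  "A_ball X \<alpha> \<beta> \<rho> x n = ball_in X (x n) ((\<alpha> * \<beta>) ^ n * \<rho>)"

definition B_ball :: "'a::metric_space set \<Rightarrow> real \<Rightarrow> real \<Rightarrow> real \<Rightarrow> (nat \<Rightarrow> 'a) \<Rightarrow> nat \<Rightarrow> 'a set" where
  "B_ball X \<alpha> \<beta> \<rho> y n = ball_in X (y n) (\<alpha> * (\<alpha> * \<beta>) ^ n * \<rho>)"

definition A_legal ::
    "'a::metric_space set \<Rightarrow> real \<Rightarrow> real \<Rightarrow> real \<Rightarrow> (nat \<Rightarrow> 'a) \<Rightarrow> (nat \<Rightarrow> 'a) \<Rightarrow> nat \<Rightarrow> bool" where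
  "A_legal X \<alpha> \<beta> \<rho> x y n \<longleftrightarrow>
     x n \<in> X \<and> (n > 0 \<longrightarrow> A_ball X \<alpha> \<beta> \<rho> x n \<subseteq> B_ball X \<alpha> \<beta> \<rho> y (n - 1))"

definition B_legal ::
    "'a::metric_space set \<Rightarrow> real \<Rightarrow> real \<Rightarrow> real \<Rightarrow> (nat \<Rightarrow> 'a) \<Rightarrow> (nat \<Rightarrow> 'a) \<Rightarrow> nat \<Rightarrow> bool" where
  "B_legal X \<alpha> \<beta> \<rho> x y n \<longleftrightarrow> y n \<in> X \<and> B_ball X \<alpha> \<beta> \<rho> y n \<subseteq> A_ball X \<alpha> \<beta> \<rho> x n"

definition winning_strategy ::
    "'a::metric_space set \<Rightarrow> 'a set \<Rightarrow> real \<Rightarrow> real \<Rightarrow> (real \<Rightarrow> 'a list \<Rightarrow> 'a) \<Rightarrow> bool" where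
  "winning_strategy X W \<alpha> \<beta> s \<longleftrightarrow>
     (\<forall>\<rho>>0. \<forall>x. let y = (\<lambda>n. s \<rho> (map x [0..<Suc n])) in
        (\<forall>n. (\<forall>k\<le>n. A_legal X \<alpha> \<beta> \<rho> x y k) \<longrightarrow> B_legal X \<alpha> \<beta> \<rho> x y n) \<and>
        ((\<forall>n. A_legal X \<alpha> \<beta> \<rho> x y n) \<longrightarrow> (\<exists>p\<in>W. (\<Inter>n. A_ball X \<alpha> \<beta> \<rho> x n) = {p})))"

definition schmidt_winning :: "'a::metric_space set \<Rightarrow> 'a set \<Rightarrow> bool" where
  "schmidt_winning X W \<longleftrightarrow>
     (\<exists>\<alpha>. 0 < \<alpha> \<and> \<alpha> < 1 \<and> (\<forall>\<beta>. 0 < \<beta> \<and> \<beta> < 1 \<longrightarrow> (\<exists>s. winning_strategy X W \<alpha> \<beta> s)))"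


section \<open>Basic facts\<close>

lemma openin_quotient_topology:
  "openin (quotient_topology X f) U \<longleftrightarrow>
     U \<subseteq> f ` topspace X \<and> openin X {x \<in> topspace X. f x \<in> U}"
proof -
  have "istopology (\<lambda>U. U \<subseteq> f ` topspace X \<and> openin X {x \<in> topspace X. f x \<in> U})"
    unfolding istopology_def
  proof (intro conjI allI impI)
    fix S T
    assume S: "S \<subseteq> f ` topspace X \<and> openin X {x \<in> topspace X. f x \<in> S}"
      and T: "T \<subseteq> f ` topspace X \<and> openin X {x \<in> topspace X. f x \<in> T}"
    show "S \<inter> T \<subseteq> f ` topspace X" using S by blast
    have "{x \<in> topspace X. f x \<in> S \<inter> T} =
        {x \<in> topspace X. f x \<in> S} \<inter> {x \<in> topspace X. f x \<in> T}" by auto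
    then show "openin X {x \<in> topspace X. f x \<in> S \<inter> T}" using S T by auto
  next
    fix \<K> assume K: "\<forall>S\<in>\<K>. S \<subseteq> f ` topspace X \<and> openin X {x \<in> topspace X. f x \<in> S}"
    then show "\<Union>\<K> \<subseteq> f ` topspace X" by blast
    have "{x \<in> topspace X. f x \<in> \<Union>\<K>} = (\<Union>S\<in>\<K>. {x \<in> topspace X. f x \<in> S})" by auto
    then show "openin X {x \<in> topspace X. f x \<in> \<Union>\<K>}" using K by auto
  qed
  then show ?thesis
    by (simp add: quotient_topology_def topology_inverse')
qed

lemma topspace_quotient_topology: "topspace (quotient_topology X f) = f ` topspace X"
proof -
  have "openin (quotient_topology X f) (f ` topspace X)"
  proof -
    have "{x \<in> topspace X. f x \<in> f ` topspace X} = topspace X" by auto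
    then show ?thesis unfolding openin_quotient_topology by simp
  qed
  moreover have "topspace (quotient_topology X f) \<subseteq> f ` topspace X"
    by (meson openin_quotient_topology openin_topspace)
  ultimately show ?thesis
    by (meson openin_subset subset_antisym)
qed

lemma quotient_map_quotient_topology: "quotient_map X (quotient_topology X f) f"
  by (auto simp: quotient_map_def topspace_quotient_topology openin_quotient_topology)

lemma group_SL2_real: "group SL2_real"
proof (rule groupI)
  fix A :: "real^2^2" assume A: "A \<in> carrier SL2_real"
  then have "invertible A" by (simp add: SL2_real_def invertible_det_nz)
  then obtain B where B: "B ** A = mat 1" by (auto simp: invertible_def)
  then have "det B * det A = 1" by (metis det_I det_mul)
  with A B show "\<exists>B\<in>carrier SL2_real. B \<otimes>\<^bsub>SL2_real\<^esub> A = \<one>\<^bsub>SL2_real\<^esub>"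
    by (auto simp: SL2_real_def)
qed (auto simp: SL2_real_def det_mul matrix_mul_assoc)

lemma group_SL2_KS: "group SL2_KS"
  by (simp add: SL2_KS_def group_SL2_real)

lemma topspace_SL2_KS: "topspace SL2_KS_topology = carrier SL2_KS"
  by (simp add: SL2_KS_topology_def SL2_KS_def)

lemma topspace_SL2_quotient: "topspace SL2_quotient_topology = rcosets\<^bsub>SL2_KS\<^esub> SL2_OK"
  by (auto simp: SL2_quotient_topology_def topspace_quotient_topology topspace_SL2_KS RCOSETS_def)

end

theory Submission
  imports Defs
begin

text \<open>
  For a nonzero integral vector \<open>v \<in> O\<^sub>K\<^sup>2\<close> put \<open>(p\<^sub>\<sigma>, q\<^sub>\<sigma>) = \<sigma>(v) g\<^sub>\<sigma>\<close> and let \<open>H v x t\<close> be the product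
  over \<open>\<sigma>\<close> of \<open>max (\<bar>p\<^sub>\<sigma>\<bar> exp (- r\<^sub>\<sigma> t)) (\<bar>p\<^sub>\<sigma> \<phi>\<^sub>\<sigma>(x) + q\<^sub>\<sigma>\<bar> exp (r\<^sub>\<sigma> t))\<close>. By Minkowski's theorem
  the trajectory of \<open>x\<close> is bounded as soon as \<open>H v x t\<close> is bounded below uniformly in \<open>v\<close> and
  \<open>t \<ge> 0\<close>; finiteness of the class number is replaced by the finiteness of \<open>O\<^sub>K / d\<close>.

  Let \<open>\<sigma>\<^sub>1\<close> carry the larger weight and look at an interval of length about \<open>exp (- 2 r\<^sub>1 t)\<close>. If \<open>v\<close>, \<open>w\<close>
  have small \<open>H\<close> at two of its points around time \<open>t\<close>, then the norm of \<open>det (v, w)\<close> is less than \<open>1\<close>,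
  so \<open>v\<close> and \<open>w\<close> are proportional. If moreover \<open>H v x\<close> becomes much smaller after time \<open>t\<close>, then
  \<open>\<phi>\<^sub>1(x)\<close> is very close to \<open>- q\<^sub>1 / p\<^sub>1\<close>, a point that depends only on the line through \<open>v\<close>. Hence at
  each scale Player B has to avoid a single short interval. This costs one turn, so that countably
  many weights can be handled along disjoint arithmetic progressions of turns.
\<close>

section \<open>Schmidt's game on the unit interval\<close>

text \<open>The product is the right quantity because it is unchanged when v is multiplied by a
  unit, and because a bound for H(v) H(w) turns directly into a bound for the norm of det (v, w),
  which is a rational integer. The larger weight is the right clock because an interval of length
  exp (- 2 r1 t) is also short at the scale exp (- 2 r2 t) of the other embedding, so that both
  coordinates of the curve are as good as constant on it.

  Locating x from \<phi>_1(x) needs a lower bound for the derivative of \<phi>_1. For this reason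
  the finitely many critical points are expelled first; on the closed interval that is left, all
  bounds follow from compactness. The resulting constants depend on the interval and on the weight,
  but \<alpha> = 1/16 does not: the forbidden piece is made short relative to the ball by lowering
  the threshold \<open>\<eta>\<close>, never by changing \<alpha>. That is why countably many
  weights fit into one game: a weight that is served only every 2 * 2^k turns sees the same game
  with a smaller contraction ratio.\<close>

lemma avoid_small_set:
  fixes x \<rho> :: real
  assumes "0 < \<rho>" "\<rho> \<le> 1" "x \<in> {0..1}"
    and small: "\<And>u v. u \<in> E \<inter> ball_in {0..1} x \<rho> \<Longrightarrow> v \<in> E \<inter> ball_in {0..1} x \<rho> \<Longrightarrow> \<bar>u - v\<bar> \<le> \<rho> / 5"
  obtains y where "y \<in> {0..1}" "ball_in {0..1} y (1/16 * \<rho>) \<subseteq> ball_in {0..1} x \<rho>"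
    "ball_in {0..1} y (1/16 * \<rho>) \<inter> E = {}"
proof -
  \<comment> \<open>[a, a + \<rho>/2] is a half of the ball that stays inside [0,1]; this is where
    \<rho> \<le> 1 enters. The balls of radius \<rho>/16 at its two ends leave a gap of \<rho>/4 >
    \<rho>/5, so \<open>E\<close> cannot meet both.\<close>
  define a where "a = (if x \<le> 1/2 then x else x - \<rho> / 2)"
  have a: "0 \<le> a" "a + \<rho> / 2 \<le> 1" "x - \<rho> / 2 \<le> a" "a \<le> x"
    using assms(1-3) by (auto simp: a_def)
  define y z where "y = a + \<rho> / 16" and "z = a + 7 * \<rho> / 16"
  have "ball_in {0..1} c (1/16 * \<rho>) \<subseteq> ball_in {0..1} x \<rho>" if "c - \<rho> / 16 \<ge> a" "c + \<rho> / 16 \<le> a + \<rho> / 2" for c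
  proof
    fix t assume "t \<in> ball_in {0..1} c (1/16 * \<rho>)"
    then have "\<bar>c - t\<bar> \<le> \<rho> / 16" "t \<in> {0..1}" by (auto simp: ball_in_def dist_real_def)
    moreover from this have "\<bar>x - t\<bar> \<le> \<rho>" using a assms(1) that by linarith
    ultimately show "t \<in> ball_in {0..1} x \<rho>" by (auto simp: ball_in_def dist_real_def)
  qed
  then have sub: "ball_in {0..1} y (1/16 * \<rho>) \<subseteq> ball_in {0..1} x \<rho>"
    "ball_in {0..1} z (1/16 * \<rho>) \<subseteq> ball_in {0..1} x \<rho>"
    using assms(1) by (simp_all add: y_def z_def)
  have yz: "y \<in> {0..1}" "z \<in> {0..1}" using a assms(1) by (auto simp: y_def z_def)
  show ?thesis
  proof (cases "ball_in {0..1} y (1/16 * \<rho>) \<inter> E = {}")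
    case True
    then show ?thesis using that sub yz by blast
  next
    case False
    then obtain u where u: "u \<in> ball_in {0..1} y (1/16 * \<rho>)" "u \<in> E" by blast
    have "ball_in {0..1} z (1/16 * \<rho>) \<inter> E = {}"
    proof (rule ccontr)
      assume "\<not> ?thesis"
      then obtain v where v: "v \<in> ball_in {0..1} z (1/16 * \<rho>)" "v \<in> E" by blast
      have "\<bar>u - v\<bar> \<le> \<rho> / 5" using small u v sub by blast
      moreover have "\<bar>y - u\<bar> \<le> \<rho> / 16" "\<bar>z - v\<bar> \<le> \<rho> / 16"
        using u v by (auto simp: ball_in_def dist_real_def)
      ultimately show False using assms(1) unfolding y_def z_def by linarith
    qed
    then show ?thesis using that sub yz by blast
  qed
qed

text \<open>One strategy serves all initial radii. The set to be avoided may depend on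
  \<open>\<rho>\<close> and on the whole history of A, so that it can later be read off from the
  ball that A held at an earlier turn. If no admissible centre avoids it, B repeats the centre of A,
  which keeps the play legal.\<close>

lemma avoiding_strategy:
  fixes E :: "real \<Rightarrow> real list \<Rightarrow> real set"
  assumes \<beta>: "0 < \<beta>" "\<beta> < 1"
  shows "\<exists>s. \<forall>\<rho> x y. 0 < \<rho> \<longrightarrow> y = (\<lambda>n. s \<rho> (map x [0..<Suc n])) \<longrightarrow>
     (\<forall>n. (\<forall>k\<le>n. A_legal {0..1} (1/16) \<beta> \<rho> x y k) \<longrightarrow> B_legal {0..1} (1/16) \<beta> \<rho> x y n) \<and>
     ((\<forall>n. A_legal {0..1} (1/16) \<beta> \<rho> x y n) \<longrightarrow>
        (\<exists>p\<in>{0..1}. (\<Inter>n. A_ball {0..1} (1/16) \<beta> \<rho> x n) = {p}) \<and>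
        (\<forall>n. (1/16 * \<beta>) ^ n * \<rho> \<le> 1 \<longrightarrow>
           (\<forall>u\<in>E \<rho> (map x [0..<Suc n]) \<inter> A_ball {0..1} (1/16) \<beta> \<rho> x n.
            \<forall>v\<in>E \<rho> (map x [0..<Suc n]) \<inter> A_ball {0..1} (1/16) \<beta> \<rho> x n.
              \<bar>u - v\<bar> \<le> (1/16 * \<beta>) ^ n * \<rho> / 5) \<longrightarrow>
           A_ball {0..1} (1/16) \<beta> \<rho> x (Suc n) \<inter> E \<rho> (map x [0..<Suc n]) = {}))"
proof -
  \<comment> \<open>At turn n the list \<open>xs\<close> has n + 1 entries, hence the exponent
    \<open>length xs - 1\<close> in the current radius.\<close>
  define good where "good = (\<lambda>\<rho> xs y. y \<in> {0..1} \<and>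
    ball_in {0..1} y (1/16 * ((1/16 * \<beta>) ^ (length xs - 1) * \<rho>)) \<subseteq>
      ball_in {0..1} (last xs) ((1/16 * \<beta>) ^ (length xs - 1) * \<rho>) - E \<rho> xs)"
  define s where "s = (\<lambda>\<rho> xs. if \<exists>y. good \<rho> xs y then SOME y. good \<rho> xs y else last xs)"
  have B: "B_legal {0..1} (1/16) \<beta> \<rho> x y n"
    if "\<rho> > 0" "y = (\<lambda>n. s \<rho> (map x [0..<Suc n]))" "A_legal {0..1} (1/16) \<beta> \<rho> x y n"
    for \<rho> x y n
  proof (cases "\<exists>y. good \<rho> (map x [0..<Suc n]) y")
    case True
    then have "good \<rho> (map x [0..<Suc n]) (y n)"
      using someI_ex[OF True] that(2) by (simp add: s_def)
    then show ?thesis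
      by (auto simp: B_legal_def good_def A_ball_def B_ball_def mult.assoc)
  next
    case False
    then have "y n = x n" using that(2) by (auto simp: s_def)
    moreover have "1/16 * ((1/16 * \<beta>) ^ n * \<rho>) \<le> (1/16 * \<beta>) ^ n * \<rho>"
      using that(1) \<beta> by simp
    ultimately have "B_ball {0..1} (1/16) \<beta> \<rho> y n \<subseteq> A_ball {0..1} (1/16) \<beta> \<rho> x n"
      unfolding A_ball_def B_ball_def ball_in_def mult.assoc using subset_cball Int_mono by (metis order_refl)
    then show ?thesis
      using that(3) \<open>y n = x n\<close> by (simp add: B_legal_def A_legal_def)
  qed
  have W: "(\<exists>p\<in>{0..1}. (\<Inter>n. A_ball {0..1} (1/16) \<beta> \<rho> x n) = {p}) \<and>
        (\<forall>n. (1/16 * \<beta>) ^ n * \<rho> \<le> 1 \<longrightarrow>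
           (\<forall>u\<in>E \<rho> (map x [0..<Suc n]) \<inter> A_ball {0..1} (1/16) \<beta> \<rho> x n.
            \<forall>v\<in>E \<rho> (map x [0..<Suc n]) \<inter> A_ball {0..1} (1/16) \<beta> \<rho> x n.
              \<bar>u - v\<bar> \<le> (1/16 * \<beta>) ^ n * \<rho> / 5) \<longrightarrow>
           A_ball {0..1} (1/16) \<beta> \<rho> x (Suc n) \<inter> E \<rho> (map x [0..<Suc n]) = {})"
    if \<rho>: "\<rho> > 0" and y: "y = (\<lambda>n. s \<rho> (map x [0..<Suc n]))"
      and A: "\<And>n. A_legal {0..1} (1/16) \<beta> \<rho> x y n" for \<rho> x y
  proof -
    let ?A = "A_ball {0..1} (1/16) \<beta> \<rho> x" and ?B = "B_ball {0..1} (1/16) \<beta> \<rho> y"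
    have AB: "?A (Suc n) \<subseteq> ?B n" and BA: "?B n \<subseteq> ?A n" and x01: "x n \<in> {0..1}" for n
      using A[of "Suc n"] A[of n] B[OF \<rho> y A] by (auto simp: A_legal_def B_legal_def)
    have "\<exists>p. \<Inter>(range ?A) = {p}"
    proof (rule decreasing_closed_nest_sing)
      show "closed (?A n)" for n by (auto simp: A_ball_def ball_in_def)
      show "?A n \<noteq> {}" for n
      proof -
        have "x n \<in> ?A n" using x01[of n] \<rho> \<beta> by (simp add: A_ball_def ball_in_def)
        then show ?thesis by blast
      qed
      show "?A n \<subseteq> ?A m" if "m \<le> n" for m n
        using that by (rule lift_Suc_antimono_le[rotated]) (use AB BA in blast)
      show "\<exists>n. \<forall>x\<in>?A n. \<forall>y\<in>?A n. dist x y < \<epsilon>" if "\<epsilon> > 0" for \<epsilon>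
      proof -
        have "(\<lambda>n. (1/16 * \<beta>) ^ n * \<rho>) \<longlonglongrightarrow> 0 * \<rho>"
          by (intro tendsto_mult LIMSEQ_power_zero tendsto_const) (use \<beta> in auto)
        then have "eventually (\<lambda>n. (1/16 * \<beta>) ^ n * \<rho> < \<epsilon> / 2) sequentially"
          by (rule order_tendstoD) (use that in auto)
        then obtain n where n: "(1/16 * \<beta>) ^ n * \<rho> < \<epsilon> / 2"
          by (auto simp: eventually_sequentially)
        have "dist u v < \<epsilon>" if "u \<in> ?A n" "v \<in> ?A n" for u v
          using that n unfolding A_ball_def ball_in_def
          by (smt (verit, best) Int_iff dist_triangle3 field_sum_of_halves mem_cball)
        then show ?thesis by blast
      qed
    qed
    then obtain p where p: "\<Inter>(range ?A) = {p}" by blast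
    then have pA: "p \<in> ?A n" for n by blast
    then have p01: "p \<in> {0..1}" by (auto simp: A_ball_def ball_in_def)
    have "?A (Suc n) \<inter> E \<rho> (map x [0..<Suc n]) = {}"
      if r: "(1/16 * \<beta>) ^ n * \<rho> \<le> 1"
        and sm: "\<forall>u\<in>E \<rho> (map x [0..<Suc n]) \<inter> ?A n. \<forall>v\<in>E \<rho> (map x [0..<Suc n]) \<inter> ?A n.
               \<bar>u - v\<bar> \<le> (1/16 * \<beta>) ^ n * \<rho> / 5" for n
    proof -
      obtain z where "z \<in> {0..1}"
        "ball_in {0..1} z (1/16 * ((1/16 * \<beta>) ^ n * \<rho>)) \<subseteq> ball_in {0..1} (x n) ((1/16 * \<beta>) ^ n * \<rho>)"
        "ball_in {0..1} z (1/16 * ((1/16 * \<beta>) ^ n * \<rho>)) \<inter> E \<rho> (map x [0..<Suc n]) = {}"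
      proof (rule avoid_small_set[of "(1/16 * \<beta>) ^ n * \<rho>" "x n" "E \<rho> (map x [0..<Suc n])"])
        show "0 < (1/16 * \<beta>) ^ n * \<rho>" using \<rho> \<beta> by simp
      qed (use r x01 sm in \<open>auto simp: A_ball_def\<close>)
      then have ex: "\<exists>z. good \<rho> (map x [0..<Suc n]) z" unfolding good_def by (intro exI[of _ z]) auto
      then have "good \<rho> (map x [0..<Suc n]) (y n)"
        using someI_ex[OF ex] y by (simp add: s_def)
      then have "?B n \<inter> E \<rho> (map x [0..<Suc n]) = {}"
        by (auto simp: good_def B_ball_def mult.assoc)
      then show ?thesis using AB by blast
    qed
    then show ?thesis using p p01 by blast
  qed
  show ?thesis
  proof (rule exI[of _ s], intro allI impI, rule conjI)
    fix \<rho> x y assume \<rho>: "0 < \<rho>" and y: "y = (\<lambda>n. s \<rho> (map x [0..<Suc n]))"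
    show "\<forall>n. (\<forall>k\<le>n. A_legal {0..1} (1/16) \<beta> \<rho> x y k) \<longrightarrow> B_legal {0..1} (1/16) \<beta> \<rho> x y n"
      by (intro allI impI B[OF \<rho> y]) (erule allE, erule mp, rule order_refl)
    show "(\<forall>n. A_legal {0..1} (1/16) \<beta> \<rho> x y n) \<longrightarrow>
        (\<exists>p\<in>{0..1}. (\<Inter>n. A_ball {0..1} (1/16) \<beta> \<rho> x n) = {p}) \<and>
        (\<forall>n. (1/16 * \<beta>) ^ n * \<rho> \<le> 1 \<longrightarrow>
           (\<forall>u\<in>E \<rho> (map x [0..<Suc n]) \<inter> A_ball {0..1} (1/16) \<beta> \<rho> x n.
            \<forall>v\<in>E \<rho> (map x [0..<Suc n]) \<inter> A_ball {0..1} (1/16) \<beta> \<rho> x n.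
              \<bar>u - v\<bar> \<le> (1/16 * \<beta>) ^ n * \<rho> / 5) \<longrightarrow>
           A_ball {0..1} (1/16) \<beta> \<rho> x (Suc n) \<inter> E \<rho> (map x [0..<Suc n]) = {})"
      by (intro impI W[OF \<rho> y]) (erule spec)
  qed
qed

text \<open>
  A form of absolute winning in which the sets to be avoided are fixed in advance, but an interval of
  the \<open>m\<close>-th scale only sees a short piece of \<open>D m\<close>.
\<close>

definition cuttable :: "real set \<Rightarrow> real set \<Rightarrow> bool" where
  "cuttable Z W \<longleftrightarrow> (\<forall>\<gamma> \<rho> \<delta> a b. 0 < \<gamma> \<and> \<gamma> < 1 \<and> 0 < \<rho> \<and> 0 < \<delta> \<and> {a..b} \<subseteq> {0..1} - Z \<longrightarrow>
     (\<exists>D :: nat \<Rightarrow> real set. {a..b} \<subseteq> W \<union> (\<Union>m. D m) \<and>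
        (\<forall>m. \<forall>x\<in>D m \<inter> {a..b}. \<forall>y\<in>D m \<inter> {a..b}.
           \<bar>x - y\<bar> \<le> 2 * (\<gamma> ^ m * \<rho>) \<longrightarrow> \<bar>x - y\<bar> \<le> \<delta> * (\<gamma> ^ m * \<rho>))))"

text \<open>For fixed k the numbers 2^k (2m + 1) form an arithmetic progression of difference 2 *
  2^k, and different k give disjoint progressions. Counted from \<open>N \<rho>\<close>, they are
  the turns reserved for the k-th target.\<close>

lemma power2_times_odd_unique:
  fixes k k' m m' :: nat
  assumes "2 ^ k * (2 * m + 1) = 2 ^ k' * (2 * m' + 1)"
  shows "k = k' \<and> m = m'"
proof -
  have *: "\<not> k < k'" if "2 ^ k * (2 * m + 1) = 2 ^ k' * (2 * m' + 1)" for k k' m m' :: nat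
  proof
    assume "k < k'"
    then obtain d where "k' = Suc (k + d)" using less_imp_Suc_add by blast
    with that have "2 ^ k * (2 * m + 1) = 2 ^ k * (2 * (2 ^ d * (2 * m' + 1)))"
      by (simp add: power_add algebra_simps)
    then have "2 * m + 1 = 2 * (2 ^ d * (2 * m' + 1))" by (subst (asm) mult_cancel1) simp
    then show False by presburger
  qed
  have "k = k'" using *[OF assms] *[OF assms[symmetric]] by simp
  with assms show ?thesis by simp
qed

text \<open>B waits until the radius is at most 1, expels the points of \<open>Z\<close> one per
  turn, and then freezes the ball that A holds at turn \<open>N \<rho>\<close>. On this fixed
  interval \<open>cuttable\<close> yields a sequence of sets for each target, and each set is
  avoided at its own reserved turn. A limit point outside some target would lie in a set that was
  avoided.\<close>

theorem schmidt_winning_INT_cuttable: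
  fixes W :: "'i \<Rightarrow> real set"
  assumes Z: "finite Z" and I: "countable I" and cut: "\<And>i. i \<in> I \<Longrightarrow> cuttable Z (W i)"
  shows "schmidt_winning {0..1} (\<Inter>i\<in>I. W i)"
proof -
  have "\<exists>s. winning_strategy {0..1} (\<Inter>i\<in>I. W i) (1/16) \<beta> s" if \<beta>: "0 < \<beta>" "\<beta> < 1" for \<beta>
  proof -
    define q where "q = 1/16 * \<beta>"
    have q: "0 < q" "q < 1" using \<beta> by (auto simp: q_def)
    obtain zs where zs: "set zs = Z" using finite_list[OF Z] by blast
    define K :: "nat set" where "K = to_nat_on I ` I"
    define V where "V = (\<lambda>k. W (from_nat_into I k))"
    have cutV: "cuttable Z (V k)" if "k \<in> K" for k
      using that cut I by (auto simp: K_def V_def)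
    define N0 where "N0 = (\<lambda>\<rho>::real. LEAST n. q ^ n * \<rho> \<le> 1)"
    have N0: "q ^ n * \<rho> \<le> 1" if "\<rho> > 0" "N0 \<rho> \<le> n" for \<rho> n
    proof -
      obtain n0 where "q ^ n0 < 1 / \<rho>"
        using real_arch_pow_inv[of "1/\<rho>" q] q(2) \<open>\<rho> > 0\<close> by auto
      then have "q ^ n0 * \<rho> \<le> 1" using that by (simp add: field_simps)
      then have "q ^ N0 \<rho> * \<rho> \<le> 1" unfolding N0_def by (rule LeastI)
      moreover have "q ^ n \<le> q ^ N0 \<rho>" using that q by (simp add: power_decreasing)
      ultimately show ?thesis using that(1)
        by (meson dual_order.trans less_eq_real_def mult_right_mono)
    qed
    define N where "N = (\<lambda>\<rho>. N0 \<rho> + length zs)"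
    \<comment> \<open>The m-th scale is the radius at the m-th turn reserved for k. Twice the radius
      is the diameter of a ball, and 1/5 is the spread that \<open>avoid_small_set\<close>
      tolerates.\<close>
    define P where "P = (\<lambda>\<rho> c k (D :: nat \<Rightarrow> real set).
       ball_in {0..1} c (q ^ N \<rho> * \<rho>) \<subseteq> V k \<union> (\<Union>m. D m) \<and>
        (\<forall>m. \<forall>x\<in>D m \<inter> ball_in {0..1} c (q ^ N \<rho> * \<rho>). \<forall>y\<in>D m \<inter> ball_in {0..1} c (q ^ N \<rho> * \<rho>).
           \<bar>x - y\<bar> \<le> 2 * (q ^ (N \<rho> + 2 ^ k * (2 * m + 1)) * \<rho>) \<longrightarrow>
           \<bar>x - y\<bar> \<le> 1/5 * (q ^ (N \<rho> + 2 ^ k * (2 * m + 1)) * \<rho>)))"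
    define D where "D = (\<lambda>\<rho> c k. SOME D. P \<rho> c k D)"
    have D: "P \<rho> c k (D \<rho> c k)"
      if k: "k \<in> K" and "\<rho> > 0" and J: "ball_in {0..1} c (q ^ N \<rho> * \<rho>) \<inter> Z = {}" for \<rho> c k
    proof -
      have eq: "ball_in {0..1} c (q ^ N \<rho> * \<rho>) = {max 0 (c - q ^ N \<rho> * \<rho>)..min 1 (c + q ^ N \<rho> * \<rho>)}"
        by (auto simp: ball_in_def dist_real_def)
      \<comment> \<open>The radii at the reserved turns are geometric; their ratio and initial value
        are the \<open>\<gamma>\<close> and \<open>\<rho>\<close> handed to
        \<open>cuttable\<close>.\<close>
      have g: "q ^ (N \<rho> + 2 ^ k * (2 * m + 1)) * \<rho> = (q ^ (2 * 2 ^ k)) ^ m * (q ^ (N \<rho> + 2 ^ k) * \<rho>)" for m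
        by (simp add: power_add algebra_simps flip: power_mult)
      have pos: "0 < q ^ (2 * 2 ^ k)" "q ^ (2 * 2 ^ k) < 1" "0 < q ^ (N \<rho> + 2 ^ k) * \<rho>"
        using q \<open>\<rho> > 0\<close> by (auto simp: power_less_one_iff)
      have sub: "{max 0 (c - q ^ N \<rho> * \<rho>)..min 1 (c + q ^ N \<rho> * \<rho>)} \<subseteq> {0..1} - Z"
        using J unfolding eq[symmetric] by (auto simp: ball_in_def)
      have "\<exists>D. P \<rho> c k D"
        using cutV[OF k, unfolded cuttable_def, rule_format, of "q ^ (2 * 2 ^ k)"
            "q ^ (N \<rho> + 2 ^ k) * \<rho>" "1/5", OF conjI, OF pos(1) conjI, OF pos(2) conjI, OF pos(3) conjI,
            OF _ sub]
        unfolding P_def g eq by simp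
      then show ?thesis unfolding D_def by (rule someI_ex)
    qed
    define E where "E = (\<lambda>\<rho> xs. {u. let n = length xs - 1 in
       (N0 \<rho> \<le> n \<and> n < N \<rho> \<and> u = zs ! (n - N0 \<rho>)) \<or>
       (\<exists>k\<in>K. \<exists>m. n = N \<rho> + 2 ^ k * (2 * m + 1) \<and> u \<in> D \<rho> (xs ! N \<rho>) k m)})"
    obtain s where s: "\<forall>\<rho> x y. 0 < \<rho> \<longrightarrow> y = (\<lambda>n. s \<rho> (map x [0..<Suc n])) \<longrightarrow>
     (\<forall>n. (\<forall>k\<le>n. A_legal {0..1} (1/16) \<beta> \<rho> x y k) \<longrightarrow> B_legal {0..1} (1/16) \<beta> \<rho> x y n) \<and>
     ((\<forall>n. A_legal {0..1} (1/16) \<beta> \<rho> x y n) \<longrightarrow>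
        (\<exists>p\<in>{0..1}. (\<Inter>n. A_ball {0..1} (1/16) \<beta> \<rho> x n) = {p}) \<and>
        (\<forall>n. q ^ n * \<rho> \<le> 1 \<longrightarrow>
           (\<forall>u\<in>E \<rho> (map x [0..<Suc n]) \<inter> A_ball {0..1} (1/16) \<beta> \<rho> x n.
            \<forall>v\<in>E \<rho> (map x [0..<Suc n]) \<inter> A_ball {0..1} (1/16) \<beta> \<rho> x n.
              \<bar>u - v\<bar> \<le> q ^ n * \<rho> / 5) \<longrightarrow>
           A_ball {0..1} (1/16) \<beta> \<rho> x (Suc n) \<inter> E \<rho> (map x [0..<Suc n]) = {}))"
      using avoiding_strategy[OF \<beta>, of E] unfolding q_def by (rule exE)
    note s' = s[rule_format]
    have s1: "B_legal {0..1} (1/16) \<beta> \<rho> x y n"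
      if "\<rho> > 0" "y = (\<lambda>n. s \<rho> (map x [0..<Suc n]))" "\<And>k. k \<le> n \<Longrightarrow> A_legal {0..1} (1/16) \<beta> \<rho> x y k"
      for \<rho> x y n
      using s'[OF that(1,2)] that(3) by (elim conjE) simp
    have win: "\<exists>p\<in>(\<Inter>i\<in>I. W i). (\<Inter>n. A_ball {0..1} (1/16) \<beta> \<rho> x n) = {p}"
      if \<rho>: "\<rho> > 0" and y: "y = (\<lambda>n. s \<rho> (map x [0..<Suc n]))"
      and A: "\<And>n. A_legal {0..1} (1/16) \<beta> \<rho> x y n" for \<rho> x y
    proof -
      let ?A = "A_ball {0..1} (1/16) \<beta> \<rho> x"
      let ?E = "\<lambda>n. E \<rho> (map x [0..<Suc n])"
      note s2 = s'[OF \<rho> y, THEN conjunct2, rule_format, OF A]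
      obtain p where p: "(\<Inter>n. ?A n) = {p}" using s2 by (elim conjE bexE)
      have av: "?A (Suc n) \<inter> ?E n = {}"
        if "q ^ n * \<rho> \<le> 1"
          and "\<And>u v. u \<in> ?E n \<Longrightarrow> u \<in> ?A n \<Longrightarrow> v \<in> ?E n \<Longrightarrow> v \<in> ?A n \<Longrightarrow> \<bar>u - v\<bar> \<le> q ^ n * \<rho> / 5" for n
        by (rule s2[THEN conjunct2, rule_format, OF that(1)]) (elim IntE, rule that(2))
      have An: "?A n = ball_in {0..1} (x n) (q ^ n * \<rho>)" for n
        by (simp add: A_ball_def q_def)
      have pA: "p \<in> ?A n" for n using p by blast
      have dec: "?A (Suc n) \<subseteq> ?A n" for n
        using A[of "Suc n"] s1[OF \<rho> y, of n] A by (auto simp: A_legal_def B_legal_def)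
      have mono: "?A n \<subseteq> ?A m" if "m \<le> n" for m n
        using that by (rule lift_Suc_antimono_le[rotated]) (use dec in blast)
      have Emem: "u \<in> ?E n \<longleftrightarrow> (N0 \<rho> \<le> n \<and> n < N \<rho> \<and> u = zs ! (n - N0 \<rho>)) \<or>
         (\<exists>k\<in>K. \<exists>m. n = N \<rho> + 2 ^ k * (2 * m + 1) \<and> u \<in> D \<rho> (map x [0..<Suc n] ! N \<rho>) k m)" for u n
        by (simp add: E_def Let_def del: upt_Suc)
      have nz: "?A (N \<rho>) \<inter> Z = {}"
      proof -
        have "z \<notin> ?A (N \<rho>)" if zZ: "z \<in> Z" for z
        proof -
          obtain i where i: "i < length zs" "z = zs ! i"
            using zZ unfolding zs[symmetric] in_set_conv_nth by blast
          define n where "n = N0 \<rho> + i"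
          have En: "?E n = {z}"
          proof -
            have "n < N \<rho>" "N0 \<rho> \<le> n" "zs ! (n - N0 \<rho>) = z" using i by (auto simp: n_def N_def)
            then show ?thesis unfolding set_eq_iff Emem by auto
          qed
          \<comment> \<open>A single point has spread 0, so it can always be avoided.\<close>
          have "?A (Suc n) \<inter> ?E n = {}"
            by (rule av) (use N0[OF \<rho>] En \<rho> q in \<open>auto simp: n_def\<close>)
          moreover have "?A (N \<rho>) \<subseteq> ?A (Suc n)" by (rule mono) (use i in \<open>simp add: n_def N_def\<close>)
          ultimately show ?thesis using En by blast
        qed
        then show ?thesis by blast
      qed
      have "p \<in> V k" if k: "k \<in> K" for k
      proof (rule ccontr)
        assume "p \<notin> V k"
        note Pk = D[OF _ \<rho> nz[unfolded An], unfolded P_def An[symmetric]]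
        obtain m where m: "p \<in> D \<rho> (x (N \<rho>)) k m"
          using Pk[OF k] pA \<open>p \<notin> V k\<close> by blast
        define n where "n = N \<rho> + 2 ^ k * (2 * m + 1)"
        have le: "N \<rho> < n" by (simp add: n_def)
        then have nth: "map x [0..<Suc n] ! N \<rho> = x (N \<rho>)" by (subst nth_map) (auto simp del: upt_Suc)
        have En: "u \<in> ?E n \<longleftrightarrow> u \<in> D \<rho> (x (N \<rho>)) k m" for u
        proof -
          \<comment> \<open>Turn n is reserved for this k and m alone, so the set avoided there is
            exactly the m-th set of k.\<close>
          have "n = N \<rho> + 2 ^ k' * (2 * m' + 1) \<longleftrightarrow> k' = k \<and> m' = m" for k' m'
            unfolding n_def using power2_times_odd_unique[of k m k' m'] by auto
          then show ?thesis unfolding Emem nth using le k by auto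
        qed
        have "?A (Suc n) \<inter> ?E n = {}"
        proof (rule av)
          show "q ^ n * \<rho> \<le> 1" using N0[OF \<rho>] le by (simp add: N_def)
          fix u v assume uv: "u \<in> ?E n" "u \<in> ?A n" "v \<in> ?E n" "v \<in> ?A n"
          have "\<bar>u - v\<bar> \<le> 2 * (q ^ n * \<rho>)"
            using uv(2,4) by (auto simp: An ball_in_def dist_real_def)
          moreover have "u \<in> ?A (N \<rho>)" "v \<in> ?A (N \<rho>)" using uv mono[OF less_imp_le, OF le] by auto
          ultimately have "\<bar>u - v\<bar> \<le> 1/5 * (q ^ n * \<rho>)"
            using Pk[OF k, THEN conjunct2, rule_format, of u m v] uv(1,3) unfolding En n_def[symmetric] by blast
          then show "\<bar>u - v\<bar> \<le> q ^ n * \<rho> / 5" by simp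
        qed
        with m En pA show False by blast
      qed
      then have "p \<in> W i" if "i \<in> I" for i
        using that I \<open>\<And>k. k \<in> K \<Longrightarrow> p \<in> V k\<close>[of "to_nat_on I i"] by (simp add: K_def V_def)
      then show ?thesis using p by blast
    qed
    have "winning_strategy {0..1} (\<Inter>i\<in>I. W i) (1/16) \<beta> s"
      unfolding winning_strategy_def Let_def
      by (intro allI impI conjI s1[OF _ refl] win[OF _ refl]) simp_all
    then show ?thesis by (rule exI[of _ s])
  qed
  then show ?thesis unfolding schmidt_winning_def by (intro exI[of _ "1/16"]) auto
qed

section \<open>Dangerous sets for two expanding factors\<close>

text \<open>The sup norm of the row vector (u, w) after the flow diag (exp (- r t), exp (r t)). With
  u = p and w = p f + q this is one factor of H.\<close>

definition stretch :: "real \<Rightarrow> real \<Rightarrow> real \<Rightarrow> real \<Rightarrow> real" where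
  "stretch r u w t = max (\<bar>u\<bar> * exp (- (r * t))) (\<bar>w\<bar> * exp (r * t))"

lemma stretch_nonneg: "0 \<le> stretch r u w t"
  by (simp add: stretch_def le_max_iff_disj)

lemma stretch_bounds:
  "\<bar>u\<bar> \<le> stretch r u w t * exp (r * t)" "\<bar>w\<bar> \<le> stretch r u w t * exp (- (r * t))"
proof -
  have "\<bar>u\<bar> * exp (- (r * t)) * exp (r * t) \<le> stretch r u w t * exp (r * t)"
    by (intro mult_right_mono) (auto simp: stretch_def)
  then show "\<bar>u\<bar> \<le> stretch r u w t * exp (r * t)" by (simp add: mult.assoc flip: exp_add)
  have "\<bar>w\<bar> * exp (r * t) * exp (- (r * t)) \<le> stretch r u w t * exp (- (r * t))"
    by (intro mult_right_mono) (auto simp: stretch_def)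
  then show "\<bar>w\<bar> \<le> stretch r u w t * exp (- (r * t))" by (simp add: mult.assoc flip: exp_add)
qed

text \<open>The contracted coordinate sets the fastest possible rate of decay; the other one only
  grows.\<close>

lemma stretch_decay:
  assumes "0 \<le> r" "s \<le> t"
  shows "exp (- (r * (t - s))) * stretch r u w s \<le> stretch r u w t"
proof -
  have "exp (- (r * (t - s))) * (\<bar>u\<bar> * exp (- (r * s))) = \<bar>u\<bar> * exp (- (r * t))"
    by (simp add: algebra_simps flip: exp_add)
  moreover have "exp (- (r * (t - s))) * (\<bar>w\<bar> * exp (r * s)) \<le> 1 * (\<bar>w\<bar> * exp (r * t))"
    using assms by (intro mult_mono) (auto intro!: mult_left_mono)
  ultimately have "max (exp (- (r * (t - s))) * (\<bar>u\<bar> * exp (- (r * s)))) (exp (- (r * (t - s))) * (\<bar>w\<bar> * exp (r * s)))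
      \<le> stretch r u w t"
    unfolding stretch_def by (intro max.mono; linarith)
  then show ?thesis by (simp add: stretch_def max_mult_distrib_left)
qed

lemma continuous_on_stretch: "continuous_on A (stretch r u w)"
  unfolding stretch_def by (intro continuous_intros)

lemma stretch_0: "stretch r u w 0 = max \<bar>u\<bar> \<bar>w\<bar>"
  by (simp add: stretch_def)

text \<open>A common shear leaves the determinant of (p, q) and (p', q') unchanged, so using two
  different parameters f and f' costs just the term p p' (f - f'). The two mixed products cost a
  factor exp (r \<bar>s - s'\<bar>), the extra term a factor exp (r (s + s')) L. Estimating r by R
  gives a single constant \<open>B\<close> for both embeddings.\<close>

lemma det_le_stretch:
  assumes r: "0 \<le> r" "r \<le> R" and s: "0 \<le> s" "0 \<le> s'" "\<bar>s - s'\<bar> \<le> T" "exp (R * T) \<le> B" "exp (R * (s + s')) * L \<le> B"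
    and f: "\<bar>f - f'\<bar> \<le> L"
  shows "\<bar>p * q' - q * p'\<bar> \<le> stretch r p (p * f + q) s * stretch r p' (p' * f' + q') s' * (3 * B)"
proof -
  define a a' where "a = stretch r p (p * f + q) s" and "a' = stretch r p' (p' * f' + q') s'"
  have a: "0 \<le> a" "0 \<le> a'" by (auto simp: a_def a'_def stretch_nonneg)
  have e: "exp (r * d) \<le> B" if "\<bar>d\<bar> \<le> T" for d
  proof -
    have "r * d \<le> r * T" using r that by (intro mult_left_mono) auto
    also have "\<dots> \<le> R * T" using r that by (intro mult_right_mono) auto
    finally show ?thesis using s(4) by (meson exp_le_cancel_iff order_trans)
  qed
  have 1: "\<bar>p\<bar> * \<bar>p' * f' + q'\<bar> \<le> a * a' * B"
  proof -
    have "\<bar>p\<bar> * \<bar>p' * f' + q'\<bar> \<le> (a * exp (r * s)) * (a' * exp (- (r * s')))"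
      unfolding a_def a'_def by (intro mult_mono stretch_bounds) (auto simp: stretch_nonneg)
    also have "\<dots> = a * a' * exp (r * (s - s'))" by (simp add: algebra_simps flip: exp_add)
    also have "\<dots> \<le> a * a' * B" using a s by (intro mult_left_mono e) auto
    finally show ?thesis .
  qed
  have 2: "\<bar>p'\<bar> * \<bar>p * f + q\<bar> \<le> a * a' * B"
  proof -
    have "\<bar>p'\<bar> * \<bar>p * f + q\<bar> \<le> (a' * exp (r * s')) * (a * exp (- (r * s)))"
      unfolding a_def a'_def by (intro mult_mono stretch_bounds) (auto simp: stretch_nonneg)
    also have "\<dots> = a * a' * exp (r * (s' - s))" by (simp add: algebra_simps flip: exp_add)
    also have "\<dots> \<le> a * a' * B" using a s by (intro mult_left_mono e) auto
    finally show ?thesis .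
  qed
  have 3: "\<bar>p\<bar> * \<bar>p'\<bar> * \<bar>f - f'\<bar> \<le> a * a' * B"
  proof -
    have "\<bar>p\<bar> * \<bar>p'\<bar> * \<bar>f - f'\<bar> \<le> (a * exp (r * s)) * (a' * exp (r * s')) * L"
      unfolding a_def a'_def by (intro mult_mono stretch_bounds f) (auto simp: stretch_nonneg)
    also have "\<dots> = a * a' * (exp (r * (s + s')) * L)" by (simp add: algebra_simps flip: exp_add)
    also have "\<dots> \<le> a * a' * (exp (R * (s + s')) * L)"
      using a r s f by (intro mult_left_mono mult_right_mono) (auto intro: mult_right_mono)
    also have "\<dots> \<le> a * a' * B" using a s by (intro mult_left_mono) auto
    finally show ?thesis .
  qed
  have "p * q' - q * p' = p * (p' * f' + q') - p' * (p * f + q) + p * p' * (f - f')"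
    by (simp add: algebra_simps)
  then have "\<bar>p * q' - q * p'\<bar> \<le> \<bar>p\<bar> * \<bar>p' * f' + q'\<bar> + \<bar>p'\<bar> * \<bar>p * f + q\<bar> + \<bar>p\<bar> * \<bar>p'\<bar> * \<bar>f - f'\<bar>"
    by (simp only: abs_mult[symmetric])
  with 1 2 3 show ?thesis unfolding a_def[symmetric] a'_def[symmetric] by (simp add: algebra_simps)
qed

text \<open>
  The second factor decays at most like \<open>exp (- r2 t)\<close> and \<open>r2 \<le> r1\<close>, so a decrease of the product
  forces the first factor to be still in its contracting phase at time \<open>s\<close>.
\<close>

lemma small_after_decrease:
  assumes r: "0 \<le> r2" "r2 \<le> r1" and st: "s \<le> t" and \<eta>: "0 < \<eta>" "\<eta> \<le> 1"
    and big: "stretch r1 p1 w1 s * stretch r2 p2 w2 s = E"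
    and small: "stretch r1 p1 w1 t * stretch r2 p2 w2 t < \<eta> * E"
  shows "p1 \<noteq> 0 \<and> \<bar>w1\<bar> \<le> \<eta> * \<bar>p1\<bar> * exp (- (2 * r1 * s))"
proof -
  define a1 a2 where "a1 = stretch r1 p1 w1" and "a2 = stretch r2 p2 w2"
  have nn: "0 \<le> a1 x" "0 \<le> a2 x" for x by (auto simp: a1_def a2_def stretch_nonneg)
  have "0 \<le> a1 t * a2 t" using nn by simp
  then have "0 < \<eta> * E" using small by (simp add: a1_def a2_def)
  then have "E > 0" using \<eta> by (simp add: zero_less_mult_iff)
  then have pos: "0 < a1 s" "0 < a2 s" using big nn[of s] by (auto simp: a1_def[symmetric] a2_def[symmetric] zero_less_mult_iff)
  have "a1 t * (exp (- (r2 * (t - s))) * a2 s) \<le> a1 t * a2 t"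
    unfolding a2_def using r st nn by (intro mult_left_mono stretch_decay) auto
  also have "\<dots> < \<eta> * (a1 s * a2 s)" using small big by (simp add: a1_def a2_def)
  finally have "(a1 t * exp (- (r2 * (t - s)))) * a2 s < (\<eta> * a1 s) * a2 s" by (simp add: mult_ac)
  then have "a1 t * exp (- (r2 * (t - s))) < \<eta> * a1 s" using pos by simp
  moreover have "\<bar>w1\<bar> * exp (r1 * t) \<le> a1 t" by (simp add: a1_def stretch_def)
  ultimately have "\<bar>w1\<bar> * exp (r1 * t) * exp (- (r2 * (t - s))) < \<eta> * a1 s"
    by (meson exp_ge_zero mult_right_mono order_le_less_trans)
  then have lt: "\<bar>w1\<bar> * exp (r1 * s) * exp ((r1 - r2) * (t - s)) < \<eta> * a1 s"
    by (simp add: algebra_simps flip: exp_add)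
  have "1 \<le> exp ((r1 - r2) * (t - s))" using r st by simp
  then have "\<bar>w1\<bar> * exp (r1 * s) * 1 \<le> \<bar>w1\<bar> * exp (r1 * s) * exp ((r1 - r2) * (t - s))"
    by (intro mult_left_mono) auto
  with lt have lt': "\<bar>w1\<bar> * exp (r1 * s) < \<eta> * a1 s" by simp
  have "\<eta> * a1 s \<le> a1 s" using \<eta> nn[of s] by (simp add: mult_left_le_one_le)
  with lt' have "\<bar>w1\<bar> * exp (r1 * s) < a1 s" by simp
  \<comment> \<open>The expanding entry is strictly below \<open>a1 s\<close>, so the maximum is
    attained by the contracting one.\<close>
  then have eq: "a1 s = \<bar>p1\<bar> * exp (- (r1 * s))" by (auto simp: a1_def stretch_def max_def split: if_splits)
  have "\<bar>w1\<bar> * exp (r1 * s) * exp (- (r1 * s)) \<le> \<eta> * (\<bar>p1\<bar> * exp (- (r1 * s))) * exp (- (r1 * s))"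
    using lt' eq by (intro mult_right_mono) auto
  then have "\<bar>w1\<bar> \<le> \<eta> * \<bar>p1\<bar> * exp (- (2 * r1 * s))"
    by (simp add: mult.assoc flip: exp_add)
  moreover have "p1 \<noteq> 0" using eq pos by auto
  ultimately show ?thesis by simp
qed

text \<open>Undoing the shear costs at most a factor 1 + M. This makes the lower bound for H at time
  0 uniform in x.\<close>

lemma max_shear_ge:
  fixes p q f M :: real
  assumes "\<bar>f\<bar> \<le> M"
  shows "max \<bar>p\<bar> \<bar>q\<bar> / (1 + M) \<le> max \<bar>p\<bar> \<bar>p * f + q\<bar>"
proof -
  let ?m = "max \<bar>p\<bar> \<bar>p * f + q\<bar>"
  have M: "0 \<le> M" using assms by linarith
  have "\<bar>q\<bar> \<le> \<bar>p * f + q\<bar> + \<bar>p\<bar> * \<bar>f\<bar>" unfolding abs_mult[symmetric] by linarith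
  also have "\<dots> \<le> ?m + ?m * M" using assms by (intro add_mono mult_mono) auto
  finally have "\<bar>q\<bar> \<le> ?m * (1 + M)" by (simp add: algebra_simps)
  moreover have "\<bar>p\<bar> * 1 \<le> ?m * (1 + M)" using M by (intro mult_mono) auto
  ultimately show ?thesis using M by (simp add: divide_le_eq)
qed

text \<open>The number field enters only through \<open>discrete\<close> and \<open>c0\<close>: the
  norm of a nonzero integer is at least 1 in absolute value, and integral vectors are not short at
  time 0.\<close>

lemma dangerous_sets:
  fixes p1 q1 p2 q2 :: "'v \<Rightarrow> real" and f1 f2 :: "real \<Rightarrow> real" and r1 r2 :: real
  defines "H \<equiv> \<lambda>v x t. stretch r1 (p1 v) (p1 v * f1 x + q1 v) t * stretch r2 (p2 v) (p2 v * f2 x + q2 v) t"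
  assumes r: "0 \<le> r2" "r2 \<le> r1" "0 < r1"
    and discrete: "\<And>v v'. \<lbrakk>v \<in> V; v' \<in> V; \<bar>(p1 v * q1 v' - q1 v * p1 v') * (p2 v * q2 v' - q2 v * p2 v')\<bar> < 1\<rbrakk>
          \<Longrightarrow> p1 v * q1 v' - q1 v * p1 v' = 0"
    and c0: "0 < c0" "\<And>v. v \<in> V \<Longrightarrow> c0 \<le> max \<bar>p1 v\<bar> \<bar>q1 v\<bar> * max \<bar>p2 v\<bar> \<bar>q2 v\<bar>"
    and M: "0 \<le> M" "\<And>x. x \<in> J \<Longrightarrow> \<bar>f1 x\<bar> \<le> M" "\<And>x. x \<in> J \<Longrightarrow> \<bar>f2 x\<bar> \<le> M"
    and C: "0 \<le> C" "\<And>x y. \<lbrakk>x \<in> J; y \<in> J\<rbrakk> \<Longrightarrow> \<bar>f1 x - f1 y\<bar> \<le> C * \<bar>x - y\<bar>"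
       "\<And>x y. \<lbrakk>x \<in> J; y \<in> J\<rbrakk> \<Longrightarrow> \<bar>f2 x - f2 y\<bar> \<le> C * \<bar>x - y\<bar>"
    and c: "0 < c" "\<And>x y. \<lbrakk>x \<in> J; y \<in> J\<rbrakk> \<Longrightarrow> c * \<bar>x - y\<bar> \<le> \<bar>f1 x - f1 y\<bar>"
    and \<gamma>: "0 < \<gamma>" "\<gamma> < 1" and \<rho>: "0 < \<rho>" and \<delta>: "0 < \<delta>"
  shows "\<exists>D :: nat \<Rightarrow> real set. J \<subseteq> {x. \<exists>e>0. \<forall>v\<in>V. \<forall>t\<ge>0. e \<le> H v x t} \<union> (\<Union>m. D m) \<and>
        (\<forall>m. \<forall>x\<in>D m \<inter> J. \<forall>y\<in>D m \<inter> J.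
           \<bar>x - y\<bar> \<le> 2 * (\<gamma> ^ m * \<rho>) \<longrightarrow> \<bar>x - y\<bar> \<le> \<delta> * (\<gamma> ^ m * \<rho>))"
proof -
  \<comment> \<open>\<open>\<tau> m\<close> solves exp (- 2 r1 \<tau>) = \<gamma>^m \<rho>, so that
    the m-th scale of the game corresponds to the time window from \<open>\<tau> m\<close> to
    \<open>\<tau> (Suc m)\<close>, of length \<open>T\<close>.\<close>
  define T where "T = ln (1 / \<gamma>) / (2 * r1)"
  define \<tau> where "\<tau> = (\<lambda>m::nat. real m * T - ln \<rho> / (2 * r1))"
  have T: "0 < T" using \<gamma> r by (simp add: T_def)
  have "2 * r1 * T = - ln \<gamma>" using r \<gamma> by (simp add: T_def ln_div)
  have \<tau>: "exp (- (2 * r1 * \<tau> m)) = \<gamma> ^ m * \<rho>" for m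
  proof -
    have "- (2 * r1 * \<tau> m) = real m * ln \<gamma> + ln \<rho>"
    proof -
      have "- (2 * r1 * \<tau> m) = - (real m * (2 * r1 * T)) + ln \<rho>"
        using r by (simp add: \<tau>_def field_simps)
      then show ?thesis unfolding \<open>2 * r1 * T = - ln \<gamma>\<close> by simp
    qed
    then show ?thesis using \<gamma> \<rho> by (simp add: exp_add exp_of_nat_mult)
  qed
  \<comment> \<open>Inside one window exp (r1 T) is at most 1/\<gamma>, and exp (r1 (s + s')) times
    the variation 2 C \<gamma>^m \<rho> of the curve on a ball is at most 2 C/\<gamma>.
    \<open>B\<close> dominates both.\<close>
  define B where "B = (1 + 2 * C) / \<gamma>"
  have B: "0 < B" "1 / \<gamma> \<le> B" "2 * C / \<gamma> \<le> B" using C(1) \<gamma> by (simp_all add: B_def field_simps)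
  \<comment> \<open>The first bound keeps H at least \<open>E\<close> up to time max 0 (\<tau> 0),
    before the windows become relevant. The second gives (3 B E)^2 \<le> 1/4 < 1, as
    \<open>discrete\<close> requires.\<close>
  define E where "E = min (c0 / (1 + M)^2 * min 1 \<rho>) (1 / (6 * B))"
  have E: "0 < E" "E \<le> c0 / (1 + M)^2 * min 1 \<rho>" "E \<le> 1 / (6 * B)"
    using c0 M(1) \<rho> B by (auto simp: E_def)
  \<comment> \<open>2 \<eta> / c \<le> \<delta> makes the dangerous piece as short as
    demanded.\<close>
  define \<eta> where "\<eta> = min 1 (\<delta> * c / 2)"
  have \<eta>: "0 < \<eta>" "\<eta> \<le> 1" "2 * \<eta> \<le> \<delta> * c" using \<delta> c by (auto simp: \<eta>_def min_def)
  \<comment> \<open>x is dangerous at scale m if some v has H at most \<open>E\<close> during window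
    m while f1 x is within \<eta> \<gamma>^m \<rho> of - q1/p1.\<close>
  define D where "D = (\<lambda>m. {x \<in> J. \<exists>v\<in>V. \<exists>s\<ge>0. \<tau> m \<le> s \<and> s \<le> \<tau> (Suc m) \<and> H v x s \<le> E \<and>
     p1 v \<noteq> 0 \<and> \<bar>p1 v * f1 x + q1 v\<bar> \<le> \<eta> * \<bar>p1 v\<bar> * (\<gamma> ^ m * \<rho>)})"
  have close: "\<bar>x - y\<bar> \<le> \<delta> * (\<gamma> ^ m * \<rho>)"
    if x: "x \<in> D m" and y: "y \<in> D m" and xy: "\<bar>x - y\<bar> \<le> 2 * (\<gamma> ^ m * \<rho>)" for x y m
  proof -
    define \<epsilon> where "\<epsilon> = \<gamma> ^ m * \<rho>"
    obtain v s where v: "v \<in> V" "0 \<le> s" "\<tau> m \<le> s" "s \<le> \<tau> (Suc m)" "H v x s \<le> E"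
      "p1 v \<noteq> 0" "\<bar>p1 v * f1 x + q1 v\<bar> \<le> \<eta> * \<bar>p1 v\<bar> * \<epsilon>" and xJ: "x \<in> J"
      using x by (auto simp: D_def \<epsilon>_def)
    obtain v' s' where v': "v' \<in> V" "0 \<le> s'" "\<tau> m \<le> s'" "s' \<le> \<tau> (Suc m)" "H v' y s' \<le> E"
      "p1 v' \<noteq> 0" "\<bar>p1 v' * f1 y + q1 v'\<bar> \<le> \<eta> * \<bar>p1 v'\<bar> * \<epsilon>" and yJ: "y \<in> J"
      using y by (auto simp: D_def \<epsilon>_def)
    have ss: "\<bar>s - s'\<bar> \<le> T"
    proof -
      have "\<tau> (Suc m) = \<tau> m + T" by (simp add: \<tau>_def algebra_simps)
      then show ?thesis using v v' by linarith
    qed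
    have e1: "exp (r1 * T) \<le> B"
    proof -
      have "exp (r1 * T) \<le> exp (2 * r1 * T)" using r T by simp
      also have "\<dots> = 1 / \<gamma>" using \<open>2 * r1 * T = - ln \<gamma>\<close> \<gamma> by (simp add: exp_minus field_simps)
      finally show ?thesis using B by simp
    qed
    have e2: "exp (r1 * (s + s')) * (C * \<bar>x - y\<bar>) \<le> B"
    proof -
      have "r1 * (s + s') \<le> r1 * (\<tau> (Suc m) + \<tau> (Suc m))" using v v' r by (intro mult_left_mono) auto
      then have "exp (r1 * (s + s')) \<le> exp (2 * r1 * \<tau> (Suc m))" by (simp add: algebra_simps)
      also have "\<dots> = inverse (exp (- (2 * r1 * \<tau> (Suc m))))" by (simp add: exp_minus)
      also have "\<dots> = inverse (\<gamma> * \<epsilon>)" unfolding \<tau> \<epsilon>_def by (simp add: mult_ac)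
      finally have "exp (r1 * (s + s')) * (C * \<bar>x - y\<bar>) \<le> inverse (\<gamma> * \<epsilon>) * (C * (2 * \<epsilon>))"
        using xy C(1) \<gamma> \<rho> by (intro mult_mono) (auto simp: \<epsilon>_def intro!: mult_left_mono)
      also have "\<dots> = 2 * C / \<gamma>" using \<gamma> \<rho> by (simp add: \<epsilon>_def field_simps)
      finally show ?thesis using B by simp
    qed
    have d1: "\<bar>p1 v * q1 v' - q1 v * p1 v'\<bar> \<le>
        stretch r1 (p1 v) (p1 v * f1 x + q1 v) s * stretch r1 (p1 v') (p1 v' * f1 y + q1 v') s' * (3 * B)"
      by (rule det_le_stretch[OF _ _ v(2) v'(2) ss e1 e2 C(2)[OF xJ yJ]]) (use r in auto)
    have d2: "\<bar>p2 v * q2 v' - q2 v * p2 v'\<bar> \<le>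
        stretch r2 (p2 v) (p2 v * f2 x + q2 v) s * stretch r2 (p2 v') (p2 v' * f2 y + q2 v') s' * (3 * B)"
      by (rule det_le_stretch[OF _ _ v(2) v'(2) ss e1 e2 C(3)[OF xJ yJ]]) (use r in auto)
    have "\<bar>(p1 v * q1 v' - q1 v * p1 v') * (p2 v * q2 v' - q2 v * p2 v')\<bar> \<le>
       (stretch r1 (p1 v) (p1 v * f1 x + q1 v) s * stretch r1 (p1 v') (p1 v' * f1 y + q1 v') s' * (3 * B)) *
       (stretch r2 (p2 v) (p2 v * f2 x + q2 v) s * stretch r2 (p2 v') (p2 v' * f2 y + q2 v') s' * (3 * B))"
      unfolding abs_mult by (intro mult_mono d1 d2 order_trans[OF abs_ge_zero d1]) simp
    also have "\<dots> = (H v x s * (3 * B)) * (H v' y s' * (3 * B))" by (simp add: H_def mult_ac)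
    also have "\<dots> \<le> (E * (3 * B)) * (E * (3 * B))"
      using v(5) v'(5) B E(1) by (intro mult_mono) (auto simp: H_def intro!: mult_nonneg_nonneg stretch_nonneg)
    also have "\<dots> \<le> (1/2) * (1/2)"
      using E(1,3) B by (intro mult_mono) (auto simp: field_simps)
    finally have "p1 v * q1 v' - q1 v * p1 v' = 0" using discrete[OF v(1) v'(1)] by simp
    \<comment> \<open>Both dangerous points are near the same value - q1/p1, so f1 x and f1 y are
      close to each other.\<close>
    then have eq: "q1 v / p1 v = q1 v' / p1 v'" using v(6) v'(6) by (simp add: field_simps)
    have "\<bar>f1 x + q1 v / p1 v\<bar> \<le> \<eta> * \<epsilon>"
    proof -
      have "\<bar>p1 v\<bar> * \<bar>f1 x + q1 v / p1 v\<bar> = \<bar>p1 v * f1 x + q1 v\<bar>"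
        using v(6) by (simp add: algebra_simps flip: abs_mult)
      then have "\<bar>p1 v\<bar> * \<bar>f1 x + q1 v / p1 v\<bar> \<le> \<bar>p1 v\<bar> * (\<eta> * \<epsilon>)" using v(7) by (simp add: mult_ac)
      then show ?thesis using v(6) by simp
    qed
    moreover have "\<bar>f1 y + q1 v' / p1 v'\<bar> \<le> \<eta> * \<epsilon>"
    proof -
      have "\<bar>p1 v'\<bar> * \<bar>f1 y + q1 v' / p1 v'\<bar> = \<bar>p1 v' * f1 y + q1 v'\<bar>"
        using v'(6) by (simp add: algebra_simps flip: abs_mult)
      then have "\<bar>p1 v'\<bar> * \<bar>f1 y + q1 v' / p1 v'\<bar> \<le> \<bar>p1 v'\<bar> * (\<eta> * \<epsilon>)" using v'(7) by (simp add: mult_ac)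
      then show ?thesis using v'(6) by simp
    qed
    ultimately have "\<bar>f1 x - f1 y\<bar> \<le> 2 * \<eta> * \<epsilon>" unfolding eq by linarith
    then have "c * \<bar>x - y\<bar> \<le> 2 * \<eta> * \<epsilon>" using c(2)[OF xJ yJ] by linarith
    also have "\<dots> \<le> (\<delta> * c) * \<epsilon>" using \<eta>(3) \<gamma> \<rho> by (intro mult_right_mono) (auto simp: \<epsilon>_def)
    finally show ?thesis using c(1) by (simp add: \<epsilon>_def mult_ac)
  qed
  have cover: "\<eta> * E \<le> H v x t"
    if x: "x \<in> J" "\<And>m. x \<notin> D m" and v: "v \<in> V" and t: "0 \<le> t" for x v t
  proof (rule ccontr)
    assume "\<not> ?thesis"
    then have small: "H v x t < \<eta> * E" by simp
    have small': "H v x t < E" using small \<eta> E(1) by (smt (verit) mult_left_le_one_le)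
    \<comment> \<open>\<open>\<tau> 0\<close> is negative when \<rho> > 1. With the maximum, exp (-
      2 r1 t0) = min 1 \<rho>, which is the factor in \<open>E\<close>.\<close>
    define t0 where "t0 = max 0 (\<tau> 0)"
    have early: "E \<le> H v x s" if s: "0 \<le> s" "s \<le> t0" for s
    proof -
      have H0: "c0 / (1 + M)^2 \<le> H v x 0"
      proof -
        have "c0 / (1 + M)^2 \<le> (max \<bar>p1 v\<bar> \<bar>q1 v\<bar> * max \<bar>p2 v\<bar> \<bar>q2 v\<bar>) / (1 + M)^2"
          using c0(2)[OF v] by (intro divide_right_mono) auto
        also have "\<dots> = (max \<bar>p1 v\<bar> \<bar>q1 v\<bar> / (1 + M)) * (max \<bar>p2 v\<bar> \<bar>q2 v\<bar> / (1 + M))"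
          by (simp add: power2_eq_square)
        also have "\<dots> \<le> H v x 0"
          unfolding H_def stretch_0 using M(1) by (intro mult_mono max_shear_ge M x) auto
        finally show ?thesis .
      qed
      have "min 1 \<rho> \<le> exp (- (2 * r1 * s))"
      proof -
        have "2 * r1 * s \<le> 2 * r1 * t0" using r s by (intro mult_left_mono) auto
        then have "exp (- (2 * r1 * t0)) \<le> exp (- (2 * r1 * s))" by simp
        moreover have "min 1 \<rho> \<le> exp (- (2 * r1 * t0))"
          using \<tau>[of 0] by (auto simp: t0_def max_def)
        ultimately show ?thesis by linarith
      qed
      also have "\<dots> \<le> exp (- (r1 * (s - 0))) * exp (- (r2 * (s - 0)))"
      proof -
        have "r2 * s \<le> r1 * s" using r s by (intro mult_right_mono) auto
        then show ?thesis by (simp flip: exp_add)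
      qed
      finally have "c0 / (1 + M)^2 * min 1 \<rho> \<le> H v x 0 * (exp (- (r1 * (s - 0))) * exp (- (r2 * (s - 0))))"
        using H0 \<rho> c0(1) M(1) by (intro mult_mono) (auto simp: H_def intro!: mult_nonneg_nonneg stretch_nonneg)
      also have "\<dots> = (exp (- (r1 * (s - 0))) * stretch r1 (p1 v) (p1 v * f1 x + q1 v) 0) *
            (exp (- (r2 * (s - 0))) * stretch r2 (p2 v) (p2 v * f2 x + q2 v) 0)"
        by (simp add: H_def mult_ac)
      also have "\<dots> \<le> H v x s"
        unfolding H_def using r s
        by (intro mult_mono stretch_decay) (auto intro!: mult_nonneg_nonneg stretch_nonneg)
      finally show ?thesis using E by linarith
    qed
    have "t0 < t" using early[of t] t small' by force
    moreover have "E \<le> H v x t0" by (rule early) (auto simp: t0_def)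
    moreover have "continuous_on {t0..t} (H v x)"
      unfolding H_def by (intro continuous_intros continuous_on_stretch)
    \<comment> \<open>H equals \<open>E\<close> at s and is below \<eta> E at t: this is the
      decrease that \<open>small_after_decrease\<close> exploits.\<close>
    ultimately obtain s where s: "t0 \<le> s" "s \<le> t" "H v x s = E"
      using IVT2'[of "H v x" t E t0] small' by auto
    have s0: "0 \<le> s" "\<tau> 0 \<le> s" using s by (auto simp: t0_def)
    define m where "m = nat \<lfloor>(s - \<tau> 0) / T\<rfloor>"
    have m: "\<tau> m \<le> s" "s \<le> \<tau> (Suc m)"
    proof -
      have "0 \<le> (s - \<tau> 0) / T" using s0 T by simp
      then have "real m \<le> (s - \<tau> 0) / T" "(s - \<tau> 0) / T \<le> real m + 1"
        unfolding m_def by linarith+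
      then show "\<tau> m \<le> s" "s \<le> \<tau> (Suc m)" using T by (simp_all add: \<tau>_def field_simps)
    qed
    have sad: "p1 v \<noteq> 0 \<and> \<bar>p1 v * f1 x + q1 v\<bar> \<le> \<eta> * \<bar>p1 v\<bar> * exp (- (2 * r1 * s))"
      by (rule small_after_decrease[OF r(1,2) s(2) \<eta>(1,2) s(3)[unfolded H_def] small[unfolded H_def]])
    have "exp (- (2 * r1 * s)) \<le> exp (- (2 * r1 * \<tau> m))" using m r by simp
    then have "\<eta> * \<bar>p1 v\<bar> * exp (- (2 * r1 * s)) \<le> \<eta> * \<bar>p1 v\<bar> * (\<gamma> ^ m * \<rho>)"
      unfolding \<tau> using \<eta> by (intro mult_left_mono) auto
    then have "x \<in> D m" unfolding D_def using x(1) v s0 m sad s(3)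
      by (auto intro!: bexI[of _ v] exI[of _ s])
    with x(2) show False by blast
  qed
  have "J \<subseteq> {x. \<exists>e>0. \<forall>v\<in>V. \<forall>t\<ge>0. e \<le> H v x t} \<union> (\<Union>m. D m)"
  proof
    fix x assume "x \<in> J"
    show "x \<in> {x. \<exists>e>0. \<forall>v\<in>V. \<forall>t\<ge>0. e \<le> H v x t} \<union> (\<Union>m. D m)"
    proof (cases "\<exists>m. x \<in> D m")
      case False
      then have "\<forall>v\<in>V. \<forall>t\<ge>0. \<eta> * E \<le> H v x t" using cover \<open>x \<in> J\<close> by blast
      moreover have "0 < \<eta> * E" using \<eta> E by simp
      ultimately show ?thesis by blast
    qed blast
  qed
  then show ?thesis using close by (intro exI[of _ D]) blast
qed

section \<open>Minkowski's theorem on linear forms\<close>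

text \<open>Used to compute the covolume of the rank-four lattice in
  \<open>short_lattice_vector\<close>.\<close>

lemma det_4:
  "det (A::'a::comm_ring_1^4^4) =
     A$1$1 * (A$2$2 * (A$3$3 * A$4$4)) -
     A$1$1 * (A$2$2 * (A$3$4 * A$4$3)) +
     (A$1$1 * (A$2$3 * (A$3$4 * A$4$2)) -
      A$1$1 * (A$2$3 * (A$3$2 * A$4$4)) +
      (A$1$1 * (A$2$4 * (A$3$2 * A$4$3)) -
       A$1$1 * (A$2$4 * (A$3$3 * A$4$2)))) +
     (A$1$2 * (A$2$1 * (A$3$4 * A$4$3)) -
      A$1$2 * (A$2$1 * (A$3$3 * A$4$4)) +
      (A$1$2 * (A$2$3 * (A$3$1 * A$4$4)) -
       A$1$2 * (A$2$3 * (A$3$4 * A$4$1)) +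
       (A$1$2 * (A$2$4 * (A$3$3 * A$4$1)) -
        A$1$2 * (A$2$4 * (A$3$1 * A$4$3)))) +
      (A$1$3 * (A$2$2 * (A$3$4 * A$4$1)) -
       A$1$3 * (A$2$2 * (A$3$1 * A$4$4)) +
       (A$1$3 * (A$2$1 * (A$3$2 * A$4$4)) -
        A$1$3 * (A$2$1 * (A$3$4 * A$4$2)) +
        (A$1$3 * (A$2$4 * (A$3$1 * A$4$2)) -
         A$1$3 * (A$2$4 * (A$3$2 * A$4$1)))) +
       (A$1$4 * (A$2$2 * (A$3$1 * A$4$3)) -
        A$1$4 * (A$2$2 * (A$3$3 * A$4$1)) +
        (A$1$4 * (A$2$3 * (A$3$2 * A$4$1)) -
         A$1$4 * (A$2$3 * (A$3$1 * A$4$2)) +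
         (A$1$4 * (A$2$1 * (A$3$3 * A$4$2)) -
          A$1$4 * (A$2$1 * (A$3$2 * A$4$3)))))))"
proof -
  have f1: "finite {2::4, 3, 4}" "1 \<notin> {2::4, 3, 4}" by auto
  have f2: "finite {3::4, 4}" "2 \<notin> {3::4, 4}" by auto
  have f3: "finite {4::4}" "3 \<notin> {4::4}" by auto
  show ?thesis
    unfolding det_def UNIV_4
    unfolding sum_over_permutations_insert[OF f1]
    unfolding sum_over_permutations_insert[OF f2]
    unfolding sum_over_permutations_insert[OF f3]
    unfolding permutes_sing
    by (simp add: sign_swap_id permutation_swap_id sign_compose permutation_compose sign_id swap_id_eq)
qed

lemma finite_bounded_int_vectors:
  "finite {z :: real^'n. \<forall>i. z $ i \<in> \<int> \<and> \<bar>z $ i\<bar> \<le> K}"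
proof -
  have "{z :: real^'n. \<forall>i. z $ i \<in> \<int> \<and> \<bar>z $ i\<bar> \<le> K} \<subseteq>
      (\<lambda>f. \<chi> i. real_of_int (f i)) ` (PiE UNIV (\<lambda>_. {- \<lceil>K\<rceil>..\<lceil>K\<rceil>}))"
  proof
    fix z :: "real^'n" assume z: "z \<in> {z. \<forall>i. z $ i \<in> \<int> \<and> \<bar>z $ i\<bar> \<le> K}"
    have "z $ i = of_int \<lfloor>z $ i\<rfloor>" for i using z by simp
    moreover have "\<lfloor>z $ i\<rfloor> \<in> {- \<lceil>K\<rceil>..\<lceil>K\<rceil>}" for i
    proof -
      have "\<bar>z $ i\<bar> \<le> K" using z by simp
      then show ?thesis by simp linarith
    qed
    ultimately show "z \<in> (\<lambda>f. \<chi> i. real_of_int (f i)) ` (PiE UNIV (\<lambda>_. {- \<lceil>K\<rceil>..\<lceil>K\<rceil>}))"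
      by (intro image_eqI[where x = "\<lambda>i. \<lfloor>z $ i\<rfloor>"]) (auto simp: vec_eq_iff)
  qed
  then show ?thesis by (rule finite_subset) (simp add: finite_PiE)
qed

text \<open>Cut S along the integer cells and translate all pieces into the half-open unit cube. If
  no two points of S differed by an integral vector, the pieces would be disjoint and their total
  measure at most 1. Boundedness makes the number of pieces finite.\<close>

lemma blichfeldt:
  fixes S :: "(real^'n::{finite,wellorder}) set"
  assumes S: "S \<in> lmeasurable" "bounded S" and big: "measure lebesgue S > 1"
  obtains x y where "x \<in> S" "y \<in> S" "x \<noteq> y" "\<And>i. (x - y) $ i \<in> \<int>"
proof (rule ccontr)
  assume contra: "\<not> thesis"
  have none: "x = y" if "x \<in> S" "y \<in> S" "\<And>i. (x - y) $ i \<in> \<int>" for x y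
    using contra \<open>\<And>y x. \<lbrakk>x \<in> S; y \<in> S; x \<noteq> y; \<And>i. (x - y) $ i \<in> \<int>\<rbrakk> \<Longrightarrow> thesis\<close>[OF that(1,2) _ that(3)] by blast
  define Q where "Q = {x :: (real, 'n) vec. \<forall>i. 0 \<le> x $ i \<and> x $ i < 1}"
  obtain K where K: "\<And>x. x \<in> S \<Longrightarrow> norm x \<le> K" using S(2) by (auto simp: bounded_iff)
  define F where "F = (\<lambda>x. (\<chi> i. of_int \<lfloor>x $ i\<rfloor>) :: (real, 'n) vec) ` S"
  have "F \<subseteq> {z :: (real, 'n) vec. \<forall>i. z $ i \<in> \<int> \<and> \<bar>z $ i\<bar> \<le> K + 1}"
  proof (clarsimp simp: F_def)
    fix x i assume "x \<in> S"
    then have "\<bar>x $ i\<bar> \<le> K" using K component_le_norm_cart order_trans by blast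
    then show "\<bar>real_of_int \<lfloor>x $ i\<rfloor>\<bar> \<le> K + 1" by linarith
  qed
  then have F: "finite F" using finite_bounded_int_vectors finite_subset by blast
  have Fint: "z $ i \<in> \<int>" if "z \<in> F" for z i using that by (auto simp: F_def)
  define T where "T = (\<lambda>z. Q \<inter> (+) (- z) ` S)"
  have Qs: "Q \<in> sets lebesgue"
  proof -
    have "Q \<in> sets borel" unfolding Q_def by measurable
    then show ?thesis by simp
  qed
  have T: "T z \<in> lmeasurable" for z
    unfolding T_def Int_commute[of Q]
    by (intro fmeasurable_Int_fmeasurable measurable_translation S Qs)
  have cover: "S \<subseteq> (\<Union>z\<in>F. (+) z ` T z)"
  proof
    fix x assume x: "x \<in> S"
    define z where "z = ((\<chi> i. of_int \<lfloor>x $ i\<rfloor>) :: (real, 'n) vec)"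
    have "0 \<le> (x - z) $ i \<and> (x - z) $ i < 1" for i
      by (simp add: z_def) linarith
    then have "x - z \<in> T z" using x by (auto simp: T_def Q_def)
    moreover have "z \<in> F" using x by (simp add: F_def z_def)
    ultimately show "x \<in> (\<Union>z\<in>F. (+) z ` T z)"
      by (intro UN_I[of z] image_eqI[of _ _ "x - z"]) auto
  qed
  have disj: "pairwise (\<lambda>z z'. disjnt (T z) (T z')) F"
  proof (clarsimp simp: pairwise_def disjnt_def)
    fix z z' assume z: "z \<in> F" "z' \<in> F" "z \<noteq> z'"
    have False if t: "t \<in> T z" "t \<in> T z'" for t
    proof -
      obtain x x' where x: "x \<in> S" "x' \<in> S" "t = - z + x" "t = - z' + x'"
        using t unfolding T_def by blast
      then have "x - x' = z - z'"  by (simp add: algebra_simps)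
      then have "x = x'"
        using none[of x x'] Fint z x by simp
      with \<open>x - x' = z - z'\<close> z show False by simp
    qed
    then show "T z \<inter> T z' = {}" by blast
  qed
  have "measure lebesgue S \<le> measure lebesgue (\<Union>z\<in>F. (+) z ` T z)"
    using cover S F T by (intro measure_mono_fmeasurable fmeasurable.finite_UN measurable_translation) (auto simp: fmeasurableD)
  also have "\<dots> \<le> (\<Sum>z\<in>F. measure lebesgue ((+) z ` T z))"
    using F T by (intro measure_UNION_le fmeasurableD measurable_translation) auto
  also have "\<dots> = (\<Sum>z\<in>F. measure lebesgue (T z))" by (simp add: measure_translation)
  also have "\<dots> = measure lebesgue (\<Union>z\<in>F. T z)"
    using F T disj by (intro measure_UNION'[symmetric]) auto
  also have "\<dots> \<le> measure lebesgue (cbox 0 (1 :: (real, 'n) vec))"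
    using F T by (intro measure_mono_fmeasurable fmeasurableD fmeasurable.finite_UN)
      (auto simp: T_def Q_def mem_box_cart less_imp_le)
  also have "\<dots> = 1"
  proof -
    have "0 \<in> cbox 0 (1 :: (real, 'n) vec)" by (simp add: mem_box_cart)
    then show ?thesis by (auto simp: content_cbox_if_cart)
  qed
  finally show False using big by simp
qed

text \<open>The preimage of the cube [0, s]^n under A has measure s^n / \<bar>det A\<bar> > 1. Two
  of its points differ by a nonzero integral vector, and the image of this difference lies in
  [-s, s]^n. Starting from the one-sided cube takes the place of halving a symmetric body.\<close>

theorem minkowski_linear_forms:
  fixes A :: "((real, 'n::{finite,wellorder}) vec, 'n) vec"
  assumes A: "det A \<noteq> 0" and s: "\<bar>det A\<bar> < s ^ CARD('n)" "0 < s"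
  obtains z :: "'n \<Rightarrow> int" where "z \<noteq> (\<lambda>_. 0)" "\<And>i. \<bar>(A *v (\<chi> j. of_int (z j))) $ i\<bar> \<le> s"
proof -
  obtain B where AB: "A ** B = mat 1" using A by (metis invertible_det_nz invertible_def)
  then have "det A * det B = 1" by (metis det_I det_mul)
  then have detB: "\<bar>det B\<bar> = 1 / \<bar>det A\<bar>" using A by (simp add: field_simps flip: abs_mult)
  define C where "C = cbox 0 ((\<chi> i. s) :: (real, 'n) vec)"
  define S where "S = (*v) B ` C"
  have "measure lebesgue S = \<bar>det B\<bar> * measure lebesgue C"
    unfolding S_def by (subst measure_linear_image) (auto simp: C_def matrix_vector_mul_linear)
  also have "measure lebesgue C = s ^ CARD('n)"
  proof -
    have "0 \<in> C" using s(2) by (simp add: C_def mem_box_cart)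
    then show ?thesis by (auto simp: C_def content_cbox_if_cart)
  qed
  finally have "measure lebesgue S = s ^ CARD('n) / \<bar>det A\<bar>" by (simp add: detB)
  moreover have "1 < s ^ CARD('n) / \<bar>det A\<bar>" using A s(1) by simp
  ultimately have "measure lebesgue S > 1" by simp
  moreover have "S \<in> lmeasurable"
    unfolding S_def by (intro measurable_linear_image) (auto simp: C_def matrix_vector_mul_linear)
  moreover have "bounded S"
    unfolding S_def C_def by (intro bounded_linear_image) (auto simp: matrix_vector_mul_bounded_linear)
  ultimately obtain x y where xy: "x \<in> S" "y \<in> S" "x \<noteq> y" "\<And>i. (x - y) $ i \<in> \<int>"
    using blichfeldt[of S] by blast
  obtain u v where u: "u \<in> C" "x = B *v u" and v: "v \<in> C" "y = B *v v" using xy by (auto simp: S_def)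
  have "A *v (x - y) = u - v"
    by (simp add: u v matrix_vector_mult_diff_distrib matrix_vector_mul_assoc AB)
  moreover have "\<bar>(u - v) $ i\<bar> \<le> s" for i
  proof -
    have "0 \<le> u $ i" "u $ i \<le> s" "0 \<le> v $ i" "v $ i \<le> s" using u v by (simp_all add: C_def mem_box_cart)
    then show ?thesis by simp
  qed
  moreover define z where "z = (\<lambda>i. \<lfloor>(x - y) $ i\<rfloor>)"
  have eq: "(\<chi> j. of_int (z j)) = x - y" using xy(4) by (simp add: vec_eq_iff z_def)
  ultimately have "\<bar>(A *v (\<chi> j. of_int (z j))) $ i\<bar> \<le> s" for i by simp
  moreover have "z \<noteq> (\<lambda>_. 0)" using eq xy(3) by (auto simp: vec_eq_iff)
  ultimately show ?thesis using that by blast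
qed

section \<open>Integers of a real quadratic field\<close>

context
  fixes \<sigma> :: "'k::field_char_0 \<Rightarrow> real"
  assumes \<sigma>: "\<sigma> \<in> real_embeddings"
begin

lemma embedding_1: "\<sigma> 1 = 1" and embedding_add: "\<sigma> (x + y) = \<sigma> x + \<sigma> y"
  and embedding_mult: "\<sigma> (x * y) = \<sigma> x * \<sigma> y"
  using \<sigma> by (auto simp: real_embeddings_def)

lemma embedding_0: "\<sigma> 0 = 0"
  using embedding_add[of 0 0] by simp

lemma embedding_minus: "\<sigma> (- x) = - \<sigma> x"
  using embedding_add[of x "- x"] by (simp add: embedding_0)

lemma embedding_diff: "\<sigma> (x - y) = \<sigma> x - \<sigma> y"
  using embedding_add[of x "- y"] by (simp add: embedding_minus)

lemma embedding_of_nat: "\<sigma> (of_nat n) = of_nat n"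
  by (induction n) (simp_all add: embedding_0 embedding_1 embedding_add)

lemma embedding_of_int: "\<sigma> (of_int n) = of_int n"
  by (cases n) (simp_all add: embedding_of_nat embedding_minus embedding_diff embedding_1)

lemma embedding_eq_0_iff: "\<sigma> x = 0 \<longleftrightarrow> x = 0"
  using embedding_mult[of x "inverse x"] embedding_0 embedding_1 by (cases "x = 0") auto

lemma embedding_of_rat: "\<sigma> (of_rat q) = of_rat q"
proof -
  obtain a b where q: "quotient_of q = (a, b)" by force
  then have b: "b > 0" and q: "q = of_int a / of_int b"
    using quotient_of_denom_pos quotient_of_div by blast+
  have "\<sigma> (of_rat q) * of_int b = \<sigma> (of_rat q * of_int b)" by (simp add: embedding_mult embedding_of_int)
  also have "of_rat q * of_int b = (of_int a :: 'k)" using b by (simp add: q of_rat_divide)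
  finally show ?thesis using b by (simp add: q of_rat_divide embedding_of_int field_simps)
qed

end

lemmas embedding_simps = embedding_0 embedding_1 embedding_add embedding_minus embedding_diff
  embedding_mult embedding_of_int embedding_of_rat embedding_eq_0_iff

text \<open>The embeddings are parameters so that the locale can be interpreted a second time with
  their roles exchanged, when the larger weight belongs to the other one.\<close>

locale quadratic_field =
  fixes \<theta> :: "'k::field_char_0" and D :: int and \<sigma>1 \<sigma>2 :: "'k \<Rightarrow> real"
  assumes \<theta>_square: "\<theta> * \<theta> = of_int D"
    and basis: "\<exists>a b. x = of_rat a + of_rat b * \<theta>"
    and embeddings: "real_embeddings = {\<sigma>1, \<sigma>2}"
    and \<sigma>2_\<theta>: "\<sigma>2 \<theta> = - \<sigma>1 \<theta>" and \<sigma>1_\<theta>: "\<sigma>1 \<theta> \<noteq> 0"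

text \<open>An exchange argument: in 1 = a u + b v one coefficient is nonzero, so 1 can replace a
  basis vector. The other one is irrational, since otherwise 1 would span the field.\<close>

lemma quadratic_basis:
  assumes "real_quadratic_field TYPE('k::field_char_0)"
  obtains \<theta> :: "'k::field_char_0" where "\<theta> \<notin> \<rat>" "\<And>x. \<exists>a b. x = of_rat a + of_rat b * \<theta>"
proof -
  interpret vector_space "\<lambda>q x. of_rat q * x :: 'k"
    by unfold_locales (auto simp: algebra_simps of_rat_add of_rat_mult)
  have dim: "dim (UNIV :: 'k set) = 2" using assms by (simp add: real_quadratic_field_def)
  obtain B where B: "independent B" "UNIV \<subseteq> span B" "card B = 2"
    using basis_exists[of UNIV] dim by metis
  then obtain u v where uv: "B = {u, v}" by (auto simp: card_2_iff)
  have rep: "\<exists>a b. x = of_rat a * u + of_rat b * v" for x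
  proof -
    have "x \<in> span {u, v}" using B uv by auto
    then obtain a b where "x - of_rat a * u = of_rat b * v"
      by (auto simp: span_insert span_singleton)
    then show ?thesis by (metis add.commute diff_add_cancel)
  qed
  obtain w :: 'k where w: "\<And>x. \<exists>a b. x = of_rat a + of_rat b * w"
  proof -
    obtain a b where ab: "1 = of_rat a * u + of_rat b * v" using rep by blast
    show ?thesis
    proof (cases "a = 0")
      case True
      with ab have "b \<noteq> 0" by auto
      then have v: "v = of_rat (1 / b)" using ab True by (simp add: of_rat_divide field_simps)
      show ?thesis
      proof (rule that[of u])
        fix x obtain c d where "x = of_rat c * u + of_rat d * v" using rep by blast
        then have "x = of_rat (d * (1/b)) + of_rat c * u" by (simp add: v of_rat_mult of_rat_divide)
        then show "\<exists>a b. x = of_rat a + of_rat b * u" by blast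
      qed
    next
      case False
      then have u: "u = of_rat (1 / a) - of_rat (b / a) * v"
        using ab by (simp add: of_rat_divide field_simps)
      show ?thesis
      proof (rule that[of v])
        fix x obtain c d where "x = of_rat c * u + of_rat d * v" using rep by blast
        then have "x = of_rat (c * (1/a)) + of_rat (d - c * (b / a)) * v"
          unfolding u of_rat_diff of_rat_mult by (simp add: algebra_simps)
        then show "\<exists>a b. x = of_rat a + of_rat b * v" by blast
      qed
    qed
  qed
  moreover have "w \<notin> \<rat>"
  proof
    assume "w \<in> \<rat>"
    then obtain q where q: "w = of_rat q" by (auto elim: Rats_cases)
    have "x \<in> span {1}" for x
    proof -
      obtain a b where "x = of_rat a + of_rat b * w" using w by blast
      then have "x = of_rat (a + b * q) * 1" by (simp add: q of_rat_add of_rat_mult)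
      then show ?thesis by (auto simp: span_singleton)
    qed
    then have "dim (UNIV :: 'k set) \<le> card {1 :: 'k}" by (intro dim_le_card) auto
    then show False using dim by simp
  qed
  ultimately show ?thesis using that by blast
qed

lemma quadratic_sqrt_basis:
  assumes "real_quadratic_field TYPE('k::field_char_0)"
  obtains \<theta> :: "'k::field_char_0" and D :: int where "\<theta> \<notin> \<rat>" "\<theta> * \<theta> = of_int D" "\<And>x. \<exists>a b. x = of_rat a + of_rat b * \<theta>"
proof -
  obtain w :: 'k where w: "w \<notin> \<rat>" "\<And>x. \<exists>a b. x = of_rat a + of_rat b * w"
    using quadratic_basis[OF assms] by blast
  obtain a b where ab: "w * w = of_rat a + of_rat b * w" using w(2) by blast
  define q where "q = a + b * b / 4"
  obtain m n where mn: "quotient_of q = (m, n)" by force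
  then have n: "n > 0" and q: "q = of_int m / of_int n"
    using quotient_of_denom_pos quotient_of_div by blast+
  \<comment> \<open>Completing the square turns w into a square root of q = m/n; multiplying by n
    turns it into a square root of the integer n m.\<close>
  define \<theta> where "\<theta> = of_int n * (w - of_rat (b / 2))"
  have w\<theta>: "w = \<theta> / of_int n + of_rat (b / 2)" using n by (simp add: \<theta>_def)
  have "(w - of_rat (b / 2)) * (w - of_rat (b / 2)) = of_rat q"
    using ab by (simp add: q_def of_rat_add of_rat_divide of_rat_mult algebra_simps)
  then have "\<theta> * \<theta> = of_int n * of_int n * of_rat q" by (simp add: \<theta>_def mult_ac)
  also have "\<dots> = of_int (n * m)" using n by (simp add: q of_rat_divide)
  finally have sq: "\<theta> * \<theta> = of_int (n * m)" .
  have irr: "\<theta> \<notin> \<rat>"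
  proof
    assume "\<theta> \<in> \<rat>"
    then have "w \<in> \<rat>" unfolding w\<theta> by (intro Rats_add Rats_divide) auto
    with w(1) show False by simp
  qed
  have "\<exists>a b. x = of_rat a + of_rat b * \<theta>" for x
  proof -
    obtain c d where "x = of_rat c + of_rat d * w" using w(2) by blast
    then have "x = of_rat (c + d * (b / 2)) + of_rat (d / of_int n) * \<theta>"
      unfolding w\<theta> by (simp add: of_rat_add of_rat_mult of_rat_divide algebra_simps)
    then show ?thesis by blast
  qed
  with sq irr show ?thesis using that by blast
qed

text \<open>Conjugating the given embedding by \<theta> -> - \<theta> yields the second one. There
  are no others, because an embedding is determined by its value at \<theta>, a real square root of
  D.\<close>

lemma real_quadratic_fieldE:
  assumes "real_quadratic_field TYPE('k::field_char_0)"
  obtains \<theta> :: "'k::field_char_0" and D \<sigma>1 \<sigma>2 where "quadratic_field \<theta> D \<sigma>1 \<sigma>2"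
proof -
  obtain \<theta> :: 'k and D :: int where \<theta>: "\<theta> \<notin> \<rat>" "\<theta> * \<theta> = of_int D" "\<And>x. \<exists>a b. x = of_rat a + of_rat b * \<theta>"
    using quadratic_sqrt_basis[OF assms] by blast
  have uniq: "a = c \<and> b = d" if "of_rat a + of_rat b * \<theta> = of_rat c + of_rat d * \<theta>" for a b c d
  proof -
    have *: "of_rat (b - d) * \<theta> = of_rat (c - a)" using that by (simp add: of_rat_diff algebra_simps)
    have "b = d"
    proof (rule ccontr)
      assume "b \<noteq> d"
      then have "\<theta> = of_rat ((c - a) / (b - d))" using * by (simp add: of_rat_divide field_simps)
      then show False using \<theta>(1) by auto
    qed
    then show ?thesis using that by simp
  qed
  obtain \<sigma> :: "'k \<Rightarrow> real" where \<sigma>: "\<sigma> \<in> real_embeddings" using assms by (auto simp: real_quadratic_field_def)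
  obtain A B where AB: "\<And>x. x = of_rat (A x) + of_rat (B x) * \<theta>" using \<theta>(3) by metis
  have coords: "A (of_rat a + of_rat b * \<theta>) = a" "B (of_rat a + of_rat b * \<theta>) = b" for a b
    using uniq AB[of "of_rat a + of_rat b * \<theta>"] by metis+
  define \<tau> where "\<tau> = (\<lambda>x. of_rat (A x) - of_rat (B x) * \<sigma> \<theta>)"
  have \<tau>: "\<tau> (of_rat a + of_rat b * \<theta>) = of_rat a - of_rat b * \<sigma> \<theta>" for a b
    by (simp add: \<tau>_def coords)
  have s2: "\<sigma> \<theta> * \<sigma> \<theta> = of_int D"
    using \<theta>(2) embedding_mult[OF \<sigma>, of \<theta> \<theta>] by (simp add: embedding_of_int[OF \<sigma>])
  have "\<tau> 1 = 1" using \<tau>[of 1 0] by simp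
  moreover have "\<tau> (x + y) = \<tau> x + \<tau> y" for x y
  proof -
    have "x + y = of_rat (A x + A y) + of_rat (B x + B y) * \<theta>"
      by (subst AB[of x], subst AB[of y]) (simp add: of_rat_add algebra_simps)
    then have "\<tau> (x + y) = of_rat (A x + A y) - of_rat (B x + B y) * \<sigma> \<theta>" by (simp only: \<tau>)
    then show ?thesis by (simp add: \<tau>_def of_rat_add algebra_simps)
  qed
  moreover have "\<tau> (x * y) = \<tau> x * \<tau> y" for x y
  proof -
    have "x * y = of_rat (A x * A y) + of_rat (A x * B y + B x * A y) * \<theta> + of_rat (B x * B y) * (\<theta> * \<theta>)"
      by (subst AB[of x], subst AB[of y]) (simp add: of_rat_add of_rat_mult algebra_simps)
    also have "\<dots> = of_rat (A x * A y + B x * B y * of_int D) + of_rat (A x * B y + B x * A y) * \<theta>"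
      unfolding \<theta>(2) by (simp add: of_rat_add of_rat_mult)
    finally have "\<tau> (x * y) = of_rat (A x * A y + B x * B y * of_int D) - of_rat (A x * B y + B x * A y) * \<sigma> \<theta>"
      by (simp only: \<tau>)
    also have "\<dots> = \<tau> x * \<tau> y"
      by (simp add: \<tau>_def of_rat_add of_rat_mult s2[symmetric] algebra_simps)
    finally show ?thesis .
  qed
  ultimately have \<tau>e: "\<tau> \<in> real_embeddings" by (simp add: real_embeddings_def)
  have "\<upsilon> = \<sigma> \<or> \<upsilon> = \<tau>" if \<upsilon>: "\<upsilon> \<in> real_embeddings" for \<upsilon>
  proof -
    have "\<upsilon> \<theta> * \<upsilon> \<theta> = of_int D"
      using \<theta>(2) embedding_mult[OF \<upsilon>, of \<theta> \<theta>] by (simp add: embedding_of_int[OF \<upsilon>])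
    then have "\<upsilon> \<theta> = \<sigma> \<theta> \<or> \<upsilon> \<theta> = - \<sigma> \<theta>" using s2 by (metis square_eq_iff)
    moreover have u: "\<upsilon> x = of_rat (A x) + of_rat (B x) * \<upsilon> \<theta>" for x
      by (subst AB[of x]) (simp add: embedding_simps[OF \<upsilon>])
    moreover have v: "\<sigma> x = of_rat (A x) + of_rat (B x) * \<sigma> \<theta>" for x
      by (subst AB[of x]) (simp add: embedding_simps[OF \<sigma>])
    ultimately show ?thesis
    proof (elim disjE)
      assume "\<upsilon> \<theta> = \<sigma> \<theta>"
      then have "\<upsilon> x = \<sigma> x" for x unfolding u[of x] v[of x] by simp
      then show ?thesis by blast
    next
      assume "\<upsilon> \<theta> = - \<sigma> \<theta>"
      then have "\<upsilon> x = \<tau> x" for x unfolding u[of x] \<tau>_def by simp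
      then show ?thesis by blast
    qed
  qed
  then have "real_embeddings = {\<sigma>, \<tau>}" using \<sigma> \<tau>e by blast
  moreover have "\<tau> \<theta> = - \<sigma> \<theta>" using \<tau>[of 0 1] by simp
  moreover have "\<sigma> \<theta> \<noteq> 0" using \<theta>(1) by (auto simp: embedding_simps[OF \<sigma>])
  ultimately have "quadratic_field \<theta> D \<sigma> \<tau>" using \<theta> by unfold_locales auto
  then show ?thesis using that by blast
qed


section \<open>Algebraic integers described by trace and norm\<close>

lemma map_poly_of_int_mult:
  "map_poly of_int (p * q) = (map_poly of_int p * map_poly of_int q :: 'a::comm_ring_1 poly)"
  by (rule poly_eqI) (simp add: coeff_map_poly coeff_mult)

lemma map_poly_of_int_add:
  "map_poly of_int (p + q) = (map_poly of_int p + map_poly of_int q :: 'a::comm_ring_1 poly)"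
  by (rule poly_eqI) (simp add: coeff_map_poly)

text \<open>Gauss's lemma: the primitive integral quadratic of \<open>x\<close> divides a monic integral polynomial.\<close>

lemma algebraic_int_quadratic_coeffs:
  fixes x :: "'a::field_char_0"
  assumes x: "x \<notin> \<rat>" "algebraic_int x" and eq: "x * x - of_rat t * x + of_rat n = 0"
  shows "t \<in> \<int> \<and> n \<in> \<int>"
proof -
  let ?ev = "\<lambda>p. poly (map_poly of_int p) x"
  obtain p where p: "?ev p = 0" "lead_coeff p = 1"
    using x(2) algebraic_int_altdef_ipoly by blast
  obtain t1 t2 where "quotient_of t = (t1, t2)" by force
  then have t: "t2 > 0" "t = of_int t1 / of_int t2" using quotient_of_denom_pos quotient_of_div by blast+
  obtain n1 n2 where "quotient_of n = (n1, n2)" by force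
  then have n: "n2 > 0" "n = of_int n1 / of_int n2" using quotient_of_denom_pos quotient_of_div by blast+
  \<comment> \<open>The minimal equation with denominators cleared; dividing by the content makes it
    primitive.\<close>
  define F0 where "F0 = [:n1 * t2, - (t1 * n2), t2 * n2:]"
  define F where "F = primitive_part F0"
  have F0: "F0 = smult (content F0) F" by (simp add: F_def)
  have "F0 \<noteq> 0" using t n by (simp add: F0_def)
  then have c0: "content F0 \<noteq> 0" and F_nz: "F \<noteq> 0" by (simp_all add: F_def)
  have "degree F0 = 2" using t n by (simp add: F0_def)
  then have degF: "degree F = 2" by (simp add: F_def)
  have "content F = 1" using \<open>F0 \<noteq> 0\<close> by (simp add: F_def)
  have "?ev F0 = of_int (t2 * n2) * (x * x - of_rat t * x + of_rat n)"
  proof -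
    have tt: "(of_int t1 :: 'a) = of_rat t * of_int t2" and nn: "(of_int n1 :: 'a) = of_rat n * of_int n2"
      using t n by (simp_all add: of_rat_divide)
    show ?thesis by (simp add: F0_def map_poly_pCons tt nn algebra_simps)
  qed
  then have "of_int (content F0) * ?ev F = 0"
    using eq by (subst (asm) F0) (simp add: map_poly_smult)
  then have evF: "?ev F = 0" using c0 by simp
  \<comment> \<open>The remainder of the pseudo-division has degree below 2 and vanishes at the
    irrational x, hence it is zero.\<close>
  obtain q r where qr: "pseudo_divmod p F = (q, r)" by force
  define a where "a = coeff F (degree F) ^ (Suc (degree p) - degree F)"
  have div: "smult a p = F * q + r" and r: "r = 0 \<or> degree r < 2"
    using pseudo_divmod[OF F_nz qr] degF by (simp_all add: a_def)
  have "?ev (smult a p) = ?ev F * ?ev q + ?ev r"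
    unfolding div map_poly_of_int_add map_poly_of_int_mult by simp
  then have evr: "?ev r = 0" using p evF by (simp add: map_poly_smult)
  have "r = 0"
  proof -
    have "degree r \<le> 1" using r by auto
    then have req: "r = [:coeff r 0, coeff r 1:]"
      by (intro poly_eqI) (auto simp: coeff_pCons coeff_eq_0 split: nat.splits)
    have lin: "of_int (coeff r 0) + x * of_int (coeff r 1) = 0"
      using evr by (subst (asm) req) (simp add: map_poly_pCons)
    have "coeff r 1 = 0"
    proof (rule ccontr)
      assume "coeff r 1 \<noteq> 0"
      then have "x = - of_int (coeff r 0) / of_int (coeff r 1)"
        using lin by (simp add: field_simps add_eq_0_iff)
      then show False using x(1) by (metis Rats_divide Rats_minus_iff Rats_of_int)
    qed
    with lin have "coeff r 0 = 0" by simp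
    with \<open>coeff r 1 = 0\<close> show ?thesis by (subst req) simp
  qed
  have "a \<noteq> 0" using F_nz by (simp add: a_def)
  have "content p = 1"
  proof -
    have "content p dvd lead_coeff p" by simp
    then show ?thesis using p(2) by (metis is_unit_content_iff)
  qed
  \<comment> \<open>Contents are multiplicative and F and p have content 1. After cancelling
    \<bar>a\<bar>, comparison of leading coefficients shows that the leading coefficient of F is a
    unit.\<close>
  then have "content q = \<bar>a\<bar>"
    using arg_cong[OF div, of content] \<open>content F = 1\<close> \<open>r = 0\<close> by (simp add: content_mult)
  then have "smult a p = smult \<bar>a\<bar> (F * primitive_part q)"
    using div \<open>r = 0\<close> content_times_primitive_part[of q] by (metis add.right_neutral mult_smult_right)
  then have "a * lead_coeff p = \<bar>a\<bar> * (lead_coeff F * lead_coeff (primitive_part q))"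
    by (metis lead_coeff_mult lead_coeff_smult)
  then have "\<bar>a\<bar> * 1 = \<bar>a\<bar> * \<bar>lead_coeff F * lead_coeff (primitive_part q)\<bar>"
    using p(2) by (metis abs_abs abs_mult mult.right_neutral)
  then have "\<bar>lead_coeff F * lead_coeff (primitive_part q)\<bar> = 1" using \<open>a \<noteq> 0\<close> by simp
  then have lF: "\<bar>lead_coeff F\<bar> = 1" by (metis abs_mult abs_zmult_eq_1)
  have coeffF0: "coeff F0 i = content F0 * coeff F i" for i by (metis F0 coeff_smult)
  have "t2 * n2 = content F0 * coeff F 2" "- (t1 * n2) = content F0 * coeff F 1" "n1 * t2 = content F0 * coeff F 0"
    unfolding coeffF0[symmetric] by (simp_all add: F0_def numeral_2_eq_2)
  moreover have "coeff F 2 = 1 \<or> coeff F 2 = - 1" using lF degF by auto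
  \<comment> \<open>F is monic up to sign, so the leading coefficient of \<open>F0\<close> is its
    content up to sign and divides the other coefficients.\<close>
  ultimately have "t2 * n2 dvd - (t1 * n2)" "t2 * n2 dvd n1 * t2" by auto
  then have "t2 dvd t1" "n2 dvd n1" using t(1) n(1) by (simp_all add: mult.commute[of t2])
  then obtain k l where "t1 = t2 * k" "n1 = n2 * l" by (elim dvdE)
  then show ?thesis using t n by simp
qed

context quadratic_field
begin

lemma embedding1: "\<sigma>1 \<in> real_embeddings" and embedding2: "\<sigma>2 \<in> real_embeddings"
  using embeddings by auto

lemmas \<sigma>_simps = embedding_simps[OF embedding1] embedding_simps[OF embedding2] \<sigma>2_\<theta>

lemma \<sigma>_neq: "\<sigma>1 \<noteq> \<sigma>2"
  using \<sigma>1_\<theta> \<sigma>2_\<theta> by auto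

lemma \<sigma>1_\<theta>_square: "\<sigma>1 \<theta> * \<sigma>1 \<theta> = of_int D"
  using arg_cong[OF \<theta>_square, of \<sigma>1] by (simp add: \<sigma>_simps)

lemma trace_norm_rational:
  obtains t n :: rat where "\<sigma>1 x + \<sigma>2 x = of_rat t" "\<sigma>1 x * \<sigma>2 x = of_rat n"
    "x * x - of_rat t * x + of_rat n = 0"
proof -
  obtain a b where x: "x = of_rat a + of_rat b * \<theta>" using basis by blast
  have "of_rat (b * b * of_int D) = of_rat b * of_rat b * (\<sigma>1 \<theta> * \<sigma>1 \<theta>)"
    by (simp add: \<sigma>1_\<theta>_square of_rat_mult)
  then have "\<sigma>1 x * \<sigma>2 x = of_rat (a * a - b * b * of_int D)"
    by (simp add: x \<sigma>_simps of_rat_diff of_rat_mult algebra_simps)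
  moreover have "\<sigma>1 x + \<sigma>2 x = of_rat (2 * a)"
    by (simp add: x \<sigma>_simps of_rat_mult)
  moreover have "x * x - of_rat (2 * a) * x + of_rat (a * a - b * b * of_int D) = 0"
  proof -
    show ?thesis
      by (simp add: x of_rat_diff of_rat_mult algebra_simps) (simp add: mult.assoc mult.left_commute flip: \<theta>_square)
  qed
  ultimately show ?thesis using that by blast
qed

lemma Ints_of_rat_iff: "(of_rat q :: real) \<in> \<int> \<longleftrightarrow> q \<in> \<int>"
  by (metis Ints_cases Ints_of_int of_rat_eq_iff of_rat_of_int_eq)

text \<open>Reduces closure properties of the ring of integers to the integrality of two real
  numbers.\<close>

lemma algebraic_int_iff: "algebraic_int x \<longleftrightarrow> \<sigma>1 x + \<sigma>2 x \<in> \<int> \<and> \<sigma>1 x * \<sigma>2 x \<in> \<int>"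
proof -
  obtain t n :: rat where tn: "\<sigma>1 x + \<sigma>2 x = of_rat t" "\<sigma>1 x * \<sigma>2 x = of_rat n"
    "x * x - of_rat t * x + of_rat n = 0"
    by (rule trace_norm_rational)
  show ?thesis
  proof
    assume x: "algebraic_int x"
    show "\<sigma>1 x + \<sigma>2 x \<in> \<int> \<and> \<sigma>1 x * \<sigma>2 x \<in> \<int>"
    proof (cases "x \<in> \<rat>")
      case True
      then obtain k where "x = of_int k" using rational_algebraic_int_is_int[OF x] by (auto elim: Ints_cases)
      then show ?thesis by (simp add: \<sigma>_simps)
    next
      case False
      then show ?thesis using algebraic_int_quadratic_coeffs[OF False x tn(3)] tn by (simp add: Ints_of_rat_iff)
    qed
  next
    assume "\<sigma>1 x + \<sigma>2 x \<in> \<int> \<and> \<sigma>1 x * \<sigma>2 x \<in> \<int>"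
    then have "t \<in> \<int>" "n \<in> \<int>" unfolding tn Ints_of_rat_iff by auto
    then obtain k l where kl: "t = of_int k" "n = of_int l" by (elim Ints_cases)
    show "algebraic_int x"
      unfolding algebraic_int_altdef_ipoly
      by (intro exI[of _ "[:l, - k, 1:]"]) (use tn(3) kl in \<open>simp add: map_poly_pCons algebra_simps\<close>)
  qed
qed

text \<open>The trace A of x y and the mixed sum B are the roots of a monic integral quadratic: A +
  B is the product of the traces, and A B = N(x) tr(y^2) + N(y) tr(x^2). Since A is rational, it is
  an integer, and then so is B. The second claim is the cross term in the norm of x + y.\<close>

lemma algebraic_int_mult:
  fixes x y :: 'k
  assumes "algebraic_int x" "algebraic_int y"
  shows "algebraic_int (x * y)" "\<sigma>1 x * \<sigma>2 y + \<sigma>2 x * \<sigma>1 y \<in> \<int>"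
proof -
  define A B where "A = \<sigma>1 (x * y) + \<sigma>2 (x * y)" and "B = \<sigma>1 x * \<sigma>2 y + \<sigma>2 x * \<sigma>1 y"
  have x: "\<sigma>1 x + \<sigma>2 x \<in> \<int>" "\<sigma>1 x * \<sigma>2 x \<in> \<int>" and y: "\<sigma>1 y + \<sigma>2 y \<in> \<int>" "\<sigma>1 y * \<sigma>2 y \<in> \<int>"
    using assms by (simp_all add: algebraic_int_iff)
  have sum: "A + B = (\<sigma>1 x + \<sigma>2 x) * (\<sigma>1 y + \<sigma>2 y)"
    by (simp add: A_def B_def \<sigma>_simps algebra_simps)
  have prod: "A * B = (\<sigma>1 x * \<sigma>2 x) * ((\<sigma>1 y + \<sigma>2 y)\<^sup>2 - 2 * (\<sigma>1 y * \<sigma>2 y))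
      + (\<sigma>1 y * \<sigma>2 y) * ((\<sigma>1 x + \<sigma>2 x)\<^sup>2 - 2 * (\<sigma>1 x * \<sigma>2 x))"
    by (simp add: A_def B_def \<sigma>_simps algebra_simps power2_eq_square)
  have sumZ: "A + B \<in> \<int>" unfolding sum using x y by (intro Ints_mult)
  have prodZ: "A * B \<in> \<int>"
  proof -
    obtain a b c d where "\<sigma>1 x + \<sigma>2 x = of_int a" "\<sigma>1 x * \<sigma>2 x = of_int b"
      "\<sigma>1 y + \<sigma>2 y = of_int c" "\<sigma>1 y * \<sigma>2 y = of_int d"
      using x y by (elim Ints_cases)
    then show ?thesis unfolding prod by simp
  qed
  have "A \<in> \<rat>"
    unfolding A_def using trace_norm_rational[of "x * y"] by (metis Rats_of_rat)
  moreover have "algebraic_int A"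
  proof (rule algebraic_int.intros)
    show "lead_coeff [:A * B, - (A + B), 1:] = 1" by simp
    show "\<forall>i. coeff [:A * B, - (A + B), 1:] i \<in> \<int>"
      using sumZ prodZ by (auto simp: coeff_pCons simp del: minus_add_distrib split: nat.splits)
    show "poly [:A * B, - (A + B), 1:] A = 0" by (simp add: algebra_simps)
  qed
  ultimately have A: "A \<in> \<int>" by (intro rational_algebraic_int_is_int)
  moreover have "\<sigma>1 (x * y) * \<sigma>2 (x * y) = (\<sigma>1 x * \<sigma>2 x) * (\<sigma>1 y * \<sigma>2 y)"
    by (simp add: \<sigma>_simps)
  ultimately show "algebraic_int (x * y)" using x y by (simp add: algebraic_int_iff A_def Ints_mult)
  have "B = (A + B) - A" by simp
  then show "\<sigma>1 x * \<sigma>2 y + \<sigma>2 x * \<sigma>1 y \<in> \<int>" using sumZ A Ints_diff unfolding B_def by metis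
qed

lemma algebraic_int_add:
  fixes x y :: 'k
  assumes "algebraic_int x" "algebraic_int y"
  shows "algebraic_int (x + y)"
proof -
  have "\<sigma>1 (x + y) * \<sigma>2 (x + y) = \<sigma>1 x * \<sigma>2 x + \<sigma>1 y * \<sigma>2 y + (\<sigma>1 x * \<sigma>2 y + \<sigma>2 x * \<sigma>1 y)"
    by (simp add: \<sigma>_simps algebra_simps)
  moreover have "\<sigma>1 (x + y) + \<sigma>2 (x + y) = (\<sigma>1 x + \<sigma>2 x) + (\<sigma>1 y + \<sigma>2 y)"
    by (simp add: \<sigma>_simps)
  ultimately show ?thesis using assms algebraic_int_mult(2)[OF assms] by (simp add: algebraic_int_iff)
qed

lemma algebraic_int_diff: "algebraic_int (x :: 'k) \<Longrightarrow> algebraic_int y \<Longrightarrow> algebraic_int (x - y)"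
  using algebraic_int_add[of x "- y"] by simp

lemma algebraic_int_lattice: "algebraic_int (of_int a + of_int b * \<theta>)"
proof -
  have "algebraic_int \<theta>" by (simp add: algebraic_int_iff \<sigma>_simps \<sigma>1_\<theta>_square)
  then show ?thesis
    using algebraic_int_add[OF int_imp_algebraic_int algebraic_int_mult(1)[OF int_imp_algebraic_int]] by simp
qed

lemma norm_less_1_imp_0:
  assumes "algebraic_int x" "\<bar>\<sigma>1 x * \<sigma>2 x\<bar> < 1"
  shows "x = 0"
proof -
  have "\<sigma>1 x * \<sigma>2 x \<in> \<int>" using assms(1) algebraic_int_iff by blast
  then have "\<sigma>1 x * \<sigma>2 x = 0" using assms(2) by (metis Ints_nonzero_abs_less1)
  then show ?thesis by (simp add: \<sigma>_simps)
qed

end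

section \<open>Short vectors and reduction modulo \<open>SL\<^sub>2(O\<^sub>K)\<close>\<close>

text \<open>Row vectors are used because the arithmetic group multiplies from the left. With the
  identity as \<open>\<sigma>\<close> this is the action of a real matrix on a real row
  vector.\<close>

definition vec_act :: "('k \<Rightarrow> real) \<Rightarrow> real^2^2 \<Rightarrow> 'k^2 \<Rightarrow> real^2" where
  "vec_act \<sigma> A v = (\<chi> j. \<sigma> (v $ 1) * A $ 1 $ j + \<sigma> (v $ 2) * A $ 2 $ j)"

definition integral_vectors :: "('k::field_char_0 ^ 2) set" where
  "integral_vectors = {v. v \<noteq> 0 \<and> algebraic_int (v $ 1) \<and> algebraic_int (v $ 2)}"

definition sup_size :: "real^2 \<Rightarrow> real" where
  "sup_size y = max \<bar>y $ 1\<bar> \<bar>y $ 2\<bar>"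

definition vec_det :: "'a::comm_ring_1 ^ 2 \<Rightarrow> 'a ^ 2 \<Rightarrow> 'a" where
  "vec_det v w = v $ 1 * w $ 2 - v $ 2 * w $ 1"

lemma vec_act_nth: "vec_act \<sigma> A v $ j = \<sigma> (v $ 1) * A $ 1 $ j + \<sigma> (v $ 2) * A $ 2 $ j"
  by (simp add: vec_act_def)

lemma vec_act_matrix_mult: "vec_act \<sigma> (A ** B) v = vec_act (\<lambda>x. x) B (vec_act \<sigma> A v)"
  by (simp add: vec_eq_iff vec_act_nth matrix_matrix_mult_def sum_2 algebra_simps)

lemma vec_det_act:
  assumes "\<sigma> \<in> real_embeddings"
  shows "vec_det (vec_act \<sigma> A v) (vec_act \<sigma> A w) = \<sigma> (vec_det v w) * det A"
  by (simp add: vec_det_def vec_act_nth det_2 embedding_simps[OF assms] algebra_simps)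

lemma component_le_sup_size: "\<bar>y $ j\<bar> \<le> sup_size y"
  using exhaust_2[of j] by (auto simp: sup_size_def)

lemma sup_size_le: "(\<And>j. \<bar>y $ j\<bar> \<le> C) \<Longrightarrow> sup_size y \<le> C"
  by (simp add: sup_size_def)

lemma sup_size_nonneg: "0 \<le> sup_size y"
  by (simp add: sup_size_def)

lemma abs_vec_det_le:
  fixes y z :: "real^2"
  assumes "\<And>j. \<bar>y $ j\<bar> \<le> a" "\<And>j. \<bar>z $ j\<bar> \<le> b"
  shows "\<bar>vec_det y z\<bar> \<le> 2 * (a * b)"
proof -
  have a: "0 \<le> a" using assms(1)[of 1] by linarith
  have "\<bar>y $ 1 * z $ 2\<bar> \<le> a * b" "\<bar>y $ 2 * z $ 1\<bar> \<le> a * b"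
    unfolding abs_mult using assms a by (auto intro!: mult_mono)
  then show ?thesis by (simp add: vec_det_def)
qed

context quadratic_field
begin

text \<open>The order Z[\<theta>], possibly smaller than the ring of integers. Its explicit integer
  coordinates are enough to produce short vectors, so an integral basis of the full ring is
  avoided.\<close>

definition lattice :: "'k set" where
  "lattice = {of_int a + of_int b * \<theta> | a b. True}"

lemma algebraic_int_latticeD: "x \<in> lattice \<Longrightarrow> algebraic_int x"
  using algebraic_int_lattice by (auto simp: lattice_def)

text \<open>4 (\<sigma>1 \<theta>)^2 is the covolume of Z[\<theta>]^2 in R^4. Adding 1 makes the
  constant at least 1, hence its fourth power exceeds the covolume.\<close>

definition mink_const :: real where
  "mink_const = 1 + 4 * (\<sigma>1 \<theta>)\<^sup>2"

lemma mink_const_ge_1: "1 \<le> mink_const"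
  by (simp add: mink_const_def)

lemma lattice_coord_eq_0:
  assumes "of_int a + of_int b * \<theta> = 0"
  shows "a = 0 \<and> b = 0"
proof -
  have "of_int a + of_int b * \<sigma>1 \<theta> = 0" "of_int a - of_int b * \<sigma>1 \<theta> = 0"
    using arg_cong[OF assms, of \<sigma>1] arg_cong[OF assms, of \<sigma>2] by (simp_all add: \<sigma>_simps)
  then have "real_of_int a = 0" "of_int b * \<sigma>1 \<theta> = 0" by linarith+
  then show ?thesis using \<sigma>1_\<theta> by simp
qed

text \<open>The four coordinates of v A1 and v A2 are real linear forms in the four integer
  coordinates of v.\<close>

lemma short_lattice_vector:
  assumes "det A1 = 1" "det A2 = 1"
  obtains v where "v \<noteq> 0" "v $ 1 \<in> lattice" "v $ 2 \<in> lattice"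
    "\<And>j. \<bar>vec_act \<sigma>1 A1 v $ j\<bar> \<le> mink_const" "\<And>j. \<bar>vec_act \<sigma>2 A2 v $ j\<bar> \<le> mink_const"
proof -
  define s where "s = \<sigma>1 \<theta>"
  \<comment> \<open>A row lists the coefficients of one coordinate of v A; the second embedding
    replaces s by -s.\<close>
  define R where "R = (\<lambda>s (A :: real^2^2) j. vector [A $ 1 $ j, s * A $ 1 $ j, A $ 2 $ j, s * A $ 2 $ j] :: real^4)"
  define M where "M = (vector [R s A1 1, R s A1 2, R (- s) A2 1, R (- s) A2 2] :: real^4^4)"
  have vec4: "(vector [a, b, c, d] :: 'z::zero^4) $ 1 = a" "(vector [a, b, c, d] :: 'z^4) $ 2 = b"
     "(vector [a, b, c, d] :: 'z^4) $ 3 = c" "(vector [a, b, c, d] :: 'z^4) $ 4 = d" for a b c d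
    by (simp_all add: vector_def)
  have "det M = 4 * s\<^sup>2 * (A1 $ 1 $ 1 * A1 $ 2 $ 2 - A1 $ 1 $ 2 * A1 $ 2 $ 1) * (A2 $ 1 $ 1 * A2 $ 2 $ 2 - A2 $ 1 $ 2 * A2 $ 2 $ 1)
     \<or> det M = - (4 * s\<^sup>2 * (A1 $ 1 $ 1 * A1 $ 2 $ 2 - A1 $ 1 $ 2 * A1 $ 2 $ 1) * (A2 $ 1 $ 1 * A2 $ 2 $ 2 - A2 $ 1 $ 2 * A2 $ 2 $ 1))"
    unfolding det_4 M_def R_def vec4 by (simp add: algebra_simps power2_eq_square)
  then have detM: "\<bar>det M\<bar> = 4 * s\<^sup>2" using assms by (auto simp: det_2)
  have "s \<noteq> 0" using \<sigma>1_\<theta> by (simp add: s_def)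
  have "mink_const ^ 1 \<le> mink_const ^ CARD(4)" by (rule power_increasing) (use mink_const_ge_1 in auto)
  then have "\<bar>det M\<bar> < mink_const ^ CARD(4)" using detM by (simp add: mink_const_def s_def)
  moreover have "det M \<noteq> 0" using detM \<open>s \<noteq> 0\<close> by auto
  ultimately obtain z :: "4 \<Rightarrow> int" where z: "z \<noteq> (\<lambda>_. 0)"
      "\<And>i. \<bar>(M *v (\<chi> j. of_int (z j))) $ i\<bar> \<le> mink_const"
    using minkowski_linear_forms[of M mink_const] mink_const_ge_1 by auto
  define v :: "'k^2" where "v = vector [of_int (z 1) + of_int (z 2) * \<theta>, of_int (z 3) + of_int (z 4) * \<theta>]"
  have v12: "v $ 1 = of_int (z 1) + of_int (z 2) * \<theta>" "v $ 2 = of_int (z 3) + of_int (z 4) * \<theta>"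
    by (simp_all add: v_def)
  have "v \<noteq> 0"
  proof
    assume "v = 0"
    then have "z 1 = 0 \<and> z 2 = 0" "z 3 = 0 \<and> z 4 = 0" using v12 lattice_coord_eq_0 by auto
    then have "z i = 0" for i using exhaust_4[of i] by auto
    then show False using z(1) by auto
  qed
  moreover have "\<bar>vec_act \<sigma>1 A1 v $ j\<bar> \<le> mink_const" for j
  proof -
    have "vec_act \<sigma>1 A1 v $ 1 = (M *v (\<chi> j. of_int (z j))) $ 1" "vec_act \<sigma>1 A1 v $ 2 = (M *v (\<chi> j. of_int (z j))) $ 2"
      by (simp_all add: vec_act_nth v12 \<sigma>_simps matrix_vector_mult_def sum_4 M_def R_def vec4 s_def algebra_simps)
    then show ?thesis using z(2) exhaust_2[of j] by metis
  qed
  moreover have "\<bar>vec_act \<sigma>2 A2 v $ j\<bar> \<le> mink_const" for j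
  proof -
    have "vec_act \<sigma>2 A2 v $ 1 = (M *v (\<chi> j. of_int (z j))) $ 3" "vec_act \<sigma>2 A2 v $ 2 = (M *v (\<chi> j. of_int (z j))) $ 4"
      by (simp_all add: vec_act_nth v12 \<sigma>_simps matrix_vector_mult_def sum_4 M_def R_def vec4 s_def algebra_simps)
    then show ?thesis using z(2) exhaust_2[of j] by metis
  qed
  moreover have "v $ 1 \<in> lattice" "v $ 2 \<in> lattice" unfolding v12 lattice_def by blast+
  ultimately show ?thesis using that by blast
qed


text \<open>With C = \<open>mink_const\<close> and S = C^2 (1 + 1/c) this is C + (C^2 + C^2 S C^2 /
  c^2). The first summand bounds the first short vector, the bracket the second.\<close>

definition lattice_bound :: "real \<Rightarrow> real" where
  "lattice_bound c = mink_const + (mink_const\<^sup>2 + mink_const\<^sup>2 * (mink_const\<^sup>2 * (1 + 1 / c)) * (mink_const\<^sup>2 / c\<^sup>2))"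

text \<open>
  The second vector comes from applying the same result to \<open>A\<^sub>i k\<^sub>i\<close>, where \<open>k\<^sub>i\<close> maps \<open>y\<^sub>i = v A\<^sub>i\<close> to
  \<open>(S, 0)\<close>: vectors proportional to \<open>v\<close> that are short for the new lattice would be too short
  for the old one.
\<close>

lemma two_short_lattice_vectors:
  assumes A: "det A1 = 1" "det A2 = 1" and c: "0 < c"
    and large: "\<And>v. v \<in> integral_vectors \<Longrightarrow> c \<le> sup_size (vec_act \<sigma>1 A1 v) * sup_size (vec_act \<sigma>2 A2 v)"
  obtains v w where "v $ 1 \<in> lattice" "v $ 2 \<in> lattice" "w $ 1 \<in> lattice" "w $ 2 \<in> lattice" "vec_det v w \<noteq> 0"
    "\<And>j. \<bar>vec_act \<sigma>1 A1 v $ j\<bar> \<le> lattice_bound c" "\<And>j. \<bar>vec_act \<sigma>2 A2 v $ j\<bar> \<le> lattice_bound c"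
    "\<And>j. \<bar>vec_act \<sigma>1 A1 w $ j\<bar> \<le> lattice_bound c" "\<And>j. \<bar>vec_act \<sigma>2 A2 w $ j\<bar> \<le> lattice_bound c"
proof -
  define C where "C = mink_const"
  have C1: "1 \<le> C" by (simp add: C_def mink_const_ge_1)
  \<comment> \<open>Chosen so that C^2 / S = c / (1 + c), whose square is less than c.\<close>
  define S where "S = C\<^sup>2 * (1 + 1 / c)"
  have "1 \<le> C\<^sup>2" using C1 by (rule one_le_power)
  then have "1 * 1 \<le> S" unfolding S_def using c by (intro mult_mono) auto
  then have S: "1 \<le> S" by simp
  define R where "R = C\<^sup>2 + C\<^sup>2 * S * (C\<^sup>2 / c\<^sup>2)"
  have LB: "lattice_bound c = C + R" by (simp add: lattice_bound_def R_def S_def C_def)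
  have "0 \<le> R" using C1 S unfolding R_def by simp
  obtain v where v: "v \<noteq> 0" "v $ 1 \<in> lattice" "v $ 2 \<in> lattice"
    "\<And>j. \<bar>vec_act \<sigma>1 A1 v $ j\<bar> \<le> C" "\<And>j. \<bar>vec_act \<sigma>2 A2 v $ j\<bar> \<le> C"
    using short_lattice_vector[OF A] unfolding C_def by metis
  define y1 y2 where "y1 = vec_act \<sigma>1 A1 v" and "y2 = vec_act \<sigma>2 A2 v"
  have "v \<in> integral_vectors" using v algebraic_int_latticeD by (auto simp: integral_vectors_def)
  then have cy: "c \<le> sup_size y1 * sup_size y2" using large by (simp add: y1_def y2_def)
  \<comment> \<open>The columns make z times \<open>k y\<close> equal to (S (z . y) / (y . y), det
    (y, z) / S). A bound for these coordinates therefore confines the component of z along y the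
    more, the larger S is.\<close>
  define k where "k = (\<lambda>y :: real^2. vector [vector [S * y $ 1 / (y \<bullet> y), - (y $ 2 / S)],
                                          vector [S * y $ 2 / (y \<bullet> y), y $ 1 / S]] :: real^2^2)"
  have inner2: "y \<bullet> z = y $ 1 * z $ 1 + y $ 2 * z $ 2" for y z :: "real^2"
    by (simp add: inner_vec_def sum_2)
  \<comment> \<open>Neither factor exceeds C while the product is at least c, so neither falls below
    c / C.\<close>
  have lower: "c / C \<le> sup_size y1" "c / C \<le> sup_size y2"
  proof -
    have le: "sup_size y1 \<le> C" "sup_size y2 \<le> C" using v by (auto simp: y1_def y2_def intro!: sup_size_le)
    have "sup_size y1 * sup_size y2 \<le> sup_size y1 * C" "sup_size y1 * sup_size y2 \<le> C * sup_size y2"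
      using le sup_size_nonneg by (auto intro!: mult_left_mono mult_right_mono)
    then show "c / C \<le> sup_size y1" "c / C \<le> sup_size y2"
      using cy C1 by (auto simp: divide_le_eq mult.commute)
  qed
  have n: "c\<^sup>2 / C\<^sup>2 \<le> y \<bullet> y" "0 < y \<bullet> y" if "c / C \<le> sup_size y" for y
  proof -
    have "(c / C)\<^sup>2 \<le> (sup_size y)\<^sup>2" using that c C1 by (intro power_mono) auto
    also have "\<dots> \<le> y \<bullet> y" by (auto simp: sup_size_def max_def inner2 power2_eq_square)
    finally show *: "c\<^sup>2 / C\<^sup>2 \<le> y \<bullet> y" by (simp add: power_divide)
    have "0 < c\<^sup>2 / C\<^sup>2" using c C1 by simp
    with * show "0 < y \<bullet> y" by linarith
  qed
  have detk: "det (k y) = 1" if "0 < y \<bullet> y" for y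
  proof -
    have "det (k y) = (y $ 1 * y $ 1 + y $ 2 * y $ 2) / (y \<bullet> y)"
      using S that by (simp add: det_2 k_def field_simps)
    also have "\<dots> = (y \<bullet> y) / (y \<bullet> y)" by (simp only: inner2)
    finally show ?thesis using that by simp
  qed
  have detAk: "det (A1 ** k y1) = 1" "det (A2 ** k y2) = 1"
    using A detk n lower by (simp_all add: det_mul)
  obtain w where w: "w \<noteq> 0" "w $ 1 \<in> lattice" "w $ 2 \<in> lattice"
    "\<And>j. \<bar>vec_act \<sigma>1 (A1 ** k y1) w $ j\<bar> \<le> C" "\<And>j. \<bar>vec_act \<sigma>2 (A2 ** k y2) w $ j\<bar> \<le> C"
    using short_lattice_vector[OF detAk] unfolding C_def by metis
  define z1 z2 where "z1 = vec_act \<sigma>1 A1 w" and "z2 = vec_act \<sigma>2 A2 w"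
  have bounds: "\<bar>z \<bullet> y\<bar> \<le> C * (y \<bullet> y) / S" "\<bar>vec_det y z\<bar> \<le> C * S"
    if k: "\<And>j. \<bar>vec_act (\<lambda>x. x) (k y) z $ j\<bar> \<le> C" and y: "0 < y \<bullet> y" for y z
  proof -
    have "vec_act (\<lambda>x. x) (k y) z $ 1 = S * (z \<bullet> y) / (y \<bullet> y)"
      by (simp add: vec_act_nth k_def inner2 field_simps add_divide_distrib)
    then have "\<bar>S * (z \<bullet> y) / (y \<bullet> y)\<bar> \<le> C" using k by metis
    then show "\<bar>z \<bullet> y\<bar> \<le> C * (y \<bullet> y) / S" using S y by (simp add: abs_mult field_simps)
    have "vec_act (\<lambda>x. x) (k y) z $ 2 = vec_det y z / S"
      by (simp add: vec_act_nth k_def vec_det_def diff_divide_distrib mult.commute)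
    then have "\<bar>vec_det y z / S\<bar> \<le> C" using k by metis
    then show "\<bar>vec_det y z\<bar> \<le> C * S" using S by (simp add: field_simps)
  qed
  have w1: "\<bar>z1 \<bullet> y1\<bar> \<le> C * (y1 \<bullet> y1) / S" "\<bar>vec_det y1 z1\<bar> \<le> C * S"
    using bounds[of y1 z1] w(4) n lower unfolding z1_def vec_act_matrix_mult by blast+
  have w2: "\<bar>z2 \<bullet> y2\<bar> \<le> C * (y2 \<bullet> y2) / S" "\<bar>vec_det y2 z2\<bar> \<le> C * S"
    using bounds[of y2 z2] w(5) n lower unfolding z2_def vec_act_matrix_mult by blast+
  \<comment> \<open>Orthogonal decomposition: (y . y) z is (z . y) y plus det (y, z) times y turned
    by a right angle.\<close>
  have split: "\<bar>z $ j\<bar> \<le> C\<^sup>2 / S + C * d / (y \<bullet> y)"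
    if y: "0 < y \<bullet> y" and yC: "\<And>j. \<bar>y $ j\<bar> \<le> C" and zy: "\<bar>z \<bullet> y\<bar> \<le> C * (y \<bullet> y) / S" and d: "\<bar>vec_det y z\<bar> \<le> d"
    for y z d j
  proof -
    have "(y \<bullet> y) * \<bar>z $ j\<bar> \<le> \<bar>z \<bullet> y\<bar> * C + \<bar>vec_det y z\<bar> * C"
    proof -
      have "(y \<bullet> y) * z $ 1 = (z \<bullet> y) * y $ 1 - vec_det y z * y $ 2" "(y \<bullet> y) * z $ 2 = (z \<bullet> y) * y $ 2 + vec_det y z * y $ 1"
        by (simp_all add: inner2 vec_det_def algebra_simps)
      then have "\<bar>(y \<bullet> y) * z $ 1\<bar> \<le> \<bar>z \<bullet> y\<bar> * \<bar>y $ 1\<bar> + \<bar>vec_det y z\<bar> * \<bar>y $ 2\<bar>"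
        "\<bar>(y \<bullet> y) * z $ 2\<bar> \<le> \<bar>z \<bullet> y\<bar> * \<bar>y $ 2\<bar> + \<bar>vec_det y z\<bar> * \<bar>y $ 1\<bar>"
        unfolding abs_mult[symmetric] by simp_all
      moreover have "\<bar>z \<bullet> y\<bar> * \<bar>y $ i\<bar> \<le> \<bar>z \<bullet> y\<bar> * C" "\<bar>vec_det y z\<bar> * \<bar>y $ i\<bar> \<le> \<bar>vec_det y z\<bar> * C" for i
        using yC by (auto intro!: mult_left_mono)
      ultimately have "\<bar>(y \<bullet> y) * z $ 1\<bar> \<le> \<bar>z \<bullet> y\<bar> * C + \<bar>vec_det y z\<bar> * C"
        "\<bar>(y \<bullet> y) * z $ 2\<bar> \<le> \<bar>z \<bullet> y\<bar> * C + \<bar>vec_det y z\<bar> * C" by (meson add_mono order_trans)+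
      then show ?thesis using y exhaust_2[of j] by (auto simp: abs_mult)
    qed
    also have "\<dots> \<le> (C * (y \<bullet> y) / S) * C + d * C"
      using zy d C1 by (intro add_mono mult_right_mono) auto
    also have "\<dots> = (y \<bullet> y) * (C\<^sup>2 / S + C * d / (y \<bullet> y))"
      using y S by (simp add: field_simps power2_eq_square)
    finally show ?thesis using y by simp
  qed
  have zR: "\<bar>z $ j\<bar> \<le> R"
    if yc: "c / C \<le> sup_size y" and yC: "\<And>j. \<bar>y $ j\<bar> \<le> C" and zy: "\<bar>z \<bullet> y\<bar> \<le> C * (y \<bullet> y) / S" "\<bar>vec_det y z\<bar> \<le> C * S" for y z j
  proof -
    have "C * (C * S) / (y \<bullet> y) \<le> C * (C * S) / (c\<^sup>2 / C\<^sup>2)"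
      using n[OF yc] c C1 S by (intro divide_left_mono) (auto intro!: mult_nonneg_nonneg mult_pos_pos)
    moreover have "C\<^sup>2 / S \<le> C\<^sup>2" using S C1 by (simp add: field_simps)
    moreover have "C * (C * S) / (c\<^sup>2 / C\<^sup>2) = C\<^sup>2 * S * (C\<^sup>2 / c\<^sup>2)"
      by (simp add: power2_eq_square)
    ultimately show ?thesis using split[OF n(2)[OF yc] yC zy, of j] unfolding R_def by linarith
  qed
  have "vec_det v w \<noteq> 0"
  proof
    assume "vec_det v w = 0"
    then have "vec_det y1 z1 = 0" "vec_det y2 z2 = 0"
      using embedding1 embedding2 by (simp_all add: y1_def y2_def z1_def z2_def vec_det_act \<sigma>_simps)
    \<comment> \<open>For proportional vectors only the components along y1 and y2 remain, and these
      are too short for \<open>large\<close>.\<close>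
    then have "\<bar>z1 $ j\<bar> \<le> C\<^sup>2 / S" "\<bar>z2 $ j\<bar> \<le> C\<^sup>2 / S" for j
      using split[of y1 z1 0 j] split[of y2 z2 0 j] w1 w2 n lower v by (auto simp: y1_def y2_def)
    then have "sup_size z1 * sup_size z2 \<le> (C\<^sup>2 / S) * (C\<^sup>2 / S)"
      using S by (intro mult_mono sup_size_le sup_size_nonneg) auto
    also have "\<dots> < c"
    proof -
      have "C\<^sup>2 / S = 1 / (1 + 1 / c)" using C1 by (simp add: S_def)
      also have "\<dots> = c / (1 + c)" using c by (simp add: field_simps)
      finally have eq: "C\<^sup>2 / S = c / (1 + c)" .
      have "c / (1 + c) * (c / (1 + c)) < c / (1 + c) * 1"
        using c by (intro mult_strict_left_mono) auto
      also have "\<dots> \<le> c" using c by (simp add: field_simps)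
      finally show ?thesis unfolding eq .
    qed
    finally have "sup_size z1 * sup_size z2 < c" .
    moreover have "w \<in> integral_vectors" using w algebraic_int_latticeD by (auto simp: integral_vectors_def)
    ultimately show False using large[of w] by (simp add: z1_def z2_def)
  qed
  moreover have "\<bar>vec_act \<sigma>1 A1 v $ j\<bar> \<le> lattice_bound c" "\<bar>vec_act \<sigma>2 A2 v $ j\<bar> \<le> lattice_bound c" for j
    using v(4)[of j] v(5)[of j] \<open>0 \<le> R\<close> unfolding LB by linarith+
  moreover have "\<bar>vec_act \<sigma>1 A1 w $ j\<bar> \<le> lattice_bound c" "\<bar>vec_act \<sigma>2 A2 w $ j\<bar> \<le> lattice_bound c" for j
  proof -
    have "\<bar>z1 $ j\<bar> \<le> R" by (rule zR[OF lower(1) _ w1]) (use v in \<open>simp add: y1_def\<close>)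
    moreover have "\<bar>z2 $ j\<bar> \<le> R" by (rule zR[OF lower(2) _ w2]) (use v in \<open>simp add: y2_def\<close>)
    ultimately show "\<bar>vec_act \<sigma>1 A1 w $ j\<bar> \<le> lattice_bound c" "\<bar>vec_act \<sigma>2 A2 w $ j\<bar> \<le> lattice_bound c"
      using C1 unfolding LB z1_def z2_def by linarith+
  qed
  ultimately show ?thesis using that v w by blast
qed

section \<open>The order Z[\<theta>] and matrices modulo an integer\<close>

lemma lattice_add: "x \<in> lattice \<Longrightarrow> y \<in> lattice \<Longrightarrow> x + y \<in> lattice"
  unfolding lattice_def
proof clarify
  fix a b c d :: int
  have "of_int a + of_int b * \<theta> + (of_int c + of_int d * \<theta>) = of_int (a + c) + of_int (b + d) * \<theta>"
    by (simp add: algebra_simps)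
  then show "\<exists>e f. of_int a + of_int b * \<theta> + (of_int c + of_int d * \<theta>) = of_int e + of_int f * \<theta> \<and> True" by blast
qed

lemma lattice_mult: "x \<in> lattice \<Longrightarrow> y \<in> lattice \<Longrightarrow> x * y \<in> lattice"
  unfolding lattice_def
proof clarify
  fix a b c d :: int
  have "(of_int a + of_int b * \<theta>) * (of_int c + of_int d * \<theta>) =
      of_int (a * c) + of_int (a * d + b * c) * \<theta> + of_int (b * d) * (\<theta> * \<theta>)"
    by (simp add: algebra_simps)
  also have "\<dots> = of_int (a * c + b * d * D) + of_int (a * d + b * c) * \<theta>"
    unfolding \<theta>_square by simp
  finally show "\<exists>e f. (of_int a + of_int b * \<theta>) * (of_int c + of_int d * \<theta>) = of_int e + of_int f * \<theta> \<and> True" by blast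
qed

lemma lattice_minus: "x \<in> lattice \<Longrightarrow> - x \<in> lattice"
  unfolding lattice_def
proof clarify
  fix a b :: int
  have "- (of_int a + of_int b * \<theta>) = of_int (- a) + of_int (- b) * \<theta>" by simp
  then show "\<exists>e f. - (of_int a + of_int b * \<theta>) = of_int e + of_int f * \<theta> \<and> True" by blast
qed

lemma lattice_of_int: "of_int n \<in> lattice"
  unfolding lattice_def by (intro CollectI exI[of _ n] exI[of _ 0]) simp

text \<open>d' is the conjugate of d. Thus d divides the rational integer N inside Z[\<theta>], and
  congruences modulo N can replace congruences modulo d.\<close>

lemma lattice_norm:
  assumes "d \<in> lattice"
  obtains d' N where "d' \<in> lattice" "d * d' = of_int N" "\<sigma>1 d * \<sigma>2 d = of_int N"
proof -
  obtain a b where d: "d = of_int a + of_int b * \<theta>" using assms by (auto simp: lattice_def)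
  define d' where "d' = of_int a + of_int (- b) * \<theta>"
  have "d' \<in> lattice" unfolding lattice_def d'_def by blast
  moreover have "d * d' = of_int (a * a) - of_int (b * b) * (\<theta> * \<theta>)"
    by (simp add: d d'_def algebra_simps)
  then have "d * d' = of_int (a * a - b * b * D)" by (simp add: \<theta>_square)
  moreover have "\<sigma>1 d * \<sigma>2 d = of_int (a * a) - of_int (b * b) * (\<sigma>1 \<theta> * \<sigma>1 \<theta>)"
    by (simp add: d \<sigma>_simps algebra_simps)
  then have "\<sigma>1 d * \<sigma>2 d = of_int (a * a - b * b * D)" by (simp add: \<sigma>1_\<theta>_square)
  ultimately show ?thesis using that by blast
qed

lemma finite_lattice_bounded: "finite {d \<in> lattice. \<bar>\<sigma>1 d\<bar> \<le> B \<and> \<bar>\<sigma>2 d\<bar> \<le> B}"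
proof -
  define K where "K = \<lceil>B + B / \<bar>\<sigma>1 \<theta>\<bar>\<rceil>"
  have "{d \<in> lattice. \<bar>\<sigma>1 d\<bar> \<le> B \<and> \<bar>\<sigma>2 d\<bar> \<le> B} \<subseteq> (\<lambda>(a, b). of_int a + of_int b * \<theta>) ` ({-K..K} \<times> {-K..K})"
  proof
    fix d assume d: "d \<in> {d \<in> lattice. \<bar>\<sigma>1 d\<bar> \<le> B \<and> \<bar>\<sigma>2 d\<bar> \<le> B}"
    then obtain a b where ab: "d = of_int a + of_int b * \<theta>" by (auto simp: lattice_def)
    have \<sigma>: "\<bar>of_int a + of_int b * \<sigma>1 \<theta>\<bar> \<le> B" "\<bar>of_int a - of_int b * \<sigma>1 \<theta>\<bar> \<le> B"
      using d by (auto simp: ab \<sigma>_simps)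
    then have B: "0 \<le> B" and a: "\<bar>real_of_int a\<bar> \<le> B" and "\<bar>of_int b * \<sigma>1 \<theta>\<bar> \<le> B" by linarith+
    then have b: "\<bar>real_of_int b\<bar> \<le> B / \<bar>\<sigma>1 \<theta>\<bar>" using \<sigma>1_\<theta> by (simp add: abs_mult pos_le_divide_eq)
    have "0 \<le> B / \<bar>\<sigma>1 \<theta>\<bar>" using B by simp
    then have "\<bar>real_of_int a\<bar> \<le> of_int K" "\<bar>real_of_int b\<bar> \<le> of_int K"
      using a b B unfolding K_def by linarith+
    then have "a \<in> {-K..K}" "b \<in> {-K..K}" by auto
    then show "d \<in> (\<lambda>(a, b). of_int a + of_int b * \<theta>) ` ({-K..K} \<times> {-K..K})"
      unfolding ab by force
  qed
  then show ?thesis by (rule finite_subset) simp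
qed

definition lattice_matrices :: "('k^2^2) set" where
  "lattice_matrices = {M. \<forall>i j. M $ i $ j \<in> lattice}"

definition integral_SL2 :: "('k^2^2) set" where
  "integral_SL2 = {G. (\<forall>i j. algebraic_int (G $ i $ j)) \<and> det G = 1}"

lemma lattice_diff: "x \<in> lattice \<Longrightarrow> y \<in> lattice \<Longrightarrow> x - y \<in> lattice"
  using lattice_add[of x "- y"] lattice_minus[of y] by simp

lemma det_lattice_matrix: "M \<in> lattice_matrices \<Longrightarrow> det M \<in> lattice"
  unfolding det_2 lattice_matrices_def by (intro lattice_diff lattice_mult) auto

text \<open>
  With \<open>d d' = N\<close> and \<open>M' = M + N X\<close>, the quotient \<open>M\<^sup>-\<^sup>1 M' = 1 + d' adj(M) X\<close> is integral.
\<close>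

lemma congruent_matrices_associated:
  assumes M: "M \<in> lattice_matrices" and det: "det M' = det M" "det M \<noteq> 0"
    and d': "d' \<in> lattice" "det M * d' = of_int N"
    and cong: "\<And>i j. \<exists>x\<in>lattice. M' $ i $ j = M $ i $ j + of_int N * x"
  shows "\<exists>G\<in>integral_SL2. M' = M ** G"
proof -
  obtain X where X: "\<And>i j. X i j \<in> lattice" "\<And>i j. M' $ i $ j = M $ i $ j + of_int N * X i j"
    using cong by metis
  define G :: "'k^2^2" where "G = vector
     [vector [1 + d' * (M $ 2 $ 2 * X 1 1 + - (M $ 1 $ 2) * X 2 1), d' * (M $ 2 $ 2 * X 1 2 + - (M $ 1 $ 2) * X 2 2)],
      vector [d' * (- (M $ 2 $ 1) * X 1 1 + M $ 1 $ 1 * X 2 1), 1 + d' * (- (M $ 2 $ 1) * X 1 2 + M $ 1 $ 1 * X 2 2)]]"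
  have one: "1 \<in> lattice" using lattice_of_int[of 1] by simp
  have "G $ i $ j \<in> lattice" for i j
    using M d' X one exhaust_2[of i] exhaust_2[of j] unfolding G_def lattice_matrices_def
    by (auto intro!: lattice_add lattice_mult lattice_diff)
  then have "algebraic_int (G $ i $ j)" for i j by (rule algebraic_int_latticeD)
  moreover have eq: "M' = M ** G"
  proof -
    have N: "of_int N = (M $ 1 $ 1 * M $ 2 $ 2 - M $ 1 $ 2 * M $ 2 $ 1) * d'"
      using d'(2) by (simp add: det_2)
    show ?thesis
      by (simp add: vec_eq_iff forall_2 X(2) N matrix_matrix_mult_def sum_2 G_def algebra_simps)
  qed
  moreover have "det G = 1" using det eq by (simp add: det_mul)
  ultimately show ?thesis unfolding integral_SL2_def by blast
qed

text \<open>The determinant takes finitely many values because both of its embeddings are bounded.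
  For each value the entries have finitely many residues modulo its norm, and matrices that agree in
  these data differ by an element of \<open>integral_SL2\<close>. One matrix is kept for each
  combination.\<close>

lemma finite_matrix_representatives:
  "\<exists>R. finite R \<and> (\<forall>M\<in>R. det M \<noteq> 0) \<and>
     (\<forall>M\<in>lattice_matrices. det M \<noteq> 0 \<and> \<bar>\<sigma>1 (det M)\<bar> \<le> B \<and> \<bar>\<sigma>2 (det M)\<bar> \<le> B \<longrightarrow>
        (\<exists>M0\<in>R. \<exists>G\<in>integral_SL2. M = M0 ** G))"
proof -
  define T where "T = {M \<in> lattice_matrices. det M \<noteq> 0 \<and> \<bar>\<sigma>1 (det M)\<bar> \<le> B \<and> \<bar>\<sigma>2 (det M)\<bar> \<le> B}"
  define F where "F = {d \<in> lattice. \<bar>\<sigma>1 d\<bar> \<le> B \<and> \<bar>\<sigma>2 d\<bar> \<le> B}"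
  obtain a b where ab: "\<And>x. x \<in> lattice \<Longrightarrow> x = of_int (a x) + of_int (b x) * \<theta>"
  proof -
    have "\<forall>x. \<exists>a b. x \<in> lattice \<longrightarrow> x = of_int a + of_int b * \<theta>" unfolding lattice_def by blast
    then show ?thesis using that by metis
  qed
  define N where "N = (\<lambda>d. \<lfloor>\<sigma>1 d * \<sigma>2 d\<rfloor>)"
  define key where "key = (\<lambda>M :: 'k^2^2. (det M, \<lambda>i j. (a (M $ i $ j) mod N (det M), b (M $ i $ j) mod N (det M))))"
  define K where "K = \<lceil>B * B\<rceil>"
  have "key ` T \<subseteq> F \<times> (PiE UNIV (\<lambda>_. PiE UNIV (\<lambda>_. {-K..K} \<times> {-K..K})))"
  proof (rule image_subsetI)
    fix M assume M: "M \<in> T"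
    then have "det M \<in> F" by (simp add: T_def F_def det_lattice_matrix)
    \<comment> \<open>\<open>mod\<close> takes the sign of the modulus, and the norm may be
      negative, so the range of residues is symmetric.\<close>
    moreover have "x mod N (det M) \<in> {-K..K}" for x
    proof -
      obtain n where n: "\<sigma>1 (det M) * \<sigma>2 (det M) = of_int n"
        using lattice_norm[of "det M"] M by (metis (lifting) T_def det_lattice_matrix mem_Collect_eq)
      then have Nn: "N (det M) = n" by (simp add: N_def)
      have "n \<noteq> 0" using n M by (auto simp: T_def \<sigma>_simps)
      have "\<bar>\<sigma>1 (det M) * \<sigma>2 (det M)\<bar> \<le> B * B"
        using M unfolding abs_mult by (intro mult_mono) (auto simp: T_def)
      then have "\<bar>real_of_int n\<bar> \<le> of_int K" unfolding n K_def by linarith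
      then have "\<bar>n\<bar> \<le> K" by linarith
      moreover have "\<bar>x mod n\<bar> < \<bar>n\<bar>" using \<open>n \<noteq> 0\<close> by (rule abs_mod_less)
      ultimately show ?thesis unfolding Nn by auto
    qed
    ultimately show "key M \<in> F \<times> (PiE UNIV (\<lambda>_. PiE UNIV (\<lambda>_. {-K..K} \<times> {-K..K})))"
      by (auto simp: key_def simp del: atLeastAtMost_iff)
  qed
  moreover have "finite (F \<times> (PiE (UNIV :: 2 set) (\<lambda>_. PiE (UNIV :: 2 set) (\<lambda>_. {-K..K} \<times> {-K..K}))))"
    unfolding F_def by (intro finite_cartesian_product finite_lattice_bounded finite_PiE) auto
  ultimately have fin: "finite (key ` T)" by (rule finite_subset)
  define rep where "rep = (\<lambda>k. SOME M. M \<in> T \<and> key M = k)"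
  have rep: "rep (key M) \<in> T \<and> key (rep (key M)) = key M" if "M \<in> T" for M
    unfolding rep_def by (rule someI[of _ M]) (use that in auto)
  have "\<exists>G\<in>integral_SL2. M = rep (key M) ** G" if M: "M \<in> T" for M
  proof -
    define M0 where "M0 = rep (key M)"
    have M0: "M0 \<in> T" "key M0 = key M" using rep[OF M] by (auto simp: M0_def)
    have dets: "det M = det M0" using M0(2) by (simp add: key_def)
    have lat: "M \<in> lattice_matrices" "M0 \<in> lattice_matrices" "det M0 \<noteq> 0" using M M0 by (auto simp: T_def)
    obtain d' n where n: "d' \<in> lattice" "det M0 * d' = of_int n" "\<sigma>1 (det M0) * \<sigma>2 (det M0) = of_int n"
      using lattice_norm[OF det_lattice_matrix[OF lat(2)]] by blast
    have Nn: "N (det M0) = n" using n(3) by (simp add: N_def)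
    have "\<exists>x\<in>lattice. M $ i $ j = M0 $ i $ j + of_int n * x" for i j
    proof -
      have "(a (M $ i $ j) mod n, b (M $ i $ j) mod n) = (a (M0 $ i $ j) mod n, b (M0 $ i $ j) mod n)"
        using arg_cong[OF M0(2), of "\<lambda>k. snd k i j"] by (simp add: key_def dets Nn)
      then obtain k l where kl: "a (M $ i $ j) = a (M0 $ i $ j) + n * k" "b (M $ i $ j) = b (M0 $ i $ j) + n * l"
        by (metis Pair_inject mod_eqE)
      have "M $ i $ j = of_int (a (M $ i $ j)) + of_int (b (M $ i $ j)) * \<theta>"
        using ab lat by (auto simp: lattice_matrices_def)
      also have "\<dots> = (of_int (a (M0 $ i $ j)) + of_int (b (M0 $ i $ j)) * \<theta>) + of_int n * (of_int k + of_int l * \<theta>)"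
        unfolding kl by (simp add: algebra_simps)
      also have "of_int (a (M0 $ i $ j)) + of_int (b (M0 $ i $ j)) * \<theta> = M0 $ i $ j"
        using ab lat by (auto simp: lattice_matrices_def)
      finally show ?thesis unfolding lattice_def by blast
    qed
    then show ?thesis
      unfolding M0_def[symmetric] using congruent_matrices_associated[OF lat(2) dets lat(3) n(1,2)] by blast
  qed
  then show ?thesis
    using fin rep by (intro exI[of _ "rep ` key ` T"]) (auto simp: T_def)
qed

text \<open>The two short independent vectors are the rows of a matrix M for which M A and det M are
  bounded. Writing M = M0 G with M0 from a finite list, G A = M0^-1 (M A) is bounded by a constant
  that depends on c alone.\<close>

lemma bounded_by_SL2_OK:
  assumes "0 < c"
  obtains R where "\<And>A1 A2. \<lbrakk>det A1 = 1; det A2 = 1;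
      \<And>v. v \<in> integral_vectors \<Longrightarrow> c \<le> sup_size (vec_act \<sigma>1 A1 v) * sup_size (vec_act \<sigma>2 A2 v)\<rbrakk>
    \<Longrightarrow> \<exists>G\<in>integral_SL2. \<forall>i j. \<bar>(map_matrix \<sigma>1 G ** A1) $ i $ j\<bar> \<le> R \<and> \<bar>(map_matrix \<sigma>2 G ** A2) $ i $ j\<bar> \<le> R"
proof -
  define L where "L = lattice_bound c"
  obtain F where F: "finite F" "\<And>M. M \<in> F \<Longrightarrow> det M \<noteq> 0"
    "\<And>M. \<lbrakk>M \<in> lattice_matrices; det M \<noteq> 0; \<bar>\<sigma>1 (det M)\<bar> \<le> 2 * (L * L); \<bar>\<sigma>2 (det M)\<bar> \<le> 2 * (L * L)\<rbrakk>
      \<Longrightarrow> \<exists>M0\<in>F. \<exists>G\<in>integral_SL2. M = M0 ** G"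
    using finite_matrix_representatives[of "2 * (L * L)"] by metis
  \<comment> \<open>The bound for M0^-1 (M A) from Cramer's rule, when the entries of M A are at
    most \<open>L\<close>.\<close>
  define f where "f = (\<lambda>\<sigma> (M :: 'k^2^2). 2 * L * (\<bar>\<sigma> (M $ 1 $ 1)\<bar> + \<bar>\<sigma> (M $ 1 $ 2)\<bar> + \<bar>\<sigma> (M $ 2 $ 1)\<bar> + \<bar>\<sigma> (M $ 2 $ 2)\<bar>) / \<bar>\<sigma> (det M)\<bar>)"
  define R where "R = Max (insert 0 ((\<lambda>M. max (f \<sigma>1 M) (f \<sigma>2 M)) ` F))"
  have R: "f \<sigma>1 M \<le> R" "f \<sigma>2 M \<le> R" if "M \<in> F" for M
  proof -
    have "max (f \<sigma>1 M) (f \<sigma>2 M) \<le> R" unfolding R_def using F(1) that by (intro Max_ge) auto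
    then show "f \<sigma>1 M \<le> R" "f \<sigma>2 M \<le> R" by auto
  qed
  have key: "\<bar>(map_matrix \<sigma> G ** A) $ i $ j\<bar> \<le> f \<sigma> M0"
    if \<sigma>: "\<sigma> \<in> real_embeddings" and M0: "det M0 \<noteq> 0" and L: "\<And>i j. \<bar>(map_matrix \<sigma> (M0 ** G) ** A) $ i $ j\<bar> \<le> L"
    for \<sigma> and M0 G :: "'k^2^2" and A :: "real^2^2" and i j
  proof -
    define B where "B = map_matrix \<sigma> G ** A"
    define Y where "Y = map_matrix \<sigma> (M0 ** G) ** A"
    have Y: "Y = map_matrix \<sigma> M0 ** B"
      by (simp add: Y_def B_def vec_eq_iff forall_2 matrix_matrix_mult_def sum_2 map_matrix_def embedding_simps[OF \<sigma>] algebra_simps)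
    have d: "\<sigma> (det M0) = \<sigma> (M0 $ 1 $ 1) * \<sigma> (M0 $ 2 $ 2) - \<sigma> (M0 $ 1 $ 2) * \<sigma> (M0 $ 2 $ 1)"
      by (simp add: det_2 embedding_simps[OF \<sigma>])
    have "\<sigma> (det M0) * B $ 1 $ j = \<sigma> (M0 $ 2 $ 2) * Y $ 1 $ j - \<sigma> (M0 $ 1 $ 2) * Y $ 2 $ j"
      "\<sigma> (det M0) * B $ 2 $ j = \<sigma> (M0 $ 1 $ 1) * Y $ 2 $ j - \<sigma> (M0 $ 2 $ 1) * Y $ 1 $ j"
      unfolding d Y by (simp_all add: matrix_matrix_mult_def sum_2 map_matrix_def algebra_simps)
    moreover have bnd: "\<bar>\<sigma> x * Y $ i $ j - \<sigma> y * Y $ k $ j\<bar> \<le> L * (\<bar>\<sigma> x\<bar> + \<bar>\<sigma> y\<bar>)" for x y i k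
    proof -
      have "\<bar>\<sigma> x * Y $ i $ j\<bar> \<le> \<bar>\<sigma> x\<bar> * L" "\<bar>\<sigma> y * Y $ k $ j\<bar> \<le> \<bar>\<sigma> y\<bar> * L"
        unfolding abs_mult using L unfolding Y_def by (auto intro!: mult_left_mono)
      then show ?thesis by (simp add: algebra_simps)
    qed
    ultimately have "\<bar>\<sigma> (det M0) * B $ 1 $ j\<bar> \<le> L * (\<bar>\<sigma> (M0 $ 2 $ 2)\<bar> + \<bar>\<sigma> (M0 $ 1 $ 2)\<bar>)"
      "\<bar>\<sigma> (det M0) * B $ 2 $ j\<bar> \<le> L * (\<bar>\<sigma> (M0 $ 1 $ 1)\<bar> + \<bar>\<sigma> (M0 $ 2 $ 1)\<bar>)"
      by (simp_all only: bnd)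
    moreover define t where "t = \<bar>\<sigma> (M0 $ 1 $ 1)\<bar> + \<bar>\<sigma> (M0 $ 1 $ 2)\<bar> + \<bar>\<sigma> (M0 $ 2 $ 1)\<bar> + \<bar>\<sigma> (M0 $ 2 $ 2)\<bar>"
    have "0 \<le> L" using L[of 1 1] by linarith
    then have "L * (\<bar>\<sigma> (M0 $ 2 $ 2)\<bar> + \<bar>\<sigma> (M0 $ 1 $ 2)\<bar>) \<le> L * (2 * t)"
      "L * (\<bar>\<sigma> (M0 $ 1 $ 1)\<bar> + \<bar>\<sigma> (M0 $ 2 $ 1)\<bar>) \<le> L * (2 * t)"
      unfolding t_def by (auto intro!: mult_left_mono)
    ultimately have "\<bar>\<sigma> (det M0) * B $ 1 $ j\<bar> \<le> L * (2 * t)" "\<bar>\<sigma> (det M0) * B $ 2 $ j\<bar> \<le> L * (2 * t)"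
      by linarith+
    then have "\<bar>\<sigma> (det M0) * B $ i $ j\<bar> \<le> 2 * L * t"
      using exhaust_2[of i] by auto
    moreover have "0 < \<bar>\<sigma> (det M0)\<bar>" using M0 embedding_eq_0_iff[OF \<sigma>] by simp
    ultimately show ?thesis unfolding f_def B_def[symmetric] t_def[symmetric]
      by (simp add: abs_mult pos_le_divide_eq mult.commute)
  qed
  show ?thesis
  proof (rule that[of R])
    fix A1 A2 assume A: "det A1 = 1" "det A2 = 1"
      and large: "\<And>v. v \<in> integral_vectors \<Longrightarrow> c \<le> sup_size (vec_act \<sigma>1 A1 v) * sup_size (vec_act \<sigma>2 A2 v)"
    obtain v w where vw: "v $ 1 \<in> lattice" "v $ 2 \<in> lattice" "w $ 1 \<in> lattice" "w $ 2 \<in> lattice" "vec_det v w \<noteq> 0"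
      "\<And>j. \<bar>vec_act \<sigma>1 A1 v $ j\<bar> \<le> L" "\<And>j. \<bar>vec_act \<sigma>2 A2 v $ j\<bar> \<le> L"
      "\<And>j. \<bar>vec_act \<sigma>1 A1 w $ j\<bar> \<le> L" "\<And>j. \<bar>vec_act \<sigma>2 A2 w $ j\<bar> \<le> L"
      using two_short_lattice_vectors[OF A assms large] unfolding L_def by metis
    define M :: "'k^2^2" where "M = vector [v, w]"
    have rows: "M $ 1 = v" "M $ 2 = w" by (simp_all add: M_def)
    have "M \<in> lattice_matrices" using vw by (auto simp: lattice_matrices_def forall_2 rows)
    moreover have detM: "det M = vec_det v w" by (simp add: det_2 rows vec_det_def)
    moreover have "\<bar>\<sigma>1 (vec_det v w)\<bar> \<le> 2 * (L * L)"
      using abs_vec_det_le[OF vw(6,8)] A by (simp add: vec_det_act[OF embedding1])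
    moreover have "\<bar>\<sigma>2 (vec_det v w)\<bar> \<le> 2 * (L * L)"
      using abs_vec_det_le[OF vw(7,9)] A by (simp add: vec_det_act[OF embedding2])
    ultimately obtain M0 G where M0: "M0 \<in> F" "G \<in> integral_SL2" "M = M0 ** G"
      using F(3)[of M] vw(5) by auto
    have "(map_matrix \<sigma> M ** A) $ i $ j = vec_act \<sigma> A (M $ i) $ j" for \<sigma> :: "'k \<Rightarrow> real" and A i j
      by (simp add: vec_act_nth matrix_matrix_mult_def sum_2 map_matrix_def)
    then have L: "\<bar>(map_matrix \<sigma>1 (M0 ** G) ** A1) $ i $ j\<bar> \<le> L" "\<bar>(map_matrix \<sigma>2 (M0 ** G) ** A2) $ i $ j\<bar> \<le> L" for i j
      using vw(6-9) exhaust_2[of i] rows unfolding M0(3)[symmetric] by auto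
    have "\<bar>(map_matrix \<sigma>1 G ** A1) $ i $ j\<bar> \<le> R \<and> \<bar>(map_matrix \<sigma>2 G ** A2) $ i $ j\<bar> \<le> R" for i j
      using key[OF embedding1 F(2)[OF M0(1)] L(1), of i j] key[OF embedding2 F(2)[OF M0(1)] L(2), of i j]
        R[OF M0(1)] by linarith
    then show "\<exists>G\<in>integral_SL2. \<forall>i j. \<bar>(map_matrix \<sigma>1 G ** A1) $ i $ j\<bar> \<le> R \<and> \<bar>(map_matrix \<sigma>2 G ** A2) $ i $ j\<bar> \<le> R"
      using M0(2) by blast
  qed
qed

end

section \<open>Compactness in the quotient\<close>

lemma carrier_SL2_KS: "carrier SL2_KS = real_embeddings \<rightarrow>\<^sub>E {A. det A = 1}"
  by (simp add: SL2_KS_def SL2_real_def)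

lemma mult_SL2_KS: "g \<otimes>\<^bsub>SL2_KS\<^esub> h = (\<lambda>\<sigma>\<in>real_embeddings. g \<sigma> ** h \<sigma>)"
  by (simp add: SL2_KS_def SL2_real_def)

lemma one_SL2_KS: "\<one>\<^bsub>SL2_KS\<^esub> = (\<lambda>\<sigma>\<in>real_embeddings. mat 1)"
  by (simp add: SL2_KS_def SL2_real_def)

lemma map_matrix_mult:
  fixes G H :: "'k::field_char_0^2^2"
  assumes "\<sigma> \<in> real_embeddings"
  shows "map_matrix \<sigma> (G ** H) = map_matrix \<sigma> G ** map_matrix \<sigma> H"
  by (simp add: vec_eq_iff matrix_matrix_mult_def sum_2 map_matrix_def embedding_simps[OF assms])

lemma det_map_matrix:
  fixes G :: "'k::field_char_0^2^2"
  assumes "\<sigma> \<in> real_embeddings"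
  shows "det (map_matrix \<sigma> G) = \<sigma> (det G)"
  by (simp add: det_2 map_matrix_def embedding_simps[OF assms])

lemma map_matrix_mat_1:
  assumes "\<sigma> \<in> real_embeddings"
  shows "map_matrix \<sigma> (mat 1 :: 'k::field_char_0^2^2) = mat 1"
  by (simp add: vec_eq_iff map_matrix_def mat_def embedding_simps[OF assms])

lemma closedin_SL2_KS_continuous_ge:
  assumes "continuous_map SL2_KS_topology euclideanreal f"
  shows "closedin SL2_KS_topology {h \<in> carrier SL2_KS. c \<le> f h}"
proof -
  have "closedin SL2_KS_topology {h \<in> topspace SL2_KS_topology. f h \<in> {c..}}"
    by (rule closedin_continuous_map_preimage[OF assms]) simp
  then show ?thesis by (simp add: topspace_SL2_KS)
qed

lemma continuous_map_SL2_KS_entry: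
  assumes "\<sigma> \<in> real_embeddings"
  shows "continuous_map SL2_KS_topology euclideanreal (\<lambda>h. h \<sigma> $ i $ j)"
proof -
  have "continuous_map SL2_KS_topology (top_of_set (carrier SL2_real)) (\<lambda>h. h \<sigma>)"
    unfolding SL2_KS_topology_def by (rule continuous_map_product_projection[OF assms])
  then have "continuous_map SL2_KS_topology euclidean (\<lambda>h. h \<sigma>)"
    by (rule continuous_map_into_fulltopology)
  moreover have "continuous_map euclidean euclideanreal (\<lambda>A :: real^2^2. A $ i $ j)"
    by (auto intro!: continuous_intros)
  ultimately show ?thesis
    using continuous_map_compose[of SL2_KS_topology euclidean "\<lambda>h. h \<sigma>" euclideanreal "\<lambda>A :: real^2^2. A $ i $ j"]
    by (simp add: o_def)
qed

lemma compactin_SL2_KS_bounded: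
  fixes R :: real
  assumes "finite (real_embeddings :: ('k::field_char_0 \<Rightarrow> real) set)"
  shows "compactin SL2_KS_topology
     {h \<in> carrier SL2_KS. \<forall>\<sigma>\<in>(real_embeddings :: ('k \<Rightarrow> real) set). \<forall>i j. \<bar>h \<sigma> $ i $ j\<bar> \<le> R}"
proof -
  define K where "K = {A :: real^2^2. det A = 1 \<and> (\<forall>i j. \<bar>A $ i $ j\<bar> \<le> R)}"
  have "compact K"
  proof (rule compact_eq_bounded_closed[THEN iffD2], intro conjI)
    have "norm A \<le> (\<Sum>i\<in>(UNIV :: 2 set). \<Sum>j\<in>(UNIV :: 2 set). R)" if "A \<in> K" for A :: "real^2^2"
    proof -
      have "norm A \<le> (\<Sum>i\<in>UNIV. norm (A $ i))" unfolding norm_vec_def by (rule L2_set_le_sum) simp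
      also have "\<dots> \<le> (\<Sum>i\<in>UNIV. \<Sum>j\<in>UNIV. \<bar>A $ i $ j\<bar>)" by (intro sum_mono norm_le_l1_cart)
      also have "\<dots> \<le> (\<Sum>i\<in>(UNIV :: 2 set). \<Sum>j\<in>(UNIV :: 2 set). R)"
      proof -
        have le: "\<bar>A $ i $ j\<bar> \<le> R" for i j using that by (simp add: K_def)
        show ?thesis by (intro sum_mono le)
      qed
      finally show ?thesis .
    qed
    then show "bounded K" by (auto simp: bounded_iff)
    have "closed {A :: real^2^2. det A = 1 \<and> \<bar>A $ 1 $ 1\<bar> \<le> R \<and> \<bar>A $ 1 $ 2\<bar> \<le> R \<and> \<bar>A $ 2 $ 1\<bar> \<le> R \<and> \<bar>A $ 2 $ 2\<bar> \<le> R}"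
      unfolding det_2 by (intro closed_Collect_conj closed_Collect_eq closed_Collect_le continuous_intros)
    then show "closed K" by (simp add: K_def forall_2 conj_assoc)
  qed
  then have "compactin (top_of_set (carrier SL2_real)) K"
    by (auto simp: compactin_subtopology K_def SL2_real_def)
  then have "compactin SL2_KS_topology (PiE real_embeddings (\<lambda>_ :: 'k \<Rightarrow> real. K))"
    unfolding SL2_KS_topology_def by (simp add: compactin_PiE)
  moreover have "PiE real_embeddings (\<lambda>_ :: 'k \<Rightarrow> real. K) =
      {h \<in> carrier SL2_KS. \<forall>\<sigma>\<in>real_embeddings. \<forall>i j. \<bar>h \<sigma> $ i $ j\<bar> \<le> R}"
    by (intro Set.set_eqI) (simp add: carrier_SL2_KS K_def PiE_iff ball_conj_distrib conj_ac)
  ultimately show ?thesis by simp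
qed

context quadratic_field
begin

section \<open>The arithmetic subgroup and a compactness criterion of Mahler type\<close>

lemma integral_SL2_mult:
  assumes "G \<in> integral_SL2" "H \<in> integral_SL2"
  shows "G ** H \<in> integral_SL2"
proof -
  have "algebraic_int ((G ** H) $ i $ j)" for i j
    using assms by (auto simp: integral_SL2_def matrix_matrix_mult_def sum_2 intro!: algebraic_int_add algebraic_int_mult)
  then show ?thesis using assms by (simp add: integral_SL2_def det_mul)
qed

lemma SL2_OK_eq: "SL2_OK = (\<lambda>G. \<lambda>\<sigma>\<in>real_embeddings. map_matrix \<sigma> G) ` integral_SL2"
  by (auto simp: SL2_OK_def integral_SL2_def)

lemma subgroup_SL2_OK: "subgroup (SL2_OK :: (('k \<Rightarrow> real) \<Rightarrow> real^2^2) set) SL2_KS"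
proof (rule group.subgroupI[OF group_SL2_KS])
  show sub: "SL2_OK \<subseteq> carrier (SL2_KS :: (('k \<Rightarrow> real) \<Rightarrow> real^2^2) monoid)"
    unfolding SL2_OK_eq carrier_SL2_KS integral_SL2_def
    by (auto simp: det_map_matrix embedding_1)
  have "mat 1 \<in> integral_SL2"
    by (auto simp: integral_SL2_def int_imp_algebraic_int) (simp add: mat_def int_imp_algebraic_int)
  then show "(SL2_OK :: (('k \<Rightarrow> real) \<Rightarrow> real^2^2) set) \<noteq> {}" by (auto simp: SL2_OK_eq)
  fix a b :: "('k \<Rightarrow> real) \<Rightarrow> real^2^2"
  assume a: "a \<in> SL2_OK"
  then obtain G where G: "G \<in> integral_SL2" "a = (\<lambda>\<sigma>\<in>real_embeddings. map_matrix \<sigma> G)"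
    by (auto simp: SL2_OK_eq)
  define H :: "'k^2^2" where "H = vector [vector [G $ 2 $ 2, - G $ 1 $ 2], vector [- G $ 2 $ 1, G $ 1 $ 1]]"
  have "H ** G = mat 1"
    using G(1) by (simp add: H_def vec_eq_iff forall_2 matrix_matrix_mult_def sum_2 mat_def integral_SL2_def det_2 algebra_simps)
  have H: "H \<in> integral_SL2"
    using G(1) by (auto simp: integral_SL2_def H_def forall_2 det_2 algebra_simps)
  define h where "h = (\<lambda>\<sigma>\<in>real_embeddings. map_matrix \<sigma> H)"
  have "h \<otimes>\<^bsub>SL2_KS\<^esub> a = \<one>\<^bsub>SL2_KS\<^esub>"
    unfolding mult_SL2_KS one_SL2_KS G(2) h_def
    by (rule restrict_ext) (simp add: \<open>H ** G = mat 1\<close> map_matrix_mat_1 flip: map_matrix_mult)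
  moreover have h: "h \<in> SL2_OK" using H by (auto simp: SL2_OK_eq h_def)
  ultimately have "inv\<^bsub>SL2_KS\<^esub> a = h"
    using a sub by (intro group.inv_equality[OF group_SL2_KS]) auto
  with h show "inv\<^bsub>SL2_KS\<^esub> a \<in> SL2_OK" by simp
  assume "b \<in> SL2_OK"
  then obtain G' where G': "G' \<in> integral_SL2" "b = (\<lambda>\<sigma>\<in>real_embeddings. map_matrix \<sigma> G')"
    by (auto simp: SL2_OK_eq)
  have "a \<otimes>\<^bsub>SL2_KS\<^esub> b = (\<lambda>\<sigma>\<in>real_embeddings. map_matrix \<sigma> (G ** G'))"
    unfolding mult_SL2_KS G(2) G'(2) by (rule restrict_ext) (simp add: map_matrix_mult)
  then show "a \<otimes>\<^bsub>SL2_KS\<^esub> b \<in> SL2_OK"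
    using integral_SL2_mult[OF G(1) G'(1)] by (auto simp: SL2_OK_eq)
qed

text \<open>The set in Mahler's criterion, with the product over the embeddings in place of the
  maximum.\<close>

definition thick_part :: "real \<Rightarrow> (('k \<Rightarrow> real) \<Rightarrow> real^2^2) set" where
  "thick_part c = {h \<in> carrier SL2_KS. \<forall>v\<in>integral_vectors.
     c \<le> sup_size (vec_act \<sigma>1 (h \<sigma>1) v) * sup_size (vec_act \<sigma>2 (h \<sigma>2) v)}"

lemma thick_part_subset: "thick_part c \<subseteq> carrier SL2_KS"
  by (auto simp: thick_part_def)

lemma thick_part_saturated:
  assumes \<gamma>: "\<gamma> \<in> SL2_OK" and h: "h \<in> thick_part c"
  shows "\<gamma> \<otimes>\<^bsub>SL2_KS\<^esub> h \<in> thick_part c"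
proof -
  obtain G where G: "G \<in> integral_SL2" "\<gamma> = (\<lambda>\<sigma>\<in>real_embeddings. map_matrix \<sigma> G)"
    using \<gamma> by (auto simp: SL2_OK_eq)
  have "\<gamma> \<in> carrier SL2_KS" using \<gamma> subgroup.subset[OF subgroup_SL2_OK] by blast
  then have "\<gamma> \<otimes>\<^bsub>SL2_KS\<^esub> h \<in> carrier SL2_KS"
    using h group.is_monoid[OF group_SL2_KS] monoid.m_closed by (fastforce simp: thick_part_def)
  moreover have "c \<le> sup_size (vec_act \<sigma>1 ((\<gamma> \<otimes>\<^bsub>SL2_KS\<^esub> h) \<sigma>1) v) * sup_size (vec_act \<sigma>2 ((\<gamma> \<otimes>\<^bsub>SL2_KS\<^esub> h) \<sigma>2) v)"
    if v: "v \<in> integral_vectors" for v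
  proof -
    \<comment> \<open>v' is the row vector v G. It is again integral and nonzero, by the adjugate of
      G, and its image under h is that of v under \<gamma> h.\<close>
    define v' :: "'k^2" where "v' = (\<chi> j. v $ 1 * G $ 1 $ j + v $ 2 * G $ 2 $ j)"
    have "v' \<noteq> 0"
    proof
      assume "v' = 0"
      then have 0: "v $ 1 * G $ 1 $ 1 + v $ 2 * G $ 2 $ 1 = 0" "v $ 1 * G $ 1 $ 2 + v $ 2 * G $ 2 $ 2 = 0"
        by (simp_all add: v'_def vec_eq_iff)
      have "v $ 1 * det G = (v $ 1 * G $ 1 $ 1 + v $ 2 * G $ 2 $ 1) * G $ 2 $ 2 - (v $ 1 * G $ 1 $ 2 + v $ 2 * G $ 2 $ 2) * G $ 2 $ 1"
        "v $ 2 * det G = (v $ 1 * G $ 1 $ 2 + v $ 2 * G $ 2 $ 2) * G $ 1 $ 1 - (v $ 1 * G $ 1 $ 1 + v $ 2 * G $ 2 $ 1) * G $ 1 $ 2"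
        by (simp_all add: det_2 algebra_simps)
      then have "v $ 1 = 0" "v $ 2 = 0" using 0 G(1) by (simp_all add: integral_SL2_def)
      then show False using v by (simp add: integral_vectors_def vec_eq_iff forall_2)
    qed
    then have "v' \<in> integral_vectors"
      using v G(1) by (auto simp: integral_vectors_def integral_SL2_def v'_def intro!: algebraic_int_add algebraic_int_mult)
    moreover have "vec_act \<sigma> ((\<gamma> \<otimes>\<^bsub>SL2_KS\<^esub> h) \<sigma>) v = vec_act \<sigma> (h \<sigma>) v'" if "\<sigma> \<in> real_embeddings" for \<sigma>
      using that by (simp add: G(2) mult_SL2_KS vec_eq_iff vec_act_nth v'_def matrix_matrix_mult_def sum_2
          map_matrix_def embedding_simps[OF that] algebra_simps)
    ultimately show ?thesis using h embedding1 embedding2 by (simp add: thick_part_def)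
  qed
  ultimately show ?thesis by (simp add: thick_part_def)
qed

lemma closedin_thick_part: "closedin SL2_KS_topology (thick_part c)"
\<comment> \<open>An intersection over an empty index set would be \<open>UNIV\<close> instead of
  the carrier.\<close>
proof (cases "integral_vectors = ({} :: ('k^2) set)")
  case True
  then show ?thesis by (simp add: thick_part_def flip: topspace_SL2_KS)
next
  case False
  have "thick_part c = (\<Inter>v\<in>integral_vectors. {h \<in> carrier SL2_KS.
     c \<le> sup_size (vec_act \<sigma>1 (h \<sigma>1) v) * sup_size (vec_act \<sigma>2 (h \<sigma>2) v)})"
    using False by (auto simp: thick_part_def)
  also have "closedin SL2_KS_topology \<dots>"
    unfolding sup_size_def vec_act_nth using False embedding1 embedding2
    by (intro closedin_INT closedin_SL2_KS_continuous_ge continuous_intros continuous_map_SL2_KS_entry) auto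
  finally show ?thesis .
qed

text \<open>Saturation identifies the preimage of the image with the closed set
  \<open>thick_part c\<close>, so the image is closed by the quotient map property. Reduction places
  it inside the image of a compact set of bounded matrices.\<close>

lemma compactin_thick_part:
  assumes "0 < c"
  shows "closedin SL2_quotient_topology ((\<lambda>g. SL2_OK #>\<^bsub>SL2_KS\<^esub> g) ` thick_part c)"
    and "compactin SL2_quotient_topology ((\<lambda>g. SL2_OK #>\<^bsub>SL2_KS\<^esub> g) ` thick_part c)"
proof -
  let ?\<pi> = "\<lambda>g. (SL2_OK :: (('k \<Rightarrow> real) \<Rightarrow> real^2^2) set) #>\<^bsub>SL2_KS\<^esub> g"
  interpret group "SL2_KS :: (('k \<Rightarrow> real) \<Rightarrow> real^2^2) monoid" by (rule group_SL2_KS)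
  interpret subgroup "SL2_OK :: (('k \<Rightarrow> real) \<Rightarrow> real^2^2) set" SL2_KS by (rule subgroup_SL2_OK)
  have qm: "quotient_map SL2_KS_topology SL2_quotient_topology ?\<pi>"
    unfolding SL2_quotient_topology_def by (rule quotient_map_quotient_topology)
  have pre: "{h \<in> topspace SL2_KS_topology. ?\<pi> h \<in> ?\<pi> ` thick_part c} = thick_part c"
  proof (intro equalityI subsetI)
    fix h assume "h \<in> {h \<in> topspace SL2_KS_topology. ?\<pi> h \<in> ?\<pi> ` thick_part c}"
    then have h: "h \<in> carrier SL2_KS" and "?\<pi> h \<in> ?\<pi> ` thick_part c"
      by (simp_all only: topspace_SL2_KS mem_Collect_eq)
    then obtain h' where h': "?\<pi> h = ?\<pi> h'" "h' \<in> thick_part c" by (elim imageE)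
    have "h \<in> ?\<pi> h'" using rcos_self[OF h subgroup_SL2_OK] unfolding h'(1) .
    then obtain \<gamma> where "\<gamma> \<in> SL2_OK" "h = \<gamma> \<otimes>\<^bsub>SL2_KS\<^esub> h'" unfolding r_coset_def by blast
    then show "h \<in> thick_part c" using thick_part_saturated h'(2) by simp
  next
    fix h assume "h \<in> thick_part c"
    then show "h \<in> {h \<in> topspace SL2_KS_topology. ?\<pi> h \<in> ?\<pi> ` thick_part c}"
      using thick_part_subset by (simp only: topspace_SL2_KS mem_Collect_eq) blast
  qed
  have sub: "?\<pi> ` thick_part c \<subseteq> topspace SL2_quotient_topology"
    using quotient_imp_surjective_map[OF qm] thick_part_subset by (auto simp: topspace_SL2_KS)
  have "closedin SL2_KS_topology {h \<in> topspace SL2_KS_topology. ?\<pi> h \<in> ?\<pi> ` thick_part c}"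
    unfolding pre by (rule closedin_thick_part)
  then show closed: "closedin SL2_quotient_topology (?\<pi> ` thick_part c)"
    using qm[unfolded quotient_map_closedin, THEN conjunct2, rule_format, OF sub] by (rule iffD1[rotated])
  obtain R where R: "\<And>A1 A2. \<lbrakk>det A1 = 1; det A2 = 1;
      \<And>v. v \<in> integral_vectors \<Longrightarrow> c \<le> sup_size (vec_act \<sigma>1 A1 v) * sup_size (vec_act \<sigma>2 A2 v)\<rbrakk>
    \<Longrightarrow> \<exists>G\<in>integral_SL2. \<forall>i j. \<bar>(map_matrix \<sigma>1 G ** A1) $ i $ j\<bar> \<le> R \<and> \<bar>(map_matrix \<sigma>2 G ** A2) $ i $ j\<bar> \<le> R"
    using bounded_by_SL2_OK[OF assms] by blast
  define K where "K = {h \<in> carrier SL2_KS. \<forall>\<sigma>\<in>(real_embeddings :: ('k \<Rightarrow> real) set). \<forall>i j. \<bar>h \<sigma> $ i $ j\<bar> \<le> R}"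
  have "compactin SL2_KS_topology K"
    unfolding K_def by (rule compactin_SL2_KS_bounded) (simp add: embeddings)
  then have comp: "compactin SL2_quotient_topology (?\<pi> ` K)"
    by (rule image_compactin) (rule quotient_imp_continuous_map[OF qm])
  have "?\<pi> ` thick_part c \<subseteq> ?\<pi> ` K"
  proof (rule image_subsetI)
    fix h assume h: "h \<in> thick_part c"
    then have hc: "h \<in> carrier SL2_KS" using thick_part_subset by blast
    then have "det (h \<sigma>1) = 1" "det (h \<sigma>2) = 1" using embedding1 embedding2 by (auto simp: carrier_SL2_KS)
    then obtain G where G: "G \<in> integral_SL2"
      "\<And>i j. \<bar>(map_matrix \<sigma>1 G ** h \<sigma>1) $ i $ j\<bar> \<le> R" "\<And>i j. \<bar>(map_matrix \<sigma>2 G ** h \<sigma>2) $ i $ j\<bar> \<le> R"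
      using R[of "h \<sigma>1" "h \<sigma>2"] h by (auto simp: thick_part_def)
    define \<gamma> where "\<gamma> = (\<lambda>\<sigma>\<in>real_embeddings. map_matrix \<sigma> G)"
    have \<gamma>: "\<gamma> \<in> SL2_OK" using G(1) by (auto simp: SL2_OK_eq \<gamma>_def)
    have "\<gamma> \<otimes>\<^bsub>SL2_KS\<^esub> h \<in> K"
    proof -
      have "\<gamma> \<otimes>\<^bsub>SL2_KS\<^esub> h \<in> carrier SL2_KS" using \<gamma> hc by simp
      moreover have "(\<gamma> \<otimes>\<^bsub>SL2_KS\<^esub> h) \<sigma> = map_matrix \<sigma> G ** h \<sigma>" if "\<sigma> \<in> real_embeddings" for \<sigma>
        using that by (simp add: mult_SL2_KS \<gamma>_def)
      ultimately show ?thesis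
        using G(2,3) embedding1 embedding2 unfolding K_def embeddings by simp
    qed
    moreover have "?\<pi> (\<gamma> \<otimes>\<^bsub>SL2_KS\<^esub> h) = ?\<pi> h"
      using coset_mult_assoc[OF subset, of \<gamma> h] coset_join2[OF _ subgroup_SL2_OK \<gamma>] \<gamma> hc by simp
    ultimately show "?\<pi> h \<in> ?\<pi> ` K" by (metis image_eqI)
  qed
  then show "compactin SL2_quotient_topology (?\<pi> ` thick_part c)"
    using closed_compactin[OF comp _ closed] by blast
qed

lemma bounded_trajectoryI:
  assumes "0 < c" and thick: "\<And>t. 0 \<le> t \<Longrightarrow> \<exists>h\<in>thick_part c. y #>\<^bsub>SL2_KS\<^esub> F t = SL2_OK #>\<^bsub>SL2_KS\<^esub> h"
  shows "bounded_trajectory y F"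
proof -
  have "{y #>\<^bsub>SL2_KS\<^esub> F t | t. t \<ge> 0} \<subseteq> (\<lambda>g. SL2_OK #>\<^bsub>SL2_KS\<^esub> g) ` thick_part c"
    using thick by blast
  then have "SL2_quotient_topology closure_of {y #>\<^bsub>SL2_KS\<^esub> F t | t. t \<ge> 0} \<subseteq> (\<lambda>g. SL2_OK #>\<^bsub>SL2_KS\<^esub> g) ` thick_part c"
    by (rule closure_of_minimal) (rule compactin_thick_part(1)[OF assms(1)])
  then show ?thesis
    unfolding bounded_trajectory_def
    by (rule closed_compactin[OF compactin_thick_part(2)[OF assms(1)]]) (rule closedin_closure_of)
qed

end

section \<open>Trajectories along the curve\<close>

text \<open>An equality of absolute values serves both the upper and the lower Lipschitz
  estimate.\<close>

lemma mean_value_within: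
  fixes f f' :: "real \<Rightarrow> real"
  assumes f: "\<And>x. x \<in> {a..b} \<Longrightarrow> (f has_real_derivative f' x) (at x within {a..b})"
    and xy: "x \<in> {a..b}" "y \<in> {a..b}"
  shows "\<exists>\<xi>\<in>{a..b}. \<bar>f x - f y\<bar> = \<bar>f' \<xi>\<bar> * \<bar>x - y\<bar>"
proof -
  have *: "\<exists>\<xi>\<in>{a..b}. \<bar>f x - f y\<bar> = \<bar>f' \<xi>\<bar> * \<bar>x - y\<bar>" if "x \<in> {a..b}" "y \<in> {a..b}" "x < y" for x y
  proof -
    have "\<exists>\<xi>\<in>{x<..<y}. f y - f x = (*) (f' \<xi>) (y - x)"
    proof (rule mvt_simple[OF that(3)])
      fix z assume "x \<le> z" "z \<le> y"
      then have "(f has_real_derivative f' z) (at z within {x..y})"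
        using that by (intro DERIV_subset[OF f]) auto
      then show "(f has_derivative (*) (f' z)) (at z within {x..y})" by (simp add: has_field_derivative_def)
    qed
    then obtain \<xi> where "\<xi> \<in> {x<..<y}" "f y - f x = f' \<xi> * (y - x)" by blast
    then show ?thesis using that by (intro bexI[of _ \<xi>]) (auto simp: abs_mult abs_minus_commute[of "f x"] abs_minus_commute[of x])
  qed
  consider "x < y" | "y < x" | "x = y" by linarith
  then show ?thesis
  proof cases
    case 1 then show ?thesis using *[of x y] xy by blast
  next
    case 2 then show ?thesis using *[of y x] xy by (simp add: abs_minus_commute)
  next
    case 3 then show ?thesis using xy by auto
  qed
qed

lemma unipotent_in_SL2_KS: "unipotent u \<in> carrier SL2_KS"
  by (auto simp: carrier_SL2_KS unipotent_def det_2)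

lemma diag_flow_in_SL2_KS: "diag_flow r t \<in> carrier SL2_KS"
  by (auto simp: carrier_SL2_KS diag_flow_def det_2 simp flip: exp_add)

lemma vec_act_translate:
  fixes g :: "('k::field_char_0 \<Rightarrow> real) \<Rightarrow> real^2^2" and v :: "'k^2"
  assumes "\<sigma> \<in> real_embeddings"
  defines "y \<equiv> vec_act \<sigma> (g \<sigma>) v"
  shows "sup_size (vec_act \<sigma> ((g \<otimes>\<^bsub>SL2_KS\<^esub> unipotent u \<otimes>\<^bsub>SL2_KS\<^esub> diag_flow r t) \<sigma>) v) =
     stretch (r \<sigma>) (y $ 1) (y $ 1 * u \<sigma> + y $ 2) t"
proof -
  have "vec_act \<sigma> ((g \<otimes>\<^bsub>SL2_KS\<^esub> unipotent u \<otimes>\<^bsub>SL2_KS\<^esub> diag_flow r t) \<sigma>) v $ 1 = y $ 1 * exp (- (r \<sigma> * t))"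
    "vec_act \<sigma> ((g \<otimes>\<^bsub>SL2_KS\<^esub> unipotent u \<otimes>\<^bsub>SL2_KS\<^esub> diag_flow r t) \<sigma>) v $ 2 = (y $ 1 * u \<sigma> + y $ 2) * exp (r \<sigma> * t)"
    using assms(1)
    by (simp_all add: mult_SL2_KS unipotent_def diag_flow_def y_def vec_act_nth matrix_matrix_mult_def sum_2 algebra_simps)
  then show ?thesis by (simp add: sup_size_def stretch_def abs_mult)
qed

context quadratic_field
begin

lemma swap: "quadratic_field \<theta> D \<sigma>2 \<sigma>1"
  using \<theta>_square basis embeddings \<sigma>2_\<theta> \<sigma>1_\<theta> by unfold_locales auto

text \<open>The source of \<open>c0\<close>. The coordinates of \<sigma>(v) are recovered from v A
  by the adjugate of A at the cost of a factor \<open>N A\<close>, and a nonzero coordinate has norm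
  at least 1 in absolute value.\<close>

lemma sup_size_lower_bound:
  assumes "det A1 = 1" "det A2 = 1"
  obtains c where "0 < c" "\<And>v. v \<in> integral_vectors \<Longrightarrow> c \<le> sup_size (vec_act \<sigma>1 A1 v) * sup_size (vec_act \<sigma>2 A2 v)"
proof -
  define N where "N = (\<lambda>A :: real^2^2. 1 + \<bar>A $ 1 $ 1\<bar> + \<bar>A $ 1 $ 2\<bar> + \<bar>A $ 2 $ 1\<bar> + \<bar>A $ 2 $ 2\<bar>)"
  have N: "0 < N A" for A by (simp add: N_def add_pos_nonneg)
  have le: "\<bar>\<sigma> (v $ k)\<bar> \<le> N A * sup_size (vec_act \<sigma> A v)" if "det A = 1" for \<sigma> :: "'k \<Rightarrow> real" and A v k
  proof -
    define y where "y = vec_act \<sigma> A v"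
    have "\<sigma> (v $ 1) * det A = y $ 1 * A $ 2 $ 2 - y $ 2 * A $ 2 $ 1" "\<sigma> (v $ 2) * det A = y $ 2 * A $ 1 $ 1 - y $ 1 * A $ 1 $ 2"
      by (simp_all add: y_def vec_act_nth det_2 algebra_simps)
    then have eq: "\<sigma> (v $ 1) = y $ 1 * A $ 2 $ 2 - y $ 2 * A $ 2 $ 1" "\<sigma> (v $ 2) = y $ 2 * A $ 1 $ 1 - y $ 1 * A $ 1 $ 2"
      using that by simp_all
    have "\<bar>y $ i * a - y $ j * b\<bar> \<le> (\<bar>a\<bar> + \<bar>b\<bar>) * sup_size y" for i j a b
    proof -
      have "\<bar>y $ i * a\<bar> \<le> sup_size y * \<bar>a\<bar>" "\<bar>y $ j * b\<bar> \<le> sup_size y * \<bar>b\<bar>"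
        unfolding abs_mult by (intro mult_right_mono component_le_sup_size; simp)+
      then show ?thesis by (simp add: algebra_simps)
    qed
    moreover have "(\<bar>A $ 2 $ 2\<bar> + \<bar>A $ 2 $ 1\<bar>) * sup_size y \<le> N A * sup_size y"
      "(\<bar>A $ 1 $ 1\<bar> + \<bar>A $ 1 $ 2\<bar>) * sup_size y \<le> N A * sup_size y"
      by (intro mult_right_mono sup_size_nonneg; simp add: N_def)+
    ultimately have "\<bar>\<sigma> (v $ 1)\<bar> \<le> N A * sup_size y" "\<bar>\<sigma> (v $ 2)\<bar> \<le> N A * sup_size y"
      unfolding eq using order_trans by blast+
    then show ?thesis using exhaust_2[of k] by (auto simp: y_def)
  qed
  show ?thesis
  proof (rule that[of "1 / (N A1 * N A2)"])
    show "0 < 1 / (N A1 * N A2)" using N by simp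
    fix v :: "'k^2" assume v: "v \<in> integral_vectors"
    then obtain k where k: "v $ k \<noteq> 0" by (auto simp: integral_vectors_def vec_eq_iff)
    have "algebraic_int (v $ k)" using v exhaust_2[of k] by (auto simp: integral_vectors_def)
    then have "1 \<le> \<bar>\<sigma>1 (v $ k) * \<sigma>2 (v $ k)\<bar>" using norm_less_1_imp_0 k by force
    also have "\<dots> \<le> (N A1 * sup_size (vec_act \<sigma>1 A1 v)) * (N A2 * sup_size (vec_act \<sigma>2 A2 v))"
      unfolding abs_mult using assms N[of A1] by (intro mult_mono le) (auto simp: sup_size_nonneg)
    finally show "1 / (N A1 * N A2) \<le> sup_size (vec_act \<sigma>1 A1 v) * sup_size (vec_act \<sigma>2 A2 v)"
      using N[of A1] N[of A2] by (simp add: divide_le_eq mult_ac)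
  qed
qed

lemma vec_det_algebraic_int:
  "v \<in> integral_vectors \<Longrightarrow> w \<in> integral_vectors \<Longrightarrow> algebraic_int (vec_det v w :: 'k)"
  unfolding vec_det_def integral_vectors_def by (auto intro!: algebraic_int_diff algebraic_int_mult)

lemma bounded_trajectory_thick:
  assumes g: "g \<in> carrier SL2_KS" and "0 < e"
    and e: "\<And>v t. \<lbrakk>v \<in> integral_vectors; 0 \<le> t\<rbrakk> \<Longrightarrow>
      e \<le> stretch (r \<sigma>1) (vec_act \<sigma>1 (g \<sigma>1) v $ 1) (vec_act \<sigma>1 (g \<sigma>1) v $ 1 * u \<sigma>1 + vec_act \<sigma>1 (g \<sigma>1) v $ 2) t *
          stretch (r \<sigma>2) (vec_act \<sigma>2 (g \<sigma>2) v $ 1) (vec_act \<sigma>2 (g \<sigma>2) v $ 1 * u \<sigma>2 + vec_act \<sigma>2 (g \<sigma>2) v $ 2) t"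
  shows "bounded_trajectory ((SL2_OK #>\<^bsub>SL2_KS\<^esub> g) #>\<^bsub>SL2_KS\<^esub> unipotent u) (diag_flow r)"
proof (rule bounded_trajectoryI[OF \<open>0 < e\<close>])
  fix t :: real assume t: "0 \<le> t"
  interpret group "SL2_KS :: (('k \<Rightarrow> real) \<Rightarrow> real^2^2) monoid" by (rule group_SL2_KS)
  let ?h = "g \<otimes>\<^bsub>SL2_KS\<^esub> unipotent u \<otimes>\<^bsub>SL2_KS\<^esub> diag_flow r t"
  note sub = subgroup.subset[OF subgroup_SL2_OK]
  have "?h \<in> carrier SL2_KS" using g unipotent_in_SL2_KS[of u] diag_flow_in_SL2_KS[of r t] by simp
  then have "?h \<in> thick_part e"
    using e[OF _ t] embedding1 embedding2 by (simp add: thick_part_def vec_act_translate)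
  moreover have "((SL2_OK #>\<^bsub>SL2_KS\<^esub> g) #>\<^bsub>SL2_KS\<^esub> unipotent u) #>\<^bsub>SL2_KS\<^esub> diag_flow r t = SL2_OK #>\<^bsub>SL2_KS\<^esub> ?h"
    using g unipotent_in_SL2_KS[of u] diag_flow_in_SL2_KS[of r t] sub by (simp add: coset_mult_assoc)
  ultimately show "\<exists>h\<in>thick_part e. (SL2_OK #>\<^bsub>SL2_KS\<^esub> g #>\<^bsub>SL2_KS\<^esub> unipotent u) #>\<^bsub>SL2_KS\<^esub> diag_flow r t = SL2_OK #>\<^bsub>SL2_KS\<^esub> h"
    by blast
qed

text \<open>On a closed interval without critical points, compactness bounds the curve and its
  derivative from above and \<bar>\<phi>_1'\<bar> away from 0; the mean value theorem turns this
  into the estimates that \<open>dangerous_sets\<close> expects.\<close>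

lemma cuttable_bounded_trajectories:
  fixes \<phi> \<phi>' :: "real \<Rightarrow> ('k \<Rightarrow> real) \<Rightarrow> real"
  assumes deriv: "\<And>\<sigma> x. \<sigma> \<in> real_embeddings \<Longrightarrow> x \<in> {0..1} \<Longrightarrow>
           ((\<lambda>x. \<phi> x \<sigma>) has_real_derivative \<phi>' x \<sigma>) (at x within {0..1})"
    and cont: "\<And>\<sigma>. \<sigma> \<in> real_embeddings \<Longrightarrow> continuous_on {0..1} (\<lambda>x. \<phi>' x \<sigma>)"
    and g: "g \<in> carrier SL2_KS"
    and r: "0 \<le> r \<sigma>2" "r \<sigma>2 \<le> r \<sigma>1" "0 < r \<sigma>1"
  shows "cuttable {x \<in> {0..1}. \<exists>\<sigma>\<in>real_embeddings. \<phi>' x \<sigma> = 0}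
     {x \<in> {0..1}. bounded_trajectory ((SL2_OK #>\<^bsub>SL2_KS\<^esub> g) #>\<^bsub>SL2_KS\<^esub> unipotent (\<phi> x)) (diag_flow r)}"
    (is "cuttable ?Z ?W")
  unfolding cuttable_def
proof (intro allI impI)
  fix \<gamma> \<rho> \<delta> a b :: real
  assume *: "0 < \<gamma> \<and> \<gamma> < 1 \<and> 0 < \<rho> \<and> 0 < \<delta> \<and> {a..b} \<subseteq> {0..1} - ?Z"
  then have J: "{a..b} \<subseteq> {0..1}" and nz: "\<And>\<sigma> x. \<lbrakk>\<sigma> \<in> real_embeddings; x \<in> {a..b}\<rbrakk> \<Longrightarrow> \<phi>' x \<sigma> \<noteq> 0"
    by auto
  define y1 y2 where "y1 = vec_act \<sigma>1 (g \<sigma>1)" and "y2 = vec_act \<sigma>2 (g \<sigma>2)"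
  have det: "det (g \<sigma>1) = 1" "det (g \<sigma>2) = 1" using g embedding1 embedding2 by (auto simp: carrier_SL2_KS)
  have derJ: "((\<lambda>x. \<phi> x \<sigma>) has_real_derivative \<phi>' x \<sigma>) (at x within {a..b})" if "\<sigma> \<in> real_embeddings" "x \<in> {a..b}" for \<sigma> x
    using DERIV_subset[OF deriv[OF that(1)] J] that(2) J by auto
  have contJ: "continuous_on {a..b} (\<lambda>x. \<phi>' x \<sigma>)" if "\<sigma> \<in> real_embeddings" for \<sigma>
    using cont[OF that] J by (rule continuous_on_subset)
  have bounded: "\<exists>M. \<forall>x\<in>{a..b}. \<bar>f x\<bar> \<le> M" if "continuous_on {a..b} f" for f :: "real \<Rightarrow> real"
    using compact_imp_bounded[OF compact_continuous_image[OF that]] by (auto simp: bounded_iff)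
  have contphi: "continuous_on {a..b} (\<lambda>x. \<phi> x \<sigma>)" if "\<sigma> \<in> real_embeddings" for \<sigma>
    by (rule DERIV_continuous_on[OF derJ[OF that]])
  obtain M1 M2 C1 C2 where M: "\<And>x. x \<in> {a..b} \<Longrightarrow> \<bar>\<phi> x \<sigma>1\<bar> \<le> M1" "\<And>x. x \<in> {a..b} \<Longrightarrow> \<bar>\<phi> x \<sigma>2\<bar> \<le> M2"
    and C: "\<And>x. x \<in> {a..b} \<Longrightarrow> \<bar>\<phi>' x \<sigma>1\<bar> \<le> C1" "\<And>x. x \<in> {a..b} \<Longrightarrow> \<bar>\<phi>' x \<sigma>2\<bar> \<le> C2"
    using bounded[OF contphi] bounded[OF contJ] embedding1 embedding2 by metis
  \<comment> \<open>On an empty interval \<open>M1\<close> to \<open>C2\<close> may be negative,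
    hence the maxima with 0.\<close>
  define M C where "M = max 0 (max M1 M2)" and "C = max 0 (max C1 C2)"
  obtain c where c: "0 < c" "\<And>x. x \<in> {a..b} \<Longrightarrow> c \<le> \<bar>\<phi>' x \<sigma>1\<bar>"
  proof (cases "a \<le> b")
    case True
    have "continuous_on {a..b} (\<lambda>x. \<bar>\<phi>' x \<sigma>1\<bar>)" using contJ embedding1 by (intro continuous_intros)
    then obtain x where "x \<in> {a..b}" "\<And>z. z \<in> {a..b} \<Longrightarrow> \<bar>\<phi>' x \<sigma>1\<bar> \<le> \<bar>\<phi>' z \<sigma>1\<bar>"
      using continuous_attains_inf[of "{a..b}" "\<lambda>x. \<bar>\<phi>' x \<sigma>1\<bar>"] True by auto
    then show ?thesis using that[of "\<bar>\<phi>' x \<sigma>1\<bar>"] nz embedding1 by auto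
  qed (use that[of 1] in auto)
  obtain c0 where c0: "0 < c0" "\<And>v. v \<in> integral_vectors \<Longrightarrow> c0 \<le> sup_size (y1 v) * sup_size (y2 v)"
    using sup_size_lower_bound[OF det] unfolding y1_def y2_def by blast
  have lip: "\<bar>\<phi> x \<sigma> - \<phi> y \<sigma>\<bar> \<le> C * \<bar>x - y\<bar>"
    if \<sigma>: "\<sigma> \<in> real_embeddings" and xy: "x \<in> {a..b}" "y \<in> {a..b}" for \<sigma> x y
  proof -
    obtain \<xi> where \<xi>: "\<xi> \<in> {a..b}" "\<bar>\<phi> x \<sigma> - \<phi> y \<sigma>\<bar> = \<bar>\<phi>' \<xi> \<sigma>\<bar> * \<bar>x - y\<bar>"
      using mean_value_within[OF derJ[OF \<sigma>] xy] by blast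
    have "\<sigma> = \<sigma>1 \<or> \<sigma> = \<sigma>2" using \<sigma> unfolding embeddings by blast
    then have "\<bar>\<phi>' \<xi> \<sigma>\<bar> \<le> C" using C[OF \<xi>(1)] by (auto simp: C_def le_max_iff_disj)
    then show ?thesis unfolding \<xi>(2) by (rule mult_right_mono) simp
  qed
  have colip: "c * \<bar>x - y\<bar> \<le> \<bar>\<phi> x \<sigma>1 - \<phi> y \<sigma>1\<bar>"
    if xy: "x \<in> {a..b}" "y \<in> {a..b}" for x y
  proof -
    obtain \<xi> where \<xi>: "\<xi> \<in> {a..b}" "\<bar>\<phi> x \<sigma>1 - \<phi> y \<sigma>1\<bar> = \<bar>\<phi>' \<xi> \<sigma>1\<bar> * \<bar>x - y\<bar>"
      using mean_value_within[OF derJ[OF embedding1] xy] by blast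
    show ?thesis unfolding \<xi>(2) by (rule mult_right_mono) (use c(2)[OF \<xi>(1)] in auto)
  qed
  \<comment> \<open>As det (g \<sigma>) = 1, the two determinants are the conjugates of
    \<open>vec_det v v'\<close>, and their product is its norm.\<close>
  have discrete: "y1 v $ 1 * y1 v' $ 2 - y1 v $ 2 * y1 v' $ 1 = 0"
    if v: "v \<in> integral_vectors" "v' \<in> integral_vectors"
      and small: "\<bar>(y1 v $ 1 * y1 v' $ 2 - y1 v $ 2 * y1 v' $ 1) * (y2 v $ 1 * y2 v' $ 2 - y2 v $ 2 * y2 v' $ 1)\<bar> < 1" for v v'
  proof -
    have eq: "y1 v $ 1 * y1 v' $ 2 - y1 v $ 2 * y1 v' $ 1 = \<sigma>1 (vec_det v v')"
      "y2 v $ 1 * y2 v' $ 2 - y2 v $ 2 * y2 v' $ 1 = \<sigma>2 (vec_det v v')"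
      using vec_det_act[OF embedding1, of "g \<sigma>1" v v'] vec_det_act[OF embedding2, of "g \<sigma>2" v v'] det
      unfolding y1_def y2_def by (simp_all add: vec_det_def)
    have "vec_det v v' = 0" using norm_less_1_imp_0[OF vec_det_algebraic_int[OF v]] small unfolding eq by blast
    then show ?thesis unfolding eq by (simp add: \<sigma>_simps)
  qed
  define G where "G = {x. \<exists>e>0. \<forall>v\<in>integral_vectors. \<forall>t\<ge>0.
      e \<le> stretch (r \<sigma>1) (y1 v $ 1) (y1 v $ 1 * \<phi> x \<sigma>1 + y1 v $ 2) t * stretch (r \<sigma>2) (y2 v $ 1) (y2 v $ 1 * \<phi> x \<sigma>2 + y2 v $ 2) t}"
  have "\<exists>E :: nat \<Rightarrow> real set. {a..b} \<subseteq> G \<union> (\<Union>m. E m) \<and>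
     (\<forall>m. \<forall>x\<in>E m \<inter> {a..b}. \<forall>y\<in>E m \<inter> {a..b}. \<bar>x - y\<bar> \<le> 2 * (\<gamma> ^ m * \<rho>) \<longrightarrow> \<bar>x - y\<bar> \<le> \<delta> * (\<gamma> ^ m * \<rho>))"
    unfolding G_def
  proof (rule dangerous_sets[OF r, where M = M and C = C and c = c and c0 = c0 and V = integral_vectors])
    show "0 \<le> M" "0 \<le> C" by (simp_all add: M_def C_def)
    show "\<bar>\<phi> x \<sigma>1\<bar> \<le> M" "\<bar>\<phi> x \<sigma>2\<bar> \<le> M" if "x \<in> {a..b}" for x
      using M[OF that] by (simp_all add: M_def le_max_iff_disj)
    show "c0 \<le> max \<bar>y1 v $ 1\<bar> \<bar>y1 v $ 2\<bar> * max \<bar>y2 v $ 1\<bar> \<bar>y2 v $ 2\<bar>" if "v \<in> integral_vectors" for v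
      using c0(2)[OF that] by (simp only: sup_size_def)
    show "\<bar>\<phi> x \<sigma>1 - \<phi> y \<sigma>1\<bar> \<le> C * \<bar>x - y\<bar>" "\<bar>\<phi> x \<sigma>2 - \<phi> y \<sigma>2\<bar> \<le> C * \<bar>x - y\<bar>"
      "c * \<bar>x - y\<bar> \<le> \<bar>\<phi> x \<sigma>1 - \<phi> y \<sigma>1\<bar>" if "x \<in> {a..b}" "y \<in> {a..b}" for x y
      using that lip[OF embedding1] lip[OF embedding2] colip by simp_all
  qed (use * c0(1) c(1) in \<open>simp_all only: discrete\<close>)
  then obtain E :: "nat \<Rightarrow> real set" where E: "{a..b} \<subseteq> G \<union> (\<Union>m. E m)"
     "\<forall>m. \<forall>x\<in>E m \<inter> {a..b}. \<forall>y\<in>E m \<inter> {a..b}. \<bar>x - y\<bar> \<le> 2 * (\<gamma> ^ m * \<rho>) \<longrightarrow> \<bar>x - y\<bar> \<le> \<delta> * (\<gamma> ^ m * \<rho>)"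
    by (elim exE conjE)
  have "{a..b} \<subseteq> ?W \<union> (\<Union>m. E m)"
  proof
    fix x assume x: "x \<in> {a..b}"
    show "x \<in> ?W \<union> (\<Union>m. E m)"
    proof (cases "x \<in> (\<Union>m. E m)")
      case False
      then have "x \<in> G" using E(1) x by blast
      then obtain e where "e > 0" and e: "\<forall>v\<in>integral_vectors. \<forall>t\<ge>0.
        e \<le> stretch (r \<sigma>1) (y1 v $ 1) (y1 v $ 1 * \<phi> x \<sigma>1 + y1 v $ 2) t * stretch (r \<sigma>2) (y2 v $ 1) (y2 v $ 1 * \<phi> x \<sigma>2 + y2 v $ 2) t"
        unfolding G_def mem_Collect_eq by (elim exE conjE)
      then have "bounded_trajectory ((SL2_OK #>\<^bsub>SL2_KS\<^esub> g) #>\<^bsub>SL2_KS\<^esub> unipotent (\<phi> x)) (diag_flow r)"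
        by (intro bounded_trajectory_thick[OF g \<open>e > 0\<close>] e[unfolded y1_def y2_def, rule_format])
      then show ?thesis using x J by blast
    qed blast
  qed
  then show "\<exists>D :: nat \<Rightarrow> real set. {a..b} \<subseteq> ?W \<union> (\<Union>m. D m) \<and>
      (\<forall>m. \<forall>x\<in>D m \<inter> {a..b}. \<forall>y\<in>D m \<inter> {a..b}.
         \<bar>x - y\<bar> \<le> 2 * (\<gamma> ^ m * \<rho>) \<longrightarrow> \<bar>x - y\<bar> \<le> \<delta> * (\<gamma> ^ m * \<rho>))"
    using E(2) by (intro exI[of _ E]) (rule conjI)
qed

end

theorem corollary1p4:
  fixes \<phi> \<phi>' :: "real \<Rightarrow> ('k::field_char_0 \<Rightarrow> real) \<Rightarrow> real"
    and g :: "('k \<Rightarrow> real) \<Rightarrow> real^2^2"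
    and \<Lambda> :: "(('k \<Rightarrow> real) \<Rightarrow> real^2^2) set"
  assumes "real_quadratic_field TYPE('k)"
    and "\<And>\<sigma> x. \<sigma> \<in> real_embeddings \<Longrightarrow> x \<in> {0..1} \<Longrightarrow>
           ((\<lambda>x. \<phi> x \<sigma>) has_real_derivative \<phi>' x \<sigma>) (at x within {0..1})"
    and "\<And>\<sigma>. \<sigma> \<in> real_embeddings \<Longrightarrow> continuous_on {0..1} (\<lambda>x. \<phi>' x \<sigma>)"
    and "finite {x \<in> {0..1}. \<exists>\<sigma>\<in>real_embeddings. \<phi>' x \<sigma> = 0}"
    and "g \<in> carrier SL2_KS"
    and "\<Lambda> = SL2_OK #>\<^bsub>SL2_KS\<^esub> g"
  shows "schmidt_winning {0..1}
           (\<Inter>r\<in>rational_weights.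
              {x \<in> {0..1}. bounded_trajectory (\<Lambda> #>\<^bsub>SL2_KS\<^esub> unipotent (\<phi> x)) (diag_flow r)})"
proof (rule schmidt_winning_INT_cuttable[OF assms(4)])
  obtain \<theta> :: 'k and D \<sigma>1 \<sigma>2 where "quadratic_field \<theta> D \<sigma>1 \<sigma>2"
    using real_quadratic_fieldE[OF assms(1)] by blast
  then interpret quadratic_field \<theta> D \<sigma>1 \<sigma>2 .
  interpret swapped: quadratic_field \<theta> D \<sigma>2 \<sigma>1 by (rule swap)
  \<comment> \<open>Rationality of the weights is used here: there are countably many functions from
    two embeddings to the rationals.\<close>
  have "countable ((real_embeddings :: ('k \<Rightarrow> real) set) \<rightarrow>\<^sub>E (\<rat> :: real set))"
    by (intro countable_PiE) (auto simp: embeddings countable_rat)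
  then show "countable (rational_weights :: (('k \<Rightarrow> real) \<Rightarrow> real) set)"
    by (rule countable_subset[rotated]) (auto simp: rational_weights_def)
  fix r :: "('k \<Rightarrow> real) \<Rightarrow> real"
  assume "r \<in> rational_weights"
  then have r: "0 \<le> r \<sigma>1" "0 \<le> r \<sigma>2" "r \<sigma>1 + r \<sigma>2 = 1"
    using \<sigma>_neq by (simp_all add: rational_weights_def embeddings)
  show "cuttable {x \<in> {0..1}. \<exists>\<sigma>\<in>real_embeddings. \<phi>' x \<sigma> = 0}
      {x \<in> {0..1}. bounded_trajectory (\<Lambda> #>\<^bsub>SL2_KS\<^esub> unipotent (\<phi> x)) (diag_flow r)}"
  \<comment> \<open>The larger weight is positive because the weights sum to 1; in the second case
    the swapped interpretation lets it play the role of the first.\<close>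
  proof (cases "r \<sigma>2 \<le> r \<sigma>1")
    case True
    then show ?thesis
      unfolding assms(6) using r by (intro cuttable_bounded_trajectories assms(2,3,5)) auto
  next
    case False
    then show ?thesis
      unfolding assms(6) using r by (intro swapped.cuttable_bounded_trajectories assms(2,3,5)) auto
  qed
qed

end
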